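(* Let $k$ be a field and let $k[s,t]$ be $\mathbb{N}^2$-graded with $|s|=(1,0)$, $|t|=(0,1)$. In the Serre quotient of the abelian category of finitely generated $\mathbb{N}^2$-graded $k[s,t]$-modules by the Serre subcategory of finite modules, every object decomposes, in a unique way (up to isomorphism and reordering of the summands), as a finite direct sum of objects of the following forms: (i) "vertical strips" $[a,b)_1 := s^{a}k[s,t]/s^{b}k[s,t]$, with $a<b$ in $\mathbb{N}$; (ii) "horizontal strips" $[a,b)_2 := t^{a}k[s,t]/t^{b}k[s,t]$, with $a<b$ in $\mathbb{N}$; (iii) "quadrants" $[(a_1,a_2),\infty) := s^{a_1}t^{a_2}k[s,t]$, with $(a_1,a_2)\in\mathbb{N}^2$.
   Context: Here $0\in\mathbb{N}$. All modules are $\mathbb{N}^2$-graded and all morphisms preserve bidegrees. A finitely generated module $M$ is finite if it is finitely supported, i.e. its graded piece $M(\vec d)$ is nonzero for only finitely many $\vec d\in\mathbb{N}^2$. The modules $s^{a}k[s,t]$, $t^a k[s,t]$, $s^{a_1}t^{a_2}k[s,t]$ are the principal graded ideals of $k[s,t]$ with their induced grading, and the modules in (i)–(iii) are regarded as objects of the Serre quotient via the quotient functor. *)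

theory Defs
  imports
    "HOL-Algebra.Module"
    "HOL-Algebra.Ideal"
    "HOL-Library.Poly_Mapping"
    "HOL-Library.Product_Plus"
    "HOL-Combinatorics.Permutations"
begin

section \<open>Graded modules over the polynomial ring in two variables\<close>

text \<open>
  \<open>k[s,t]\<close> is the monoid algebra of \<open>\<nat>\<^sup>2\<close> over \<open>k\<close>: the finitely supported functions
  \<open>\<nat>\<^sup>2 \<rightarrow> k\<close> with convolution product. \<open>single (i, j) c\<close> is the term \<open>c s\<^sup>i t\<^sup>j\<close>,
  of bidegree \<open>(i, j)\<close>.
\<close>

type_synonym 'k kst = "(nat \<times> nat) \<Rightarrow>\<^sub>0 'k"

definition kst_ring :: "'k::field kst ring" where
  "kst_ring = \<lparr>carrier = UNIV, monoid.mult = (*), one = 1, zero = 0, add = (+)\<rparr>"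

definition var_s :: "'k::field kst" where
  "var_s = Poly_Mapping.single (1, 0) 1"

definition var_t :: "'k::field kst" where
  "var_t = Poly_Mapping.single (0, 1) 1"

text \<open>
  The record of modules extends that of rings, but the locale of modules leaves the fields \<open>mult\<close>
  and \<open>one\<close> of the module itself unconstrained; no definition below depends on them.
\<close>

record ('r, 'm) gmodule = "('r, 'm) module" +
  piece :: "nat \<times> nat \<Rightarrow> 'm set"

text \<open>
  The third condition says that the module is the internal direct sum of its pieces. The fourth one,
  for \<open>e = 0\<close>, says that the pieces are stable under scalars from \<open>k\<close>.
\<close>

definition graded_module :: "('k::field kst, 'm) gmodule \<Rightarrow> bool" where
  "graded_module M \<longleftrightarrow>
     module kst_ring M \<and>
     (\<forall>d. additive_subgroup (piece M d) M) \<and>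
     (\<forall>x\<in>carrier M. \<exists>!c. (\<forall>d. c d \<in> piece M d) \<and> finite {d. c d \<noteq> \<zero>\<^bsub>M\<^esub>} \<and>
        x = (\<Oplus>\<^bsub>M\<^esub>d\<in>{d. c d \<noteq> \<zero>\<^bsub>M\<^esub>}. c d)) \<and>
     (\<forall>e a d. \<forall>x\<in>piece M d. Poly_Mapping.single e a \<odot>\<^bsub>M\<^esub> x \<in> piece M (e + d))"

definition finitely_generated :: "('k::field kst, 'm) gmodule \<Rightarrow> bool" where
  "finitely_generated M \<longleftrightarrow>
     (\<exists>A. finite A \<and> A \<subseteq> carrier M \<and>
        carrier M = {\<Oplus>\<^bsub>M\<^esub>a\<in>A. r a \<odot>\<^bsub>M\<^esub> a | r. r \<in> A \<rightarrow> carrier kst_ring})"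

definition fg_graded_module :: "('k::field kst, 'm) gmodule \<Rightarrow> bool" where
  "fg_graded_module M \<longleftrightarrow> graded_module M \<and> finitely_generated M"

definition finite_module :: "('k::field kst, 'm) gmodule \<Rightarrow> bool" where
  "finite_module M \<longleftrightarrow> fg_graded_module M \<and> finite {d. piece M d \<noteq> {\<zero>\<^bsub>M\<^esub>}}"

definition graded_hom ::
    "('k::field kst, 'm) gmodule \<Rightarrow> ('k kst, 'n) gmodule \<Rightarrow> ('m \<Rightarrow> 'n) set" where
  "graded_hom M N =
     {f \<in> hom (add_monoid M) (add_monoid N).
        (\<forall>r\<in>carrier kst_ring. \<forall>x\<in>carrier M. f (r \<odot>\<^bsub>M\<^esub> x) = r \<odot>\<^bsub>N\<^esub> f x) \<and>
        (\<forall>d. \<forall>x\<in>piece M d. f x \<in> piece N d)}"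

definition restrict_module :: "('k::field kst, 'm) gmodule \<Rightarrow> 'm set \<Rightarrow> ('k kst, 'm) gmodule" where
  "restrict_module M U = M\<lparr>carrier := U, piece := (\<lambda>d. U \<inter> piece M d)\<rparr>"

definition graded_submodule :: "'m set \<Rightarrow> ('k::field kst, 'm) gmodule \<Rightarrow> bool" where
  "graded_submodule U M \<longleftrightarrow> submodule U kst_ring M \<and> graded_module (restrict_module M U)"

text \<open>
  The quotient \<open>M/U\<close>, with the cosets of \<open>U\<close> as elements. For a nonempty subset \<open>X\<close> of a coset of
  \<open>U\<close>, the set \<open>U <+> X\<close> is that coset.
\<close>

definition quotient_module ::
    "('k::field kst, 'm) gmodule \<Rightarrow> 'm set \<Rightarrow> ('k kst, 'm set) gmodule" where
  "quotient_module M U =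
     \<lparr>carrier = a_rcosets\<^bsub>M\<^esub> U, monoid.mult = undefined, one = undefined,
      zero = U, add = set_add M,
      smult = (\<lambda>r X. U <+>\<^bsub>M\<^esub> ((\<lambda>x. r \<odot>\<^bsub>M\<^esub> x) ` X)),
      piece = (\<lambda>d. (\<lambda>x. U +>\<^bsub>M\<^esub> x) ` piece M d)\<rparr>"


section \<open>The Serre quotient\<close>

text \<open>
  The objects of the Serre quotient are the finitely generated graded modules; the quotient functor
  is the identity on objects. The morphisms from \<open>M\<close> to \<open>N\<close> are the elements of the filtered colimit
  of the groups \<open>Hom(U, N/V)\<close> over the subobjects \<open>U\<close> of \<open>M\<close> with \<open>M/U\<close> finite and the finite
  subobjects \<open>V\<close> of \<open>N\<close>. A subobject in the category of finitely generated graded modules is a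
  finitely generated graded submodule.
\<close>

definition cofinite_sub :: "('k::field kst, 'm) gmodule \<Rightarrow> 'm set \<Rightarrow> bool" where
  "cofinite_sub M U \<longleftrightarrow> graded_submodule U M \<and> finitely_generated (restrict_module M U) \<and>
     finite_module (quotient_module M U)"

definition finite_sub :: "('k::field kst, 'm) gmodule \<Rightarrow> 'm set \<Rightarrow> bool" where
  "finite_sub M V \<longleftrightarrow> graded_submodule V M \<and> finite_module (restrict_module M V)"

type_synonym ('m, 'n) qrep = "'m set \<times> 'n set \<times> ('m \<Rightarrow> 'n set)"

definition qreps ::
    "('k::field kst, 'm) gmodule \<Rightarrow> ('k kst, 'n) gmodule \<Rightarrow> ('m, 'n) qrep set" where
  "qreps M N = {(U, V, f). cofinite_sub M U \<and> finite_sub N V \<and>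
     f \<in> graded_hom (restrict_module M U) (quotient_module N V)}"

text \<open>
  Two representatives agree in the colimit if they induce the same map \<open>U'' \<rightarrow> N/V''\<close> for some
  smaller \<open>U''\<close> and some larger \<open>V''\<close>. The map \<open>N/V \<rightarrow> N/V''\<close> sends a coset \<open>X\<close> to \<open>V'' <+> X\<close>.
\<close>

definition qrel :: "('k::field kst, 'm) gmodule \<Rightarrow> ('k kst, 'n) gmodule \<Rightarrow>
    (('m, 'n) qrep \<times> ('m, 'n) qrep) set" where
  "qrel M N = {((U, V, f), (U', V', f')).
     (U, V, f) \<in> qreps M N \<and> (U', V', f') \<in> qreps M N \<and>
     (\<exists>U'' V''. cofinite_sub M U'' \<and> U'' \<subseteq> U \<inter> U' \<and> finite_sub N V'' \<and> V \<union> V' \<subseteq> V'' \<and>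
        (\<forall>x\<in>U''. V'' <+>\<^bsub>N\<^esub> f x = V'' <+>\<^bsub>N\<^esub> f' x))}"

definition qhom ::
    "('k::field kst, 'm) gmodule \<Rightarrow> ('k kst, 'n) gmodule \<Rightarrow> ('m, 'n) qrep set set" where
  "qhom M N = qreps M N // qrel M N"

definition qid :: "('k::field kst, 'm) gmodule \<Rightarrow> ('m, 'm) qrep set" where
  "qid M = qrel M M `` {(carrier M, {\<zero>\<^bsub>M\<^esub>}, \<lambda>x. {\<zero>\<^bsub>M\<^esub>} +>\<^bsub>M\<^esub> x)}"

text \<open>
  Let \<open>f : U \<rightarrow> N/V\<close> and \<open>g : W \<rightarrow> P/X\<close> with \<open>W\<close> a submodule of \<open>N\<close>. The composite is
  \<open>U' \<rightarrow> (W + V)/V \<cong> W/(V \<inter> W) \<rightarrow> P/X'\<close>, where \<open>U'\<close> is the preimage of \<open>(W + V)/V\<close>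
  under \<open>f\<close> and \<open>X'\<close> is the preimage of \<open>g(V \<inter> W)\<close> in \<open>P\<close>. The isomorphism sends the coset \<open>f x\<close>
  of \<open>V\<close> to the coset \<open>f x \<inter> W\<close> of \<open>V \<inter> W\<close>. The cosets \<open>g y\<close> with \<open>y\<close> in \<open>f x \<inter> W\<close> together
  form one coset of \<open>X'\<close>.
\<close>

definition rep_comp :: "('n, 'p) qrep \<Rightarrow> ('m, 'n) qrep \<Rightarrow> ('m, 'p) qrep" where
  "rep_comp = (\<lambda>(W, X, g) (U, V, f).
     ({x \<in> U. f x \<inter> W \<noteq> {}}, \<Union>y\<in>V \<inter> W. g y, \<lambda>x. \<Union>y\<in>f x \<inter> W. g y))"

definition qcomp :: "('k::field kst, 'm) gmodule \<Rightarrow> ('k kst, 'p) gmodule \<Rightarrow>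
    ('n, 'p) qrep set \<Rightarrow> ('m, 'n) qrep set \<Rightarrow> ('m, 'p) qrep set" where
  "qcomp M P G F = (\<Union>g\<in>G. \<Union>f\<in>F. qrel M P `` {rep_comp g f})"

definition rep_add ::
    "('k::field kst, 'n) gmodule \<Rightarrow> ('m, 'n) qrep \<Rightarrow> ('m, 'n) qrep \<Rightarrow> ('m, 'n) qrep" where
  "rep_add N = (\<lambda>(U, V, f) (U', V', f').
     (U \<inter> U', V <+>\<^bsub>N\<^esub> V', \<lambda>x. f x <+>\<^bsub>N\<^esub> f' x))"

definition qadd :: "('k::field kst, 'm) gmodule \<Rightarrow> ('k kst, 'n) gmodule \<Rightarrow>
    ('m, 'n) qrep set \<Rightarrow> ('m, 'n) qrep set \<Rightarrow> ('m, 'n) qrep set" where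
  "qadd M N F G = (\<Union>f\<in>F. \<Union>g\<in>G. qrel M N `` {rep_add N f g})"

definition qzero ::
    "('k::field kst, 'm) gmodule \<Rightarrow> ('k kst, 'n) gmodule \<Rightarrow> ('m, 'n) qrep set" where
  "qzero M N = qrel M N `` {(carrier M, {\<zero>\<^bsub>N\<^esub>}, \<lambda>x. {\<zero>\<^bsub>N\<^esub>})}"

text \<open>The additive group of morphisms; the monoid operation is addition.\<close>

definition qhom_group ::
    "('k::field kst, 'm) gmodule \<Rightarrow> ('k kst, 'n) gmodule \<Rightarrow> ('m, 'n) qrep set monoid" where
  "qhom_group M N = \<lparr>carrier = qhom M N, monoid.mult = qadd M N, one = qzero M N\<rparr>"

definition qiso :: "('k::field kst, 'm) gmodule \<Rightarrow> ('k kst, 'n) gmodule \<Rightarrow> bool" where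
  "qiso M N \<longleftrightarrow>
     (\<exists>F\<in>qhom M N. \<exists>G\<in>qhom N M. qcomp M M G F = qid M \<and> qcomp N N F G = qid N)"

text \<open>
  \<open>M\<close> is the direct sum (biproduct) in the Serre quotient of the objects in the list \<open>Ss\<close>, with
  inclusions \<open>\<iota> j\<close> and projections \<open>\<pi> j\<close>. The last equation reads \<open>\<Sum>\<^sub>j \<iota> j \<circ> \<pi> j = id\<close>. The
  direct sum of the empty list is a zero object.
\<close>

definition is_qdirect_sum ::
    "('k::field kst, 'm) gmodule \<Rightarrow> ('k kst, 'n) gmodule list \<Rightarrow> bool" where
  "is_qdirect_sum M Ss \<longleftrightarrow>
     (\<exists>\<iota> \<pi>.
        (\<forall>j<length Ss. \<iota> j \<in> qhom (Ss ! j) M \<and> \<pi> j \<in> qhom M (Ss ! j)) \<and>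
        (\<forall>j<length Ss. \<forall>l<length Ss.
           qcomp (Ss ! l) (Ss ! j) (\<pi> j) (\<iota> l) =
             (if l = j then qid (Ss ! j) else qzero (Ss ! l) (Ss ! j))) \<and>
        finprod (qhom_group M M) (\<lambda>j. qcomp M M (\<iota> j) (\<pi> j)) {..<length Ss} = qid M)"


section \<open>Strips and quadrants\<close>

definition kst_module :: "('k::field kst, 'k kst) gmodule" where
  "kst_module =
     \<lparr>carrier = UNIV, monoid.mult = (*), one = 1, zero = 0, add = (+), smult = (*),
      piece = (\<lambda>d. range (Poly_Mapping.single d))\<rparr>"

definition principal :: "'k::field kst \<Rightarrow> ('k kst, 'k kst) gmodule" where
  "principal p = restrict_module kst_module (PIdl\<^bsub>kst_ring\<^esub> p)"

definition vertical_strip :: "nat \<Rightarrow> nat \<Rightarrow> ('k::field kst, 'k kst set) gmodule" where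
  "vertical_strip a b = quotient_module (principal (var_s ^ a)) (PIdl\<^bsub>kst_ring\<^esub> (var_s ^ b))"

definition horizontal_strip :: "nat \<Rightarrow> nat \<Rightarrow> ('k::field kst, 'k kst set) gmodule" where
  "horizontal_strip a b = quotient_module (principal (var_t ^ a)) (PIdl\<^bsub>kst_ring\<^esub> (var_t ^ b))"

text \<open>
  A quadrant is the ideal \<open>s\<^sup>a t\<^sup>b k[s,t]\<close> itself. Its element \<open>x\<close> is written as the singleton
  \<open>{x}\<close>, a coset of the zero ideal, so that all summands have the same element type.
\<close>

definition quadrant :: "nat \<times> nat \<Rightarrow> ('k::field kst, 'k kst set) gmodule" where
  "quadrant = (\<lambda>(a1, a2). quotient_module (principal (var_s ^ a1 * var_t ^ a2)) {0})"

inductive strip_or_quadrant :: "('k::field kst, 'k kst set) gmodule \<Rightarrow> bool" where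
  vertical: "a < b \<Longrightarrow> strip_or_quadrant (vertical_strip a b)"
| horizontal: "a < b \<Longrightarrow> strip_or_quadrant (horizontal_strip a b)"
| quadrant: "strip_or_quadrant (quadrant a)"

end

theory Submission
  imports "HOL.Vector_Spaces" Defs "HOL-Library.Product_Order" "HOL-Library.Function_Algebras"
begin

text \<open>
  Why the theorem is true. A morphism \<open>M \<rightarrow> N\<close> of the Serre quotient is represented by a map
  \<open>U \<rightarrow> N/V\<close>, where \<open>U\<^sub>d = M\<^sub>d\<close> and \<open>V\<^sub>d = 0\<close> for all but finitely many bidegrees \<open>d\<close>. What it
  does in the remaining bidegrees is lost in the colimit. Hence the morphisms are the germs at
  infinity of families of linear maps \<open>M\<^sub>d \<rightarrow> N\<^sub>d\<close> that commute with the monomials, and composition and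
  addition are those of germs (\<open>qcomp_germ_class\<close>, \<open>qadd_germ_class\<close>). In these terms a direct
  sum decomposition of \<open>M\<close> into strips and quadrants is a frame: a family of vectors that form a
  basis of \<open>M\<^sub>d\<close> for almost all \<open>d\<close> and that each monomial sends to one another or to zero
  (\<open>frame_imp_qdirect_sum\<close>, \<open>qdirect_sum_imp_frame\<close>).

  Existence. For large \<open>N\<close>, the bidegrees outside the box \<open>[0, N)\<^sup>2\<close> carry a finite diagram of vector
  spaces \<open>V\<^sub>0 \<rightarrow> V\<^sub>1 \<rightarrow> \<dots> \<rightarrow> W \<leftarrow> \<dots> \<leftarrow> H\<^sub>1 \<leftarrow> H\<^sub>0\<close> with \<open>V\<^sub>i = M\<^bsub>(i,N)\<^esub>\<close>, \<open>H\<^sub>j = M\<^bsub>(N,j)\<^esub>\<close> and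
  \<open>W = M\<^bsub>(N,N)\<^esub>\<close>, a representation of a quiver of type A. Its indecomposable summands are intervals:
  those inside the left arm are vertical strips, those inside the right arm are horizontal strips,
  and those through \<open>W\<close> are quadrants. To see this by linear algebra, write \<open>M\<^sub>d\<close> as \<open>F\<^sub>d/K\<^sub>d\<close>, where
  \<open>F\<^sub>d\<close> is spanned by the generators of bidegree at most \<open>d\<close> and \<open>K\<^sub>d\<close> consists of their relations,
  inside one finite-dimensional space \<open>E\<close>. Both families increase with \<open>d\<close> and become stationary
  (\<open>subspaces_stable\<close>). Two flags in a vector space have a common adapted basis
  (\<open>two_flags\<close>). With \<open>K = K\<^bsub>(N,N)\<^esub>\<close>, the flags \<open>F\<^bsub>(i,N)\<^esub> + K\<close> and \<open>F\<^bsub>(N,j)\<^esub> + K\<close> in \<open>E\<close> yield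
  the quadrants, the flags \<open>F\<^bsub>(i,N)\<^esub> \<inter> K\<close> and \<open>K\<^bsub>(i,N)\<^esub>\<close> in \<open>K\<close> yield the vertical strips, and the
  flags \<open>F\<^bsub>(N,j)\<^esub> \<inter> K\<close> and \<open>K\<^bsub>(N,j)\<^esub>\<close> the horizontal ones (\<open>adapted_decomposition\<close>).

  Uniqueness. For bidegrees \<open>p, q \<le> r\<close> far out, the dimension of
  \<open>im(M\<^sub>p \<rightarrow> M\<^sub>r) \<inter> im(M\<^sub>q \<rightarrow> M\<^sub>r)\<close> is the number of summands whose support contains \<open>p\<close>, \<open>q\<close> and \<open>r\<close>
  (\<open>frame_count_le\<close>). Each strip or quadrant \<open>\<tau>\<close> has three such bidegrees for which these summands are
  exactly the ones that contain \<open>\<tau>\<close> up to finitely many bidegrees. So the number of summands above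
  \<open>\<tau>\<close> is an invariant of \<open>M\<close> for every \<open>\<tau>\<close>, and these numbers determine the multiset of summands
  (\<open>multiset_eq_if_counts_below\<close>).
\<close>

section \<open>Graded modules and their homogeneous components\<close>

(* Bidegrees are handled as single elements; quantifiers over them stay unsplit. *)
declare split_paired_All [simp del] split_paired_Ex [simp del]

lemma kst_ring_simps [simp]:
  "carrier kst_ring = UNIV" "x \<otimes>\<^bsub>kst_ring\<^esub> y = x * y" "\<one>\<^bsub>kst_ring\<^esub> = 1"
  "\<zero>\<^bsub>kst_ring\<^esub> = 0" "x \<oplus>\<^bsub>kst_ring\<^esub> y = x + y"
  by (simp_all add: kst_ring_def)

lemma cring_kst_ring: "cring (kst_ring :: 'k::field kst ring)"
proof (rule cringI)
  show "abelian_group (kst_ring :: 'k kst ring)"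
  proof (rule abelian_groupI)
    fix x :: "'k kst"
    show "\<exists>y\<in>carrier kst_ring. y \<oplus>\<^bsub>kst_ring\<^esub> x = \<zero>\<^bsub>kst_ring\<^esub>"
      by (rule bexI[of _ "- x"]) auto
  qed (auto simp: algebra_simps)
  show "comm_monoid (kst_ring :: 'k kst ring)"
    by (rule comm_monoidI) (auto simp: algebra_simps)
qed (auto simp: algebra_simps)

text \<open>
  The action of the term \<open>c s\<^sup>i t\<^sup>j\<close>, for \<open>e = (i, j)\<close>.
\<close>

abbreviation mact :: "('k::field kst, 'm) gmodule \<Rightarrow> nat \<times> nat \<Rightarrow> 'k \<Rightarrow> 'm \<Rightarrow> 'm" where
  "mact M e c x \<equiv> Poly_Mapping.single e c \<odot>\<^bsub>M\<^esub> x"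

definition component :: "('k::field kst, 'm) gmodule \<Rightarrow> 'm \<Rightarrow> nat \<times> nat \<Rightarrow> 'm" where
  "component M x = (THE c. (\<forall>d. c d \<in> piece M d) \<and> finite {d. c d \<noteq> \<zero>\<^bsub>M\<^esub>} \<and>
     x = (\<Oplus>\<^bsub>M\<^esub>d\<in>{d. c d \<noteq> \<zero>\<^bsub>M\<^esub>}. c d))"

lemma (in abelian_group) minus_zeroD:
  assumes "x \<in> carrier G" "y \<in> carrier G" "x \<ominus> y = \<zero>"
  shows "x = y"
  using assms minus_equality[of x "\<ominus> y"] by (simp add: a_minus_def)

text \<open>
  Additivity is required on a subset \<open>P\<close> only: a germ is additive on each graded piece, and a
  representative of a morphism on the submodule where it is defined.
\<close>

lemma hom_finsum:
  assumes "abelian_monoid M" "abelian_monoid N"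
    and "P \<subseteq> carrier M" "\<zero>\<^bsub>M\<^esub> \<in> P" "\<And>x y. x \<in> P \<Longrightarrow> y \<in> P \<Longrightarrow> x \<oplus>\<^bsub>M\<^esub> y \<in> P"
    and "\<And>x. x \<in> P \<Longrightarrow> f x \<in> carrier N" "f \<zero>\<^bsub>M\<^esub> = \<zero>\<^bsub>N\<^esub>"
    and "\<And>x y. x \<in> P \<Longrightarrow> y \<in> P \<Longrightarrow> f (x \<oplus>\<^bsub>M\<^esub> y) = f x \<oplus>\<^bsub>N\<^esub> f y"
    and "finite A" "\<And>i. i \<in> A \<Longrightarrow> c i \<in> P"
  shows "(\<Oplus>\<^bsub>M\<^esub>i\<in>A. c i) \<in> P \<and> f (\<Oplus>\<^bsub>M\<^esub>i\<in>A. c i) = (\<Oplus>\<^bsub>N\<^esub>i\<in>A. f (c i))"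
  using \<open>finite A\<close> assms(10)
proof (induction A)
  case empty
  then show ?case
    using assms by (simp add: abelian_monoid.finsum_empty)
next
  case (insert a A)
  have 1: "(\<Oplus>\<^bsub>M\<^esub>i\<in>insert a A. c i) = c a \<oplus>\<^bsub>M\<^esub> (\<Oplus>\<^bsub>M\<^esub>i\<in>A. c i)"
    using insert assms(3) by (intro abelian_monoid.finsum_insert[OF assms(1)]) auto
  have 2: "(\<Oplus>\<^bsub>N\<^esub>i\<in>insert a A. f (c i)) = f (c a) \<oplus>\<^bsub>N\<^esub> (\<Oplus>\<^bsub>N\<^esub>i\<in>A. f (c i))"
    using insert assms(6) by (intro abelian_monoid.finsum_insert[OF assms(2)]) auto
  show ?case
    unfolding 1 2 using insert assms(5,8) by auto
qed

lemma finsum_in: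
  assumes "abelian_monoid M" "P \<subseteq> carrier M" "\<zero>\<^bsub>M\<^esub> \<in> P"
    and "\<And>x y. x \<in> P \<Longrightarrow> y \<in> P \<Longrightarrow> x \<oplus>\<^bsub>M\<^esub> y \<in> P"
    and "finite A" "\<And>i. i \<in> A \<Longrightarrow> c i \<in> P"
  shows "(\<Oplus>\<^bsub>M\<^esub>i\<in>A. c i) \<in> P"
  using hom_finsum[of M M P "\<lambda>x. x" A c] assms by auto

locale graded_kst_module =
  fixes M :: "('k::field kst, 'm) gmodule" (structure)
  assumes graded: "graded_module M"

sublocale graded_kst_module \<subseteq> module kst_ring M
  using graded by (simp add: graded_module_def)

context graded_kst_module
begin

lemma piece_subgroup: "subgroup (piece M d) (add_monoid M)"
  using graded by (auto simp: graded_module_def additive_subgroup_def)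

lemma piece_closed [intro]: "x \<in> piece M d \<Longrightarrow> x \<in> carrier M"
  using subgroup.subset[OF piece_subgroup, of d] by auto

lemma zero_piece [simp, intro]: "\<zero> \<in> piece M d"
  using subgroup.one_closed[OF piece_subgroup] by simp

lemma add_piece [intro]: "x \<in> piece M d \<Longrightarrow> y \<in> piece M d \<Longrightarrow> x \<oplus> y \<in> piece M d"
  using subgroup.m_closed[OF piece_subgroup] by simp

lemma neg_piece [intro]: "x \<in> piece M d \<Longrightarrow> \<ominus> x \<in> piece M d"
  using subgroup.m_inv_closed[OF piece_subgroup] by (simp add: a_inv_def)

lemma act_piece [intro]: "x \<in> piece M d \<Longrightarrow> mact M e c x \<in> piece M (e + d)"
  using graded by (auto simp: graded_module_def)

lemma act0_piece [intro]: "x \<in> piece M d \<Longrightarrow> mact M 0 c x \<in> piece M d"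
  using act_piece[of x d 0 c] by simp

lemma act_closed [simp, intro]: "x \<in> carrier M \<Longrightarrow> r \<odot> x \<in> carrier M"
  by simp

lemma act_act: "x \<in> carrier M \<Longrightarrow> mact M e c (mact M e' c' x) = mact M (e + e') (c * c') x"
  using smult_assoc1[of "Poly_Mapping.single e c" "Poly_Mapping.single e' c'" x]
  by (simp add: mult_single)

lemma act_add_left: "x \<in> carrier M \<Longrightarrow> mact M e (c + c') x = mact M e c x \<oplus> mact M e c' x"
  using smult_l_distr[of "Poly_Mapping.single e c" "Poly_Mapping.single e c'" x]
  by (simp add: single_add)

lemma act_add_right:
  "x \<in> carrier M \<Longrightarrow> y \<in> carrier M \<Longrightarrow> r \<odot> (x \<oplus> y) = r \<odot> x \<oplus> r \<odot> y"
  by (simp add: smult_r_distr)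

lemma act_zero_left [simp]: "x \<in> carrier M \<Longrightarrow> (0 :: 'k kst) \<odot> x = \<zero>"
  using smult_l_null[of x] by simp

lemma act_zero_right [simp]: "r \<odot> \<zero> = \<zero>"
  by (rule smult_r_null) simp

lemma act_one [simp]: "x \<in> carrier M \<Longrightarrow> mact M 0 1 x = x"
  using smult_one[of x] by simp

lemma act_one' [simp]: "x \<in> carrier M \<Longrightarrow> (1 :: 'k kst) \<odot> x = x"
  using smult_one[of x] by simp

lemma act_neg: "x \<in> carrier M \<Longrightarrow> mact M e (- c) x = \<ominus> (mact M e c x)"
proof -
  assume x: "x \<in> carrier M"
  have "mact M e (- c) x \<oplus> mact M e c x = \<zero>"
    using act_add_left[OF x, of e "- c" c] x by simp
  then show ?thesis using x by (simp add: M.minus_equality)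
qed

lemma neg_eq: "x \<in> carrier M \<Longrightarrow> \<ominus> x = mact M 0 (- 1) x"
  using act_neg[of x 0 1] by simp

lemma component_ex:
  assumes "x \<in> carrier M"
  shows "\<exists>!c. (\<forall>d. c d \<in> piece M d) \<and> finite {d. c d \<noteq> \<zero>} \<and> x = (\<Oplus>d\<in>{d. c d \<noteq> \<zero>}. c d)"
  using graded assms by (auto simp: graded_module_def)

lemma component:
  assumes "x \<in> carrier M"
  shows component_piece [intro]: "component M x d \<in> piece M d"
    and finite_support: "finite {d. component M x d \<noteq> \<zero>}"
    and component_sum: "x = (\<Oplus>d\<in>{d. component M x d \<noteq> \<zero>}. component M x d)"
  using theI'[OF component_ex[OF assms], folded component_def] by simp_all

lemma component_closed [simp, intro]: "x \<in> carrier M \<Longrightarrow> component M x d \<in> carrier M"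
  by blast

lemma finsum_support:
  assumes "finite D" "\<And>d. d \<in> D \<Longrightarrow> c d \<in> carrier M" "\<And>d. d \<notin> D \<Longrightarrow> c d = \<zero>"
  shows "(\<Oplus>d\<in>D. c d) = (\<Oplus>d\<in>{d. c d \<noteq> \<zero>}. c d)"
  using assms by (intro M.add.finprod_mono_neutral_cong_right) auto

lemma component_sum':
  assumes "x \<in> carrier M" "finite D" "\<And>d. d \<notin> D \<Longrightarrow> component M x d = \<zero>"
  shows "x = (\<Oplus>d\<in>D. component M x d)"
  using component_sum[OF assms(1)] finsum_support[OF assms(2), of "component M x"] assms by auto

lemma component_unique:
  assumes "finite D" "\<And>d. c d \<in> piece M d" "\<And>d. d \<notin> D \<Longrightarrow> c d = \<zero>" "x = (\<Oplus>d\<in>D. c d)"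
  shows "component M x = c"
proof -
  have x: "x \<in> carrier M"
    using assms by (auto intro!: M.finsum_closed)
  have "finite {d. c d \<noteq> \<zero>}"
    using assms(3) by (intro finite_subset[OF _ assms(1)]) blast
  moreover have "x = (\<Oplus>d\<in>{d. c d \<noteq> \<zero>}. c d)"
    using finsum_support[OF assms(1), of c] assms by auto
  ultimately show ?thesis
    using component[OF x] component_ex[OF x] assms(2) by metis
qed

lemma component_add:
  assumes "x \<in> carrier M" "y \<in> carrier M"
  shows "component M (x \<oplus> y) d = component M x d \<oplus> component M y d"
proof -
  let ?D = "{d. component M x d \<noteq> \<zero>} \<union> {d. component M y d \<noteq> \<zero>}"
  have fin: "finite ?D" using finite_support assms by auto
  have "component M (x \<oplus> y) = (\<lambda>d. component M x d \<oplus> component M y d)"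
  proof (rule component_unique[OF fin])
    have "x = (\<Oplus>d\<in>?D. component M x d)" "y = (\<Oplus>d\<in>?D. component M y d)"
      using fin assms by (auto intro!: component_sum')
    then show "x \<oplus> y = (\<Oplus>d\<in>?D. component M x d \<oplus> component M y d)"
      using assms by (subst M.finsum_addf) auto
  qed (use assms in auto)
  then show ?thesis by simp
qed

lemma component_homogeneous:
  assumes "x \<in> piece M d"
  shows "component M x e = (if e = d then x else \<zero>)"
proof -
  have "component M x = (\<lambda>e. if e = d then x else \<zero>)"
    using assms by (intro component_unique[of "{d}"]) (auto simp: piece_closed)
  then show ?thesis by simp
qed

lemma component_zero [simp]: "component M \<zero> d = \<zero>"
  using component_homogeneous[of \<zero> d d] by simp

text \<open>
  An element is the sum of its components, so it suffices to treat sums that begin with a component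
  of \<open>x\<close> itself. This form allows \<open>P\<close> to include membership in a set that contains these components.
\<close>

lemma component_induct [consumes 1, case_names zero add]:
  assumes "x \<in> carrier M" "P \<zero>"
    and "\<And>d y. y \<in> carrier M \<Longrightarrow> P y \<Longrightarrow> P (component M x d \<oplus> y)"
  shows "P x"
proof -
  have "P (\<Oplus>d\<in>D. component M x d)" if "finite D" for D
    using that by (induction D) (use assms in \<open>auto intro!: assms(3) M.finsum_closed simp: M.finsum_insert\<close>)
  then show ?thesis
    using component_sum[OF assms(1)] finite_support[OF assms(1)] by metis
qed

lemma component_act:
  assumes "x \<in> carrier M"
  shows "component M (mact M e c x) (e + d) = mact M e c (component M x d)"
    and "\<not> e \<le> d \<Longrightarrow> component M (mact M e c x) d = \<zero>"
proof -
  have "component M (mact M e c x) (e + d) = mact M e c (component M x d) \<and>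
    (\<not> e \<le> d \<longrightarrow> component M (mact M e c x) d = \<zero>)"
    if "x \<in> carrier M" for x
    using that
  proof -
    have *: "(component M (mact M e c y) (e + d) = mact M e c (component M y d) \<and>
      (\<not> e \<le> d \<longrightarrow> component M (mact M e c y) d = \<zero>))"
      if "y \<in> piece M d'" for y d'
    proof -
      have "e \<le> e + d'" by (cases e; cases d') auto
      then show ?thesis
        using component_homogeneous[OF that] component_homogeneous[OF act_piece[OF that, of e c]] by auto
    qed
    show ?thesis
      using that
    proof (induction x rule: component_induct)
      case zero
      then show ?case by simp
    next
      case (add d' y)
      then show ?case
        using *[of "component M x d'" d'] that
        by (auto simp: component_add act_add_right)
    qed
  qed
  then show "component M (mact M e c x) (e + d) = mact M e c (component M x d)"
    and "\<not> e \<le> d \<Longrightarrow> component M (mact M e c x) d = \<zero>"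
    using assms by auto
qed

end

lemma kst_induct [case_names zero add]:
  fixes r :: "'k::field kst"
  assumes "P 0" "\<And>r e c. P r \<Longrightarrow> P (Poly_Mapping.single e c + r)"
  shows "P r"
proof (induction r rule: update_induct)
  case const
  then show ?case by (rule assms(1))
next
  case (update f a b)
  have "Poly_Mapping.update a b f = Poly_Mapping.single a b + f"
    using update(1) by (intro poly_mapping_eqI) (auto simp: lookup_add lookup_update lookup_single in_keys_iff)
  then show ?case using assms(2)[OF update(3)] by simp
qed

text \<open>
  The unique decomposition into components is split into a spanning condition, with an arbitrary
  finite index set, and the independence of the pieces. These are the two facts that are inherited by
  submodules and quotients.
\<close>

lemma graded_moduleI:
  fixes M :: "('k::field kst, 'm) gmodule" (structure)
  assumes "module kst_ring M"
    and sub: "\<And>d. subgroup (piece M d) (add_monoid M)"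
    and act: "\<And>e c x d. x \<in> piece M d \<Longrightarrow> mact M e c x \<in> piece M (e + d)"
    and ex: "\<And>x. x \<in> carrier M \<Longrightarrow> \<exists>c D. finite D \<and> (\<forall>d. c d \<in> piece M d) \<and> x = (\<Oplus>d\<in>D. c d)"
    and indep: "\<And>c D d. finite D \<Longrightarrow> (\<And>d. c d \<in> piece M d) \<Longrightarrow> (\<Oplus>d\<in>D. c d) = \<zero> \<Longrightarrow> d \<in> D \<Longrightarrow> c d = \<zero>"
  shows "graded_module M"
proof -
  interpret module kst_ring M by fact
  have pc: "x \<in> carrier M" if "x \<in> piece M d" for x d
    using subgroup.subset[OF sub[of d]] that by auto
  have z: "\<zero> \<in> piece M d" for d
    using subgroup.one_closed[OF sub] by simp
  have "\<exists>!c. (\<forall>d. c d \<in> piece M d) \<and> finite {d. c d \<noteq> \<zero>} \<and> x = (\<Oplus>d\<in>{d. c d \<noteq> \<zero>}. c d)"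
    if x: "x \<in> carrier M" for x
  proof (rule ex_ex1I)
    obtain c D where c: "finite D" "\<forall>d. c d \<in> piece M d" "x = (\<Oplus>d\<in>D. c d)"
      using ex[OF x] by auto
    have cc: "c d \<in> carrier M" for d using c(2) pc by blast
    let ?c = "\<lambda>d. if d \<in> D then c d else \<zero>"
    have "x = (\<Oplus>d\<in>D. ?c d)"
      unfolding c(3) by (intro M.finsum_cong') (auto simp: cc)
    also have "\<dots> = (\<Oplus>d\<in>{d. ?c d \<noteq> \<zero>}. ?c d)"
      using c(1) cc by (intro M.add.finprod_mono_neutral_cong_right) auto
    finally show "\<exists>c. (\<forall>d. c d \<in> piece M d) \<and> finite {d. c d \<noteq> \<zero>} \<and> x = (\<Oplus>d\<in>{d. c d \<noteq> \<zero>}. c d)"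
      using c(1,2) z by (intro exI[of _ ?c]) (auto intro: finite_subset[of _ D])
  next
    fix c c'
    assume c: "(\<forall>d. c d \<in> piece M d) \<and> finite {d. c d \<noteq> \<zero>} \<and> x = (\<Oplus>d\<in>{d. c d \<noteq> \<zero>}. c d)"
      and c': "(\<forall>d. c' d \<in> piece M d) \<and> finite {d. c' d \<noteq> \<zero>} \<and> x = (\<Oplus>d\<in>{d. c' d \<noteq> \<zero>}. c' d)"
    let ?D = "{d. c d \<noteq> \<zero>} \<union> {d. c' d \<noteq> \<zero>}"
    have fin: "finite ?D" using c c' by blast
    have cc: "c d \<in> carrier M" "c' d \<in> carrier M" for d using c c' pc by blast+
    have "x = (\<Oplus>d\<in>?D. c d)"
      using c fin cc by (subst M.add.finprod_mono_neutral_cong_right[of _ "{d. c d \<noteq> \<zero>}" c c]) auto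
    moreover have "x = (\<Oplus>d\<in>?D. c' d)"
      using c' fin cc by (subst M.add.finprod_mono_neutral_cong_right[of _ "{d. c' d \<noteq> \<zero>}" c' c']) auto
    moreover have "(\<Oplus>d\<in>?D. c d \<ominus> c' d) \<oplus> (\<Oplus>d\<in>?D. c' d) = (\<Oplus>d\<in>?D. c d)"
      using cc by (subst M.finsum_addf[symmetric]) (auto simp: a_minus_def M.add.m_assoc M.l_neg)
    ultimately have "(\<Oplus>d\<in>?D. c d \<ominus> c' d) \<oplus> x = x" by simp
    moreover have "(\<Oplus>d\<in>?D. c d \<ominus> c' d) \<in> carrier M"
      using cc by (intro M.finsum_closed) auto
    ultimately have *: "(\<Oplus>d\<in>?D. c d \<ominus> c' d) = \<zero>"
      using x by (simp only: M.add.r_cancel_one)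
    have "c d \<ominus> c' d \<in> piece M d" for d
      using subgroup.m_closed[OF sub] subgroup.m_inv_closed[OF sub] c c'
      by (simp add: a_minus_def a_inv_def)
    then have eq: "c d \<ominus> c' d = \<zero>" if "d \<in> ?D" for d
      using indep[OF fin _ * that] by blast
    have "c d = c' d" for d
    proof (cases "d \<in> ?D")
      case True
      show ?thesis by (rule M.minus_zeroD[OF cc(1) cc(2) eq[OF True]])
    qed simp
    then show "c = c'" by (rule ext)
  qed
  then show ?thesis
    using assms unfolding graded_module_def by (auto intro: additive_subgroupI)
qed

section \<open>Generators, submodules and quotients\<close>

text \<open>
  The submodule generated by \<open>B\<close>, built by adding one monomial multiple of one generator at a time.
  For homogeneous generators each step of an induction then changes a single component.
\<close>

inductive_set monomial_span :: "('k::field kst, 'm) gmodule \<Rightarrow> 'm set \<Rightarrow> 'm set" for M B where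
  zero: "\<zero>\<^bsub>M\<^esub> \<in> monomial_span M B"
| step: "b \<in> B \<Longrightarrow> x \<in> monomial_span M B \<Longrightarrow> mact M e c b \<oplus>\<^bsub>M\<^esub> x \<in> monomial_span M B"

context graded_kst_module
begin

lemma neg_zero [simp]: "\<ominus> \<zero> = \<zero>"
  by (rule M.minus_equality) auto

lemma monomial_span_closed: "B \<subseteq> carrier M \<Longrightarrow> monomial_span M B \<subseteq> carrier M"
proof
  fix x assume "B \<subseteq> carrier M" "x \<in> monomial_span M B"
  from this(2,1) show "x \<in> carrier M" by induction auto
qed

lemma monomial_span_add:
  assumes "B \<subseteq> carrier M" "x \<in> monomial_span M B" "y \<in> monomial_span M B"
  shows "x \<oplus> y \<in> monomial_span M B"
  using assms(2,1)
proof induction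
  case zero
  then show ?case using assms(3) monomial_span_closed[OF assms(1)] by auto
next
  case (step b x e c)
  then have "mact M e c b \<oplus> (x \<oplus> y) \<in> monomial_span M B" by (intro monomial_span.step) auto
  then show ?case using step monomial_span_closed assms(3) by (subst M.add.m_assoc) auto
qed

lemma monomial_span_act:
  assumes "B \<subseteq> carrier M" "x \<in> monomial_span M B"
  shows "mact M e c x \<in> monomial_span M B"
  using assms(2,1)
proof induction
  case zero
  then show ?case by (simp add: monomial_span.zero)
next
  case (step b x e' c')
  then have "mact M e c (mact M e' c' b \<oplus> x) = mact M (e + e') (c * c') b \<oplus> mact M e c x"
    using monomial_span_closed by (subst act_add_right) (auto simp: act_act)
  then show ?case using step by (auto intro: monomial_span.step)
qed

lemma monomial_span_smult:
  assumes "B \<subseteq> carrier M" "x \<in> monomial_span M B"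
  shows "r \<odot> x \<in> monomial_span M B"
proof -
  have x: "x \<in> carrier M" using assms monomial_span_closed by auto
  show ?thesis
  proof (induction r rule: kst_induct)
    case zero
    then show ?case using x by (simp add: monomial_span.zero)
  next
    case (add r e c)
    then show ?case
      using smult_l_distr[of "Poly_Mapping.single e c" r x] x monomial_span_add[OF assms(1) monomial_span_act[OF assms]] by simp
  qed
qed

lemma monomial_span_base:
  assumes "B \<subseteq> carrier M" "b \<in> B"
  shows "b \<in> monomial_span M B"
proof -
  have "mact M 0 1 b \<oplus> \<zero> \<in> monomial_span M B"
    using assms(2) by (intro monomial_span.step monomial_span.zero)
  then show ?thesis using assms by (simp add: subset_iff)
qed

lemma monomial_span_finsum:
  assumes "B \<subseteq> carrier M" "finite A" "\<And>i. i \<in> A \<Longrightarrow> c i \<in> monomial_span M B"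
  shows "(\<Oplus>i\<in>A. c i) \<in> monomial_span M B"
  by (rule finsum_in[OF M.abelian_monoid_axioms monomial_span_closed[OF assms(1)] monomial_span.zero monomial_span_add[OF assms(1)] assms(2,3)])

lemma finitely_generatedI:
  assumes B: "finite B" "B \<subseteq> carrier M" and gen: "carrier M \<subseteq> monomial_span M B"
  shows "finitely_generated M"
proof -
  have "\<exists>r. x = (\<Oplus>a\<in>B. r a \<odot> a)" if "x \<in> monomial_span M B" for x
    using that
  proof induction
    case zero
    have "\<zero> = (\<Oplus>a\<in>B. (\<lambda>_. 0) a \<odot> a)"
      using B by (simp add: subset_iff M.add.finprod_one_eqI)
    then show ?case by (intro exI[of _ "\<lambda>_. 0"])
  next
    case (step b x e c)
    then obtain r where r: "x = (\<Oplus>a\<in>B. r a \<odot> a)" by auto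
    let ?s = "\<lambda>a. if a = b then Poly_Mapping.single e c else 0"
    have "(\<Oplus>a\<in>B. ?s a \<odot> a) = (\<Oplus>a\<in>B. if a = b then mact M e c b else \<zero>)"
      using B by (intro M.finsum_cong') auto
    also have "\<dots> = mact M e c b"
      using M.finsum_singleton[of b B "\<lambda>_. mact M e c b"] step(1) B by (simp add: subset_iff eq_commute)
    finally have "mact M e c b = (\<Oplus>a\<in>B. ?s a \<odot> a)" by simp
    then have "mact M e c b \<oplus> x = (\<Oplus>a\<in>B. ?s a \<odot> a \<oplus> r a \<odot> a)"
      unfolding r using B by (subst M.finsum_addf) auto
    also have "\<dots> = (\<Oplus>a\<in>B. (?s a + r a) \<odot> a)"
      using B smult_l_distr by (intro M.finsum_cong') auto
    finally show ?case by (intro exI)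
  qed
  then have "carrier M = {\<Oplus>a\<in>B. r a \<odot> a | r. r \<in> B \<rightarrow> carrier kst_ring}"
    using gen B by (auto intro!: M.finsum_closed)
  then show ?thesis
    using B unfolding finitely_generated_def by blast
qed

text \<open>
  The components of finitely many generators are again finitely many generators.
\<close>

lemma finitely_generated_homogeneous:
  assumes "finitely_generated M"
  obtains B \<delta> where "finite B" "\<And>b. b \<in> B \<Longrightarrow> b \<in> piece M (\<delta> b)" "carrier M \<subseteq> monomial_span M B"
proof -
  obtain A where A: "finite A" "A \<subseteq> carrier M"
    "carrier M = {\<Oplus>a\<in>A. r a \<odot> a | r. r \<in> A \<rightarrow> carrier kst_ring}"
    using assms by (auto simp: finitely_generated_def)
  let ?B = "\<Union>a\<in>A. component M a ` {d. component M a d \<noteq> \<zero>}"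
  have B: "finite ?B" "?B \<subseteq> carrier M"
    using A(1,2) finite_support component_closed by blast+
  have "\<forall>b\<in>?B. \<exists>d. b \<in> piece M d" using A(2) by blast
  then obtain \<delta> where \<delta>: "\<forall>b\<in>?B. b \<in> piece M (\<delta> b)"
    using bchoice[of ?B "\<lambda>b d. b \<in> piece M d"] by blast
  have "a \<in> monomial_span M ?B" if "a \<in> A" for a
  proof -
    have a: "a \<in> carrier M" using that A(2) by blast
    have "(\<Oplus>d\<in>{d. component M a d \<noteq> \<zero>}. component M a d) \<in> monomial_span M ?B"
      using that by (intro monomial_span_finsum[OF B(2) finite_support[OF a]] monomial_span_base[OF B(2)]) blast
    then show ?thesis using component_sum[OF a] by simp
  qed
  then have "(\<Oplus>a\<in>A. r a \<odot> a) \<in> monomial_span M ?B" for r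
    by (intro monomial_span_finsum[OF B(2) A(1)] monomial_span_smult[OF B(2)])
  then have gen: "carrier M \<subseteq> monomial_span M ?B"
    by (subst A(3)) blast
  show thesis
    by (rule that[OF B(1) _ gen, of \<delta>]) (use \<delta> in blast)
qed

end

lemma restrict_module_simps [simp]:
  "carrier (restrict_module M U) = U" "zero (restrict_module M U) = zero M"
  "add (restrict_module M U) = add M" "smult (restrict_module M U) = smult M"
  "piece (restrict_module M U) d = U \<inter> piece M d"
  by (simp_all add: restrict_module_def)

lemma quotient_module_simps [simp]:
  "carrier (quotient_module M U) = a_rcosets\<^bsub>M\<^esub> U" "zero (quotient_module M U) = U"
  "add (quotient_module M U) = set_add M"
  "piece (quotient_module M U) d = (\<lambda>x. U +>\<^bsub>M\<^esub> x) ` piece M d"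
  by (simp_all add: quotient_module_def)

context graded_kst_module
begin

lemma submodule_abelian_group:
  assumes "submodule U kst_ring M"
  shows "abelian_group (restrict_module M U)"
proof -
  note U = submoduleE[OF assms]
  have z: "\<zero> \<in> U" using submodule.axioms(1)[OF assms] subgroup.one_closed by force
  show ?thesis
  proof (rule abelian_groupI; simp)
    show "x \<oplus> y \<in> U" if "x \<in> U" "y \<in> U" for x y using U that by auto
    show "x \<oplus> y \<oplus> w = x \<oplus> (y \<oplus> w)" if "x \<in> U" "y \<in> U" "w \<in> U" for x y w
      using U(1) that by (intro M.add.m_assoc) auto
    show "x \<oplus> y = y \<oplus> x" if "x \<in> U" "y \<in> U" for x y
      using U(1) that by (intro M.add.m_comm) auto
    show "\<zero> \<oplus> x = x" if "x \<in> U" for x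
      using U(1) that by auto
    show "\<exists>y\<in>U. y \<oplus> x = \<zero>" if "x \<in> U" for x
      using U(1,3) that M.l_neg by blast
  qed (use z in auto)
qed

lemma finsum_restrict:
  assumes "submodule U kst_ring M" "finite A" "\<And>i. i \<in> A \<Longrightarrow> c i \<in> U"
  shows "finsum (restrict_module M U) c A = finsum M c A" "finsum M c A \<in> U"
proof -
  interpret U: abelian_group "restrict_module M U" using assms submodule_abelian_group by auto
  have "finsum (restrict_module M U) c A \<in> U \<and> finsum (restrict_module M U) c A = finsum M c A"
    using hom_finsum[of "restrict_module M U" M U "\<lambda>x. x" A c, OF U.abelian_monoid_axioms M.abelian_monoid_axioms]
      assms submoduleE[OF assms(1)] U.zero_closed
    by auto
  then show "finsum (restrict_module M U) c A = finsum M c A" "finsum M c A \<in> U" by auto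
qed

text \<open>
  The pieces of a submodule are independent because those of the module are, so only closure under
  components is at stake.
\<close>

lemma graded_submoduleI:
  assumes U: "submodule U kst_ring M"
    and comp: "\<And>x d. x \<in> U \<Longrightarrow> component M x d \<in> U"
  shows "graded_submodule U M"
proof -
  note UE = submoduleE[OF U]
  interpret U: abelian_group "restrict_module M U" using U submodule_abelian_group by auto
  have z: "\<zero> \<in> U" using U.zero_closed by simp
  have inv: "inv\<^bsub>add_monoid (restrict_module M U)\<^esub> x = \<ominus> x" if "x \<in> U" for x
    using U.minus_equality[of "\<ominus> x" x] that UE(1,3) by (auto simp: a_inv_def M.l_neg[unfolded a_inv_def] subset_iff)
  have "graded_module (restrict_module M U)"
  proof (rule graded_moduleI)
    show "module kst_ring (restrict_module M U)"
      by (rule moduleI[OF cring_kst_ring U.abelian_group_axioms])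
        (use UE(1,4) in \<open>auto simp: subset_iff smult_r_distr smult_l_distr[simplified] smult_assoc1[simplified]\<close>)
    show "subgroup (piece (restrict_module M U) d) (add_monoid (restrict_module M U))" for d
      by (rule subgroup.intro) (use UE z inv in auto)
    show "mact (restrict_module M U) e c x \<in> piece (restrict_module M U) (e + d)"
      if "x \<in> piece (restrict_module M U) d" for e c x d
      using that UE(4) by auto
    show "\<exists>c D. finite D \<and> (\<forall>d. c d \<in> piece (restrict_module M U) d) \<and> x = (\<Oplus>\<^bsub>restrict_module M U\<^esub>d\<in>D. c d)"
      if "x \<in> carrier (restrict_module M U)" for x
    proof -
      have x: "x \<in> U" "x \<in> carrier M" using that UE by auto
      then show ?thesis
        using comp finsum_restrict(1)[OF U finite_support, of x "component M x"] component_sum[of x] finite_support[of x]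
        by (intro exI[of _ "component M x"] exI[of _ "{d. component M x d \<noteq> \<zero>}"]) auto
    qed
    show "c d = \<zero>\<^bsub>restrict_module M U\<^esub>"
      if "finite D" "\<And>d. c d \<in> piece (restrict_module M U) d"
        "(\<Oplus>\<^bsub>restrict_module M U\<^esub>d\<in>D. c d) = \<zero>\<^bsub>restrict_module M U\<^esub>" "d \<in> D" for c D d
    proof -
      let ?c = "\<lambda>d. if d \<in> D then c d else \<zero>"
      have c: "c d \<in> piece M d" "c d \<in> U" for d using that(2)[of d] by auto
      have cc: "c d \<in> carrier M" for d using c piece_closed by blast
      have "\<zero> = (\<Oplus>d\<in>D. c d)" using that finsum_restrict(1)[OF U that(1), of c] c by auto
      also have "\<dots> = (\<Oplus>d\<in>D. ?c d)"
        by (rule M.finsum_cong') (auto simp: cc)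
      finally have "component M \<zero> = ?c" using c that(1) by (intro component_unique[of D]) auto
      then show ?thesis using that(4) component_zero[of d] by (simp split: if_splits)
    qed
  qed
  then show ?thesis using U by (simp add: graded_submodule_def)
qed

text \<open>
  The decomposition inside \<open>U\<close> is also one inside \<open>M\<close>, where it is unique.
\<close>

lemma graded_submoduleD:
  assumes "graded_submodule U M" "x \<in> U"
  shows "component (restrict_module M U) x = component M x" "component M x d \<in> U"
proof -
  interpret U: graded_kst_module "restrict_module M U"
    using assms by unfold_locales (simp add: graded_submodule_def)
  have U: "submodule U kst_ring M" using assms by (simp add: graded_submodule_def)
  let ?c = "component (restrict_module M U) x"
  have x: "x \<in> carrier (restrict_module M U)" using assms by simp
  have c: "?c d \<in> U \<inter> piece M d" for d using U.component_piece[OF x] by simp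
  show "?c = component M x"
    using U.component_sum[OF x] U.finite_support[OF x] c
      finsum_restrict(1)[OF U U.finite_support[OF x], of ?c]
    by (intro component_unique[symmetric, of "{d. ?c d \<noteq> \<zero>}"]) auto
  then show "component M x d \<in> U" using c[of d] by auto
qed

end

locale graded_sub = graded_kst_module M for M :: "('k::field kst, 'm) gmodule" (structure) +
  fixes U
  assumes graded_submod: "graded_submodule U M"
begin

lemma submod: "submodule U kst_ring M"
  using graded_submod by (simp add: graded_submodule_def)

lemma restrict_graded: "graded_kst_module (restrict_module M U)"
  using graded_submod by unfold_locales (simp add: graded_submodule_def)

lemmas U_subset = submoduleE(1)[OF submod]

lemma U_carrier [intro]: "x \<in> U \<Longrightarrow> x \<in> carrier M" using U_subset by auto

lemma U_zero [simp, intro]: "\<zero> \<in> U"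
  using submodule.axioms(1)[OF submod] subgroup.one_closed by force

lemmas U_add [intro] = submoduleE(5)[OF submod]
lemmas U_neg [intro] = submoduleE(3)[OF submod]

lemma U_act [intro]: "x \<in> U \<Longrightarrow> r \<odot> x \<in> U"
  using submoduleE(4)[OF submod] by simp

lemmas U_component [intro] = graded_submoduleD(2)[OF graded_submod]

end

sublocale graded_sub \<subseteq> abelian_subgroup U M
  using submodule.axioms(1)[OF submod]
  by (intro abelian_subgroupI3 additive_subgroupI) (auto intro: M.abelian_group_axioms)

context graded_sub
begin

lemma coset_mem_iff: "x \<in> carrier M \<Longrightarrow> y \<in> U +> x \<longleftrightarrow> y \<in> carrier M \<and> y \<ominus> x \<in> U"
  using a_rcos_module[of x y] a_elemrcos_carrier[of x y] by (auto simp: a_minus_def)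

lemma coset_eq_iff:
  "x \<in> carrier M \<Longrightarrow> y \<in> carrier M \<Longrightarrow> U +> x = U +> y \<longleftrightarrow> x \<ominus> y \<in> U"
  by (metis a_repr_independence' a_rcos_self coset_mem_iff)

lemma coset_zero [simp]: "U +> \<zero> = U"
  using U_subset by (rule M.a_coset_add_zero)

lemma coset_eq_zero_iff: "x \<in> carrier M \<Longrightarrow> U +> x = U \<longleftrightarrow> x \<in> U"
  using coset_eq_iff[of x \<zero>] by (simp add: M.minus_eq neg_zero)

lemma coset_self [simp]: "x \<in> carrier M \<Longrightarrow> x \<in> U +> x"
  by (rule a_rcos_self)

lemma quotient_carrier: "X \<in> carrier (quotient_module M U) \<longleftrightarrow> (\<exists>x\<in>carrier M. X = U +> x)"
  by (auto simp: A_RCOSETS_def' a_r_coset_def')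

lemma quotient_add:
  "x \<in> carrier M \<Longrightarrow> y \<in> carrier M \<Longrightarrow> (U +> x) <+>\<^bsub>M\<^esub> (U +> y) = U +> (x \<oplus> y)"
  by (rule a_rcos_sum)

lemma quotient_smult:
  assumes x: "x \<in> carrier M"
  shows "r \<odot>\<^bsub>quotient_module M U\<^esub> (U +> x) = U +> (r \<odot> x)"
proof -
  have "r \<odot>\<^bsub>quotient_module M U\<^esub> (U +> x) = U <+>\<^bsub>M\<^esub> ((\<lambda>x. r \<odot> x) ` (U +> x))"
    by (simp add: quotient_module_def)
  also have "\<dots> = U +> (r \<odot> x)"
  proof (intro equalityI subsetI)
    fix z assume "z \<in> U <+>\<^bsub>M\<^esub> ((\<lambda>x. r \<odot> x) ` (U +> x))"
    then obtain u v where uv: "u \<in> U" "v \<in> U" "z = u \<oplus> r \<odot> (v \<oplus> x)"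
      by (auto simp: set_add_def' a_r_coset_def')
    then have "z = (u \<oplus> r \<odot> v) \<oplus> r \<odot> x"
      using x by (simp add: act_add_right U_carrier M.add.m_assoc)
    then show "z \<in> U +> (r \<odot> x)" using uv by (auto simp: a_r_coset_def')
  next
    fix z assume "z \<in> U +> (r \<odot> x)"
    then obtain u where u: "u \<in> U" "z = u \<oplus> r \<odot> x" by (auto simp: a_r_coset_def')
    then show "z \<in> U <+>\<^bsub>M\<^esub> ((\<lambda>x. r \<odot> x) ` (U +> x))"
      using u coset_self[OF x] unfolding set_add_def' by blast
  qed
  finally show ?thesis .
qed

lemma quotient_abelian_group: "abelian_group (quotient_module M U)"
proof (rule abelian_groupI)
  let ?Q = "quotient_module M U"
  fix X assume "X \<in> carrier ?Q"
  then obtain x where x: "x \<in> carrier M" "X = U +> x" by (auto simp only: quotient_carrier)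
  show "\<zero>\<^bsub>?Q\<^esub> \<oplus>\<^bsub>?Q\<^esub> X = X"
    using quotient_add[of \<zero> x] x by simp
  show "\<exists>Y\<in>carrier ?Q. Y \<oplus>\<^bsub>?Q\<^esub> X = \<zero>\<^bsub>?Q\<^esub>"
    by (rule bexI[of _ "U +> \<ominus> x"])
      (use quotient_add[of "\<ominus> x" x] x quotient_carrier in \<open>auto simp: M.l_neg\<close>)
  fix Y assume "Y \<in> carrier ?Q"
  then obtain y where y: "y \<in> carrier M" "Y = U +> y" by (auto simp only: quotient_carrier)
  show "X \<oplus>\<^bsub>?Q\<^esub> Y \<in> carrier ?Q" "X \<oplus>\<^bsub>?Q\<^esub> Y = Y \<oplus>\<^bsub>?Q\<^esub> X"
    using x y by (auto simp only: quotient_carrier quotient_module_simps(3) quotient_add M.add.m_comm)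
  fix Z assume "Z \<in> carrier ?Q"
  then obtain z where z: "z \<in> carrier M" "Z = U +> z" by (auto simp only: quotient_carrier)
  show "X \<oplus>\<^bsub>?Q\<^esub> Y \<oplus>\<^bsub>?Q\<^esub> Z = X \<oplus>\<^bsub>?Q\<^esub> (Y \<oplus>\<^bsub>?Q\<^esub> Z)"
    using x y z by (simp add: quotient_add M.add.m_assoc)
next
  show "\<zero>\<^bsub>quotient_module M U\<^esub> \<in> carrier (quotient_module M U)"
    unfolding quotient_carrier by (rule bexI[of _ \<zero>]) auto
qed

lemma quotient_finsum:
  assumes "finite A" "\<And>i. i \<in> A \<Longrightarrow> c i \<in> carrier M"
  shows "(\<Oplus>\<^bsub>quotient_module M U\<^esub>i\<in>A. U +> c i) = U +> (\<Oplus>i\<in>A. c i)"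
proof -
  interpret Q: abelian_group "quotient_module M U" by (rule quotient_abelian_group)
  have "U +> (\<Oplus>i\<in>A. c i) = (\<Oplus>\<^bsub>quotient_module M U\<^esub>i\<in>A. U +> c i)"
    by (rule conjunct2[OF hom_finsum[OF M.abelian_monoid_axioms Q.abelian_monoid_axioms, where P = "carrier M"]])
      (use assms quotient_carrier quotient_add in auto)
  then show ?thesis by simp
qed

text \<open>
  The images of the pieces are independent: if a sum of homogeneous elements lies in \<open>U\<close>, then so do
  its summands, since they are its components and \<open>U\<close> is graded.
\<close>

lemma quotient_graded: "graded_module (quotient_module M U)"
proof (rule graded_moduleI)
  let ?Q = "quotient_module M U"
  interpret Q: abelian_group "quotient_module M U" by (rule quotient_abelian_group)
  show "module kst_ring ?Q"
  proof (rule moduleI[OF cring_kst_ring Q.abelian_group_axioms])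
    fix X and a b :: "'k kst" assume "X \<in> carrier ?Q"
    then obtain x where x: "x \<in> carrier M" "X = U +> x" by (auto simp only: quotient_carrier)
    show "a \<odot>\<^bsub>?Q\<^esub> X \<in> carrier ?Q"
      unfolding quotient_carrier x(2) quotient_smult[OF x(1)] using x(1) by blast
    show "(a \<oplus>\<^bsub>kst_ring\<^esub> b) \<odot>\<^bsub>?Q\<^esub> X = (a \<odot>\<^bsub>?Q\<^esub> X) \<oplus>\<^bsub>?Q\<^esub> (b \<odot>\<^bsub>?Q\<^esub> X)"
      using x smult_l_distr[of a b x] by (simp add: quotient_smult quotient_add)
    show "(a \<otimes>\<^bsub>kst_ring\<^esub> b) \<odot>\<^bsub>?Q\<^esub> X = a \<odot>\<^bsub>?Q\<^esub> (b \<odot>\<^bsub>?Q\<^esub> X)"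
      using x smult_assoc1[of a b x] by (simp add: quotient_smult)
    show "\<one>\<^bsub>kst_ring\<^esub> \<odot>\<^bsub>?Q\<^esub> X = X"
      using x by (simp add: quotient_smult)
    fix Y assume "Y \<in> carrier ?Q"
    then obtain y where y: "y \<in> carrier M" "Y = U +> y" by (auto simp only: quotient_carrier)
    show "a \<odot>\<^bsub>?Q\<^esub> (X \<oplus>\<^bsub>?Q\<^esub> Y) = (a \<odot>\<^bsub>?Q\<^esub> X) \<oplus>\<^bsub>?Q\<^esub> (a \<odot>\<^bsub>?Q\<^esub> Y)"
      using x y by (simp add: quotient_smult quotient_add act_add_right)
  qed
  have neg: "\<ominus>\<^bsub>?Q\<^esub> (U +> x) = U +> (\<ominus> x)" if x: "x \<in> carrier M" for x
  proof (rule Q.minus_equality)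
    show "(U +> \<ominus> x) \<oplus>\<^bsub>?Q\<^esub> (U +> x) = \<zero>\<^bsub>?Q\<^esub>"
      using quotient_add[of "\<ominus> x" x] x by (simp add: M.l_neg)
  qed (use x in \<open>auto simp only: quotient_carrier intro: M.a_inv_closed\<close>)
  show "subgroup (piece ?Q d) (add_monoid ?Q)" for d
  proof (rule subgroup.intro)
    show "piece ?Q d \<subseteq> carrier (add_monoid ?Q)"
      using quotient_carrier by auto
    show "X \<otimes>\<^bsub>add_monoid ?Q\<^esub> Y \<in> piece ?Q d" if "X \<in> piece ?Q d" "Y \<in> piece ?Q d" for X Y
      using that by (auto simp: quotient_add piece_closed)
    show "\<one>\<^bsub>add_monoid ?Q\<^esub> \<in> piece ?Q d"
      by (simp add: image_iff) (rule bexI[of _ \<zero>], auto)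
    show "inv\<^bsub>add_monoid ?Q\<^esub> X \<in> piece ?Q d" if X: "X \<in> piece ?Q d" for X
    proof -
      obtain x where x: "x \<in> piece M d" "X = U +> x" using X by auto
      then have "\<ominus>\<^bsub>?Q\<^esub> X = U +> (\<ominus> x)" using neg by blast
      then have "\<ominus>\<^bsub>?Q\<^esub> X \<in> piece ?Q d" using neg_piece[OF x(1)] by simp
      then show ?thesis by (simp only: a_inv_def)
    qed
  qed
  show "mact ?Q e c X \<in> piece ?Q (e + d)" if X: "X \<in> piece ?Q d" for e c X d
  proof -
    obtain x where x: "x \<in> piece M d" "X = U +> x" using X by auto
    show ?thesis
      unfolding x(2) quotient_smult[OF piece_closed[OF x(1)]] using act_piece[OF x(1)] by simp
  qed
  show "\<exists>c D. finite D \<and> (\<forall>d. c d \<in> piece ?Q d) \<and> X = (\<Oplus>\<^bsub>?Q\<^esub>d\<in>D. c d)"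
    if X: "X \<in> carrier ?Q" for X
  proof -
    obtain x where x: "x \<in> carrier M" "X = U +> x" using X by (auto simp only: quotient_carrier)
    let ?D = "{d. component M x d \<noteq> \<zero>}"
    have "X = (\<Oplus>\<^bsub>?Q\<^esub>d\<in>?D. U +> component M x d)"
      using quotient_finsum[of ?D "component M x"] x component_sum[of x] finite_support[of x] by auto
    then show ?thesis
      using finite_support[OF x(1)] component_piece[OF x(1)]
      by (intro exI[of _ "\<lambda>d. U +> component M x d"] exI[of _ ?D]) auto
  qed
  show "C d = \<zero>\<^bsub>?Q\<^esub>"
    if D: "finite D" "\<And>d. C d \<in> piece ?Q d" "(\<Oplus>\<^bsub>?Q\<^esub>d\<in>D. C d) = \<zero>\<^bsub>?Q\<^esub>" "d \<in> D" for C D d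
  proof -
    have "\<forall>d. \<exists>y. y \<in> piece M d \<and> C d = U +> y"
      using D(2) unfolding quotient_module_simps by blast
    then obtain c where c: "\<And>d. c d \<in> piece M d" "\<And>d. C d = U +> c d" by metis
    have "U +> (\<Oplus>d\<in>D. c d) = U"
      using quotient_finsum[OF D(1), of c] c D(3) by (auto simp: piece_closed)
    then have in_U: "(\<Oplus>d\<in>D. c d) \<in> U"
      using c by (subst (asm) coset_eq_zero_iff) (auto intro!: M.finsum_closed)
    let ?c = "\<lambda>d. if d \<in> D then c d else \<zero>"
    have cc: "c d \<in> carrier M" for d using c(1) piece_closed by blast
    have "(\<Oplus>d\<in>D. c d) = (\<Oplus>d\<in>D. ?c d)"
      by (rule M.finsum_cong') (auto simp: cc)
    then have "component M (\<Oplus>d\<in>D. c d) = ?c"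
      using c D(1) by (intro component_unique[of D]) auto
    then have "c d \<in> U" using U_component[OF in_U, of d] D(4) by simp
    then show ?thesis
      using c by (simp add: coset_eq_zero_iff piece_closed)
  qed
qed

lemma quotient_finitely_generated:
  assumes "finitely_generated M"
  shows "finitely_generated (quotient_module M U)"
proof -
  let ?Q = "quotient_module M U"
  interpret Q: graded_kst_module ?Q by unfold_locales (rule quotient_graded)
  obtain B \<delta> where B: "finite B" "\<And>b. b \<in> B \<Longrightarrow> b \<in> piece M (\<delta> b)" "carrier M \<subseteq> monomial_span M B"
    using finitely_generated_homogeneous[OF assms] by blast
  have Bc: "B \<subseteq> carrier M" using B by auto
  have *: "U +> x \<in> monomial_span ?Q ((\<lambda>b. U +> b) ` B)" if "x \<in> monomial_span M B" for x
    using that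
  proof induction
    case zero
    then show ?case using monomial_span.zero[of ?Q] by simp
  next
    case (step b x e c)
    have "x \<in> carrier M" "b \<in> carrier M" using step monomial_span_closed[OF Bc] Bc by auto
    then show ?case
      using monomial_span.step[OF imageI[OF step(1), of "\<lambda>b. U +> b"] step.IH, of e c]
      by (simp add: quotient_smult quotient_add)
  qed
  show ?thesis
  proof (rule Q.finitely_generatedI[of "(\<lambda>b. U +> b) ` B"])
    show "(\<lambda>b. U +> b) ` B \<subseteq> carrier ?Q"
      using Bc unfolding image_subset_iff quotient_carrier by blast
    show "carrier ?Q \<subseteq> monomial_span ?Q ((\<lambda>b. U +> b) ` B)"
    proof
      fix X assume "X \<in> carrier ?Q"
      then obtain x where "x \<in> carrier M" "X = U +> x" unfolding quotient_carrier by blast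
      then show "X \<in> monomial_span ?Q ((\<lambda>b. U +> b) ` B)" using * B(3) by blast
    qed
  qed (use B in simp)
qed

end

section \<open>Truncations\<close>

text \<open>
  The complement of the box \<open>[0, n)\<^sup>2\<close>. Monomials do not lead out of it, and these complements are
  cofinal among the cofinite sets of bidegrees.
\<close>

definition far :: "nat \<Rightarrow> nat \<times> nat \<Rightarrow> bool" where
  "far n d \<longleftrightarrow> n \<le> fst d \<or> n \<le> snd d"

lemma far_add: "far n d \<Longrightarrow> far n (e + d)"
  by (auto simp: far_def)

lemma far_mono: "far n d \<Longrightarrow> m \<le> n \<Longrightarrow> far m d"
  by (auto simp: far_def)

lemma eventually_far: "eventually P cofinite \<longleftrightarrow> (\<exists>n. \<forall>d. far n d \<longrightarrow> P d)"
proof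
  assume "eventually P cofinite"
  then have fin: "finite {d. \<not> P d}" by (simp add: eventually_cofinite)
  obtain n where n: "\<forall>i\<in>fst ` {d. \<not> P d} \<union> snd ` {d. \<not> P d}. i < n"
    using finite_nat_set_iff_bounded[of "fst ` {d. \<not> P d} \<union> snd ` {d. \<not> P d}"] fin by blast
  have "P d" if "far n d" for d
  proof (rule ccontr)
    assume "\<not> P d"
    then have "fst d < n" "snd d < n" using n by blast+
    then show False using that by (simp add: far_def)
  qed
  then show "\<exists>n. \<forall>d. far n d \<longrightarrow> P d" by blast
next
  assume "\<exists>n. \<forall>d. far n d \<longrightarrow> P d"
  then obtain n where n: "\<forall>d. far n d \<longrightarrow> P d" by blast
  have "{d. \<not> P d} \<subseteq> {..<n} \<times> {..<n}"
  proof
    fix d assume "d \<in> {d. \<not> P d}"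
    then have "\<not> far n d" using n by blast
    then show "d \<in> {..<n} \<times> {..<n}" by (cases d) (simp add: far_def)
  qed
  then show "eventually P cofinite"
    unfolding eventually_cofinite by (rule finite_subset) simp
qed

text \<open>
  The part of \<open>M\<close> outside a box. It is the submodule on which germs at infinity will be realised as
  morphisms of modules.
\<close>

definition truncation :: "('k::field kst, 'm) gmodule \<Rightarrow> nat \<Rightarrow> 'm set" where
  "truncation M n = {x \<in> carrier M. \<forall>d. \<not> far n d \<longrightarrow> component M x d = \<zero>\<^bsub>M\<^esub>}"

context graded_kst_module
begin

lemma truncation_closed: "x \<in> truncation M n \<Longrightarrow> x \<in> carrier M"
  by (simp add: truncation_def)

lemma component_smult_zero:
  assumes "x \<in> truncation M n" "\<not> far n d"
  shows "component M (r \<odot> x) d = \<zero>"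
proof (induction r rule: kst_induct)
  case zero
  then show ?case using truncation_closed[OF assms(1)] by simp
next
  case (add r e c)
  have x: "x \<in> carrier M" using assms truncation_closed by blast
  have "component M (mact M e c x) d = \<zero>"
  proof (cases "e \<le> d")
    case True
    then have "d = e + (d - e)" by (cases d; cases e) auto
    then obtain d' where d: "d = e + d'" by blast
    then have "\<not> far n d'" using assms(2) far_add by blast
    then have "component M x d' = \<zero>" using assms(1) by (simp add: truncation_def)
    then show ?thesis using component_act(1)[OF x, of e c d'] d by simp
  next
    case False
    then show ?thesis using component_act(2)[OF x] by simp
  qed
  then show ?case
    using smult_l_distr[of "Poly_Mapping.single e c" r x] x add by (simp add: component_add)
qed

lemma truncation_add: "x \<in> truncation M n \<Longrightarrow> y \<in> truncation M n \<Longrightarrow> x \<oplus> y \<in> truncation M n"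
  by (simp add: truncation_def component_add)

lemma truncation_smult:
  assumes "x \<in> truncation M n"
  shows "r \<odot> x \<in> truncation M n"
  using component_smult_zero[OF assms, of _ r] act_closed[OF truncation_closed[OF assms], of r]
  by (subst truncation_def) blast

lemma truncation_zero [simp]: "\<zero> \<in> truncation M n"
  by (simp add: truncation_def)

lemma truncation_piece: "far n d \<Longrightarrow> x \<in> piece M d \<Longrightarrow> x \<in> truncation M n"
  using component_homogeneous[of x d] piece_closed[of x d] by (auto simp: truncation_def)

lemma truncation_piece_zero: "\<not> far n d \<Longrightarrow> x \<in> piece M d \<Longrightarrow> x \<in> truncation M n \<Longrightarrow> x = \<zero>"
  using component_homogeneous[of x d d] by (simp add: truncation_def)

lemma truncation_component: "x \<in> truncation M n \<Longrightarrow> component M x d \<in> truncation M n"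
  using truncation_piece[of n d "component M x d"] component_piece[of x d] by (cases "far n d") (auto simp: truncation_def)

lemma truncation_support: "x \<in> truncation M n \<Longrightarrow> component M x d \<noteq> \<zero> \<Longrightarrow> far n d"
  by (auto simp: truncation_def)

lemma truncation_submodule: "submodule (truncation M n) kst_ring M"
proof (rule submoduleI)
  show "truncation M n \<subseteq> carrier M" using truncation_closed by blast
  show "\<ominus> a \<in> truncation M n" if "a \<in> truncation M n" for a
    using truncation_smult[OF that, of "Poly_Mapping.single 0 (- 1)"]
    by (simp only: neg_eq[OF truncation_closed[OF that]])
  show "\<zero> \<in> truncation M n" by simp
  show "a \<oplus> b \<in> truncation M n" if "a \<in> truncation M n" "b \<in> truncation M n" for a b
    using that by (rule truncation_add)
  show "a \<odot> x \<in> truncation M n" if "a \<in> carrier kst_ring" "x \<in> truncation M n" for a x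
    using that(2) by (rule truncation_smult)
qed

lemma truncation_graded_submodule: "graded_submodule (truncation M n) M"
  by (intro graded_submoduleI truncation_submodule truncation_component)

lemma finite_sub_support: 
  assumes "finite_sub M V"
  shows "\<forall>\<^sub>F d in cofinite. V \<inter> piece M d \<subseteq> {\<zero>}"
proof -
  have "finite {d. V \<inter> piece M d \<noteq> {\<zero>}}"
    using assms by (simp add: finite_sub_def finite_module_def)
  then show ?thesis
    unfolding eventually_cofinite by (rule finite_subset[rotated]) blast
qed

end

locale fg_kst_module = graded_kst_module M for M :: "('k::field kst, 'm) gmodule" (structure) +
  assumes fin_gen: "finitely_generated M"

lemma fg_kst_moduleI: "fg_graded_module M \<Longrightarrow> fg_kst_module M"
  by unfold_locales (auto simp: fg_graded_module_def)

text \<open>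
  From any bidegree at most \<open>n\<close> steps in one direction lead out of the box, and a monomial that
  leads out of the box is divisible by such a step.
\<close>

lemma far_step:
  assumes "far n (e + d)"
  obtains e' e'' where "e = e'' + e'" "far n (e' + d)" "e' \<in> {..n} \<times> {..n}"
proof -
  obtain a b i j where eq: "e = (a, b)" "d = (i, j)" by (cases e; cases d)
  consider "far n d" | "\<not> far n d" "n \<le> a + i" | "\<not> far n d" "n \<le> b + j"
    using assms eq by (auto simp: far_def)
  then show thesis
  proof cases
    case 1
    then show ?thesis using that[of e "(0, 0)"] eq by simp
  next
    case 2
    then show ?thesis using that[of "(a - (n - i), b)" "(n - i, 0)"] eq by (auto simp: far_def)
  next
    case 3
    then show ?thesis using that[of "(a, b - (n - j))" "(0, n - j)"] eq by (auto simp: far_def)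
  qed
qed

context fg_kst_module
begin

text \<open>
  A multiple \<open>s\<^sup>i t\<^sup>j b\<close> of a generator that lies outside the box is a multiple of one with
  \<open>i, j \<le> n\<close> that already lies outside, and there are finitely many of these.
\<close>

lemma truncation_finitely_generated: "finitely_generated (restrict_module M (truncation M n))"
proof -
  let ?R = "restrict_module M (truncation M n)"
  interpret T: graded_sub M "truncation M n" by unfold_locales (rule truncation_graded_submodule)
  interpret R: graded_kst_module ?R by (rule T.restrict_graded)
  obtain B \<delta> where B: "finite B" "\<And>b. b \<in> B \<Longrightarrow> b \<in> piece M (\<delta> b)" "carrier M \<subseteq> monomial_span M B"
    using finitely_generated_homogeneous[OF fin_gen] by blast
  have Bc: "B \<subseteq> carrier M" using B(2) piece_closed by blast
  let ?B = "(\<lambda>(e, b). mact M e 1 b) ` {(e, b). (e, b) \<in> ({..n} \<times> {..n}) \<times> B \<and> far n (e + \<delta> b)}"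
  have fin: "finite ?B"
    by (intro finite_imageI finite_subset[OF _ finite_cartesian_product[OF _ B(1), of "{..n} \<times> {..n}"]]) auto
  have sub: "?B \<subseteq> carrier ?R"
    using B(2) act_piece truncation_piece by fastforce
  have one: "mact M e c b \<in> monomial_span ?R ?B" if b: "b \<in> B" and f: "far n (e + \<delta> b)" for e c b
  proof -
    obtain e' e'' where e: "e = e'' + e'" "far n (e' + \<delta> b)" "e' \<in> {..n} \<times> {..n}"
      using far_step[OF f] by metis
    have "mact M e' 1 b \<in> ?B" using e b by (intro image_eqI[of _ _ "(e', b)"]) auto
    then have "mact ?R e'' c (mact M e' 1 b) \<in> monomial_span ?R ?B"
      by (intro R.monomial_span_act R.monomial_span_base sub)
    then show ?thesis using act_act[of b e'' c e' 1] b Bc e(1) by (simp add: subset_iff)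
  qed
  have *: "component M x d \<in> monomial_span ?R ?B" if "x \<in> monomial_span M B" "far n d" for x d
    using that(1)
  proof induction
    case zero
    then show ?case using monomial_span.zero[of ?R] by simp
  next
    case (step b x e c)
    have bc: "b \<in> carrier M" "x \<in> carrier M" using step Bc monomial_span_closed by blast+
    have "mact M e c b \<in> piece M (e + \<delta> b)" using B(2)[OF step(1)] by (rule act_piece)
    then have "component M (mact M e c b) d = (if d = e + \<delta> b then mact M e c b else \<zero>)"
      by (rule component_homogeneous)
    then have "component M (mact M e c b) d = mact M e c b \<and> d = e + \<delta> b \<or>
        component M (mact M e c b) d = \<zero>\<^bsub>?R\<^esub>" by auto
    then have "component M (mact M e c b) d \<in> monomial_span ?R ?B"
      using one[OF step(1), of e c] that(2) monomial_span.zero[of ?R ?B] by (elim disjE conjE) metis+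
    then show ?case
      using R.monomial_span_add[OF sub _ step.IH, of "component M (mact M e c b) d"] bc
      by (simp add: component_add)
  qed
  have "carrier ?R \<subseteq> monomial_span ?R ?B"
  proof
    fix x assume "x \<in> carrier ?R"
    then have x: "x \<in> truncation M n" by simp
    then have xc: "x \<in> carrier M" by (rule truncation_closed)
    have "(\<Oplus>\<^bsub>?R\<^esub>d\<in>{d. component M x d \<noteq> \<zero>}. component M x d) \<in> monomial_span ?R ?B"
      using * B(3) xc truncation_support[OF x] by (intro R.monomial_span_finsum sub finite_support) auto
    then show "x \<in> monomial_span ?R ?B"
      using finsum_restrict(1)[OF T.submod finite_support[OF xc], of "component M x"]
        truncation_component[OF x] by (simp only: component_sum[OF xc, symmetric])
  qed
  then show ?thesis by (rule R.finitely_generatedI[OF fin sub])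
qed

lemma cofinite_sub_truncation: "cofinite_sub M (truncation M n)"
proof -
  interpret T: graded_sub M "truncation M n" by unfold_locales (rule truncation_graded_submodule)
  have "piece (quotient_module M (truncation M n)) d = {truncation M n}" if "far n d" for d
  proof -
    have "truncation M n +> x = truncation M n" if "x \<in> piece M d" for x
      using T.coset_eq_zero_iff[OF piece_closed[OF that]] truncation_piece[OF \<open>far n d\<close> that] by simp
    moreover have "piece M d \<noteq> {}" using zero_piece by blast
    ultimately show ?thesis by (simp add: image_constant_conv cong: image_cong)
  qed
  then have "finite {d. piece (quotient_module M (truncation M n)) d \<noteq> {\<zero>\<^bsub>quotient_module M (truncation M n)\<^esub>}}"
    unfolding eventually_cofinite[symmetric] eventually_far by (intro exI[of _ n]) simp
  then show ?thesis
    using T.quotient_graded T.quotient_finitely_generated[OF fin_gen] truncation_graded_submodule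
      truncation_finitely_generated
    unfolding cofinite_sub_def finite_module_def fg_graded_module_def by blast
qed

lemma cofinite_sub_support:
  assumes "cofinite_sub M U"
  shows "\<forall>\<^sub>F d in cofinite. piece M d \<subseteq> U"
proof -
  interpret U: graded_sub M U
    using assms by unfold_locales (simp add: cofinite_sub_def)
  have "\<forall>\<^sub>F d in cofinite. piece (quotient_module M U) d = {U}"
    using assms by (simp add: cofinite_sub_def finite_module_def eventually_cofinite)
  then show ?thesis
  proof eventually_elim
    case (elim d)
    show ?case
    proof
      fix x assume x: "x \<in> piece M d"
      then have "U +> x = U" using elim by auto
      then show "x \<in> U" using U.coset_eq_zero_iff x piece_closed by blast
    qed
  qed
qed

lemma finite_sub_zero: "finite_sub M {\<zero>}"
proof -
  have "submodule {\<zero>} kst_ring M"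
    by (rule submoduleI) auto
  then have g: "graded_submodule {\<zero>} M"
    by (rule graded_submoduleI) auto
  interpret Z: graded_sub M "{\<zero>}" by unfold_locales (rule g)
  interpret R: graded_kst_module "restrict_module M {\<zero>}" by (rule Z.restrict_graded)
  have "finitely_generated (restrict_module M {\<zero>})"
    by (rule R.finitely_generatedI[of "{}"]) (use monomial_span.zero[of "restrict_module M {\<zero>}"] in auto)
  moreover have "{\<zero>} \<inter> piece M d = {\<zero>}" for d using zero_piece by blast
  ultimately show ?thesis
    using g R.graded by (simp add: finite_sub_def finite_module_def fg_graded_module_def)
qed

lemma set_add_submodule:
  assumes "graded_submodule V M" "graded_submodule W M"
  shows "graded_submodule (V <+>\<^bsub>M\<^esub> W) M"
proof -
  interpret V: graded_sub M V by unfold_locales (rule assms)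
  interpret W: graded_sub M W by unfold_locales (rule assms)
  have mem: "x \<in> V <+>\<^bsub>M\<^esub> W \<longleftrightarrow> (\<exists>v\<in>V. \<exists>w\<in>W. x = v \<oplus> w)" for x
    by (auto simp: set_add_def')
  have "submodule (V <+>\<^bsub>M\<^esub> W) kst_ring M"
  proof (rule submoduleI)
    show "V <+>\<^bsub>M\<^esub> W \<subseteq> carrier M"
      using V.U_carrier W.U_carrier by (auto simp: mem)
    show "\<zero> \<in> V <+>\<^bsub>M\<^esub> W"
      unfolding mem by (intro bexI[of _ \<zero>]) auto
  next
    fix a assume "a \<in> V <+>\<^bsub>M\<^esub> W"
    then obtain v w where a: "v \<in> V" "w \<in> W" "a = v \<oplus> w" by (auto simp: mem)
    have c: "v \<in> carrier M" "w \<in> carrier M" using a by blast+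
    have "\<ominus> a = \<ominus> v \<oplus> \<ominus> w" using a c by (simp add: M.minus_add)
    then show "\<ominus> a \<in> V <+>\<^bsub>M\<^esub> W" using a V.U_neg W.U_neg unfolding mem by blast
    fix r :: "'k kst"
    have "r \<odot> a = r \<odot> v \<oplus> r \<odot> w" using a c by (simp add: act_add_right)
    then show "r \<odot> a \<in> V <+>\<^bsub>M\<^esub> W" using a V.U_act W.U_act unfolding mem by blast
    fix b assume "b \<in> V <+>\<^bsub>M\<^esub> W"
    then obtain v' w' where b: "v' \<in> V" "w' \<in> W" "b = v' \<oplus> w'" by (auto simp: mem)
    have c': "v' \<in> carrier M" "w' \<in> carrier M" using b by blast+
    have "a \<oplus> b = (v \<oplus> v') \<oplus> (w \<oplus> w')" using a b c c' by (simp add: M.add.m_ac)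
    then show "a \<oplus> b \<in> V <+>\<^bsub>M\<^esub> W" using a b V.U_add W.U_add unfolding mem by blast
  qed
  then show ?thesis
  proof (rule graded_submoduleI)
    fix x d assume "x \<in> V <+>\<^bsub>M\<^esub> W"
    then obtain v w where a: "v \<in> V" "w \<in> W" "x = v \<oplus> w" by (auto simp: mem)
    have c: "v \<in> carrier M" "w \<in> carrier M" using a by blast+
    have "component M x d = component M v d \<oplus> component M w d"
      using a c by (simp add: component_add)
    then show "component M x d \<in> V <+>\<^bsub>M\<^esub> W"
      using a V.U_component W.U_component unfolding mem by blast
  qed
qed

text \<open>
  Two representatives \<open>U \<rightarrow> N/V\<close> and \<open>U' \<rightarrow> N/V'\<close> of a morphism are compared modulo \<open>V + V'\<close>.
\<close>

lemma finite_sub_set_add: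
  assumes "finite_sub M V" "finite_sub M W"
  shows "finite_sub M (V <+>\<^bsub>M\<^esub> W)"
proof -
  interpret V: graded_sub M V using assms by unfold_locales (simp add: finite_sub_def)
  interpret W: graded_sub M W using assms by unfold_locales (simp add: finite_sub_def)
  interpret S: graded_sub M "V <+>\<^bsub>M\<^esub> W"
    using set_add_submodule V.graded_submod W.graded_submod by unfold_locales
  let ?V = "restrict_module M V" and ?W = "restrict_module M W" and ?S = "restrict_module M (V <+>\<^bsub>M\<^esub> W)"
  interpret RV: graded_kst_module ?V by (rule V.restrict_graded)
  interpret RW: graded_kst_module ?W by (rule W.restrict_graded)
  interpret RS: graded_kst_module ?S by (rule S.restrict_graded)
  have mem: "x \<in> V <+>\<^bsub>M\<^esub> W \<longleftrightarrow> (\<exists>v\<in>V. \<exists>w\<in>W. x = v \<oplus> w)" for x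
    by (auto simp: set_add_def')
  have sub: "V \<subseteq> V <+>\<^bsub>M\<^esub> W" "W \<subseteq> V <+>\<^bsub>M\<^esub> W"
  proof -
    show "V \<subseteq> V <+>\<^bsub>M\<^esub> W"
      unfolding mem subset_iff using V.U_carrier M.r_zero W.U_zero by metis
    show "W \<subseteq> V <+>\<^bsub>M\<^esub> W"
      unfolding mem subset_iff using W.U_carrier M.l_zero V.U_zero by metis
  qed
  have "finitely_generated ?V" "finitely_generated ?W"
    using assms by (auto simp: finite_sub_def finite_module_def fg_graded_module_def)
  then obtain B \<delta> C \<epsilon> where B: "finite B" "\<And>b. b \<in> B \<Longrightarrow> b \<in> piece ?V (\<delta> b)" "carrier ?V \<subseteq> monomial_span ?V B"
    and C: "finite C" "\<And>b. b \<in> C \<Longrightarrow> b \<in> piece ?W (\<epsilon> b)" "carrier ?W \<subseteq> monomial_span ?W C"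
    using RV.finitely_generated_homogeneous RW.finitely_generated_homogeneous by metis
  have BC: "B \<union> C \<subseteq> carrier ?S" using B(2) C(2) sub by auto
  have gV: "monomial_span ?V B \<subseteq> monomial_span ?S (B \<union> C)"
  proof
    fix x assume "x \<in> monomial_span ?V B"
    then show "x \<in> monomial_span ?S (B \<union> C)"
    proof induction
      case zero
      then show ?case using monomial_span.zero[of ?S] by simp
    next
      case (step b x e c)
      then show ?case using monomial_span.step[of b "B \<union> C" x ?S e c] by simp
    qed
  qed
  have gW: "monomial_span ?W C \<subseteq> monomial_span ?S (B \<union> C)"
  proof
    fix x assume "x \<in> monomial_span ?W C"
    then show "x \<in> monomial_span ?S (B \<union> C)"
    proof induction
      case zero
      then show ?case using monomial_span.zero[of ?S] by simp
    next
      case (step b x e c)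
      then show ?case using monomial_span.step[of b "B \<union> C" x ?S e c] by simp
    qed
  qed
  have "finitely_generated ?S"
  proof (rule RS.finitely_generatedI[OF _ BC])
    show "carrier ?S \<subseteq> monomial_span ?S (B \<union> C)"
    proof
      fix x assume "x \<in> carrier ?S"
      then obtain v w where "v \<in> V" "w \<in> W" "x = v \<oplus> w" by (auto simp: mem)
      then show "x \<in> monomial_span ?S (B \<union> C)"
        using RS.monomial_span_add[OF BC, of v w] gV gW B(3) C(3) by auto
    qed
  qed (use B C in simp)
  moreover have "\<forall>\<^sub>F d in cofinite. (V <+>\<^bsub>M\<^esub> W) \<inter> piece M d = {\<zero>}"
    using finite_sub_support[OF assms(1)] finite_sub_support[OF assms(2)]
  proof eventually_elim
    case (elim d)
    have "x = \<zero>" if x: "x \<in> V <+>\<^bsub>M\<^esub> W" "x \<in> piece M d" for x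
    proof -
      obtain v w where a: "v \<in> V" "w \<in> W" "x = v \<oplus> w" using x by (auto simp: mem)
      have c: "v \<in> carrier M" "w \<in> carrier M" using a by blast+
      have "x = component M x d" using component_homogeneous[OF x(2), of d] by simp
      also have "\<dots> = component M v d \<oplus> component M w d" using a c by (simp add: component_add)
      also have "component M v d = \<zero>"
        using elim(1) V.U_component[OF a(1)] component_piece[OF c(1)] by blast
      also have "component M w d = \<zero>"
        using elim(2) W.U_component[OF a(2)] component_piece[OF c(2)] by blast
      finally show ?thesis by simp
    qed
    then show ?case using S.U_zero zero_piece by blast
  qed
  ultimately show ?thesis
    using S.graded_submod RS.graded
    by (simp add: finite_sub_def finite_module_def fg_graded_module_def eventually_cofinite)
qed

end

section \<open>Morphisms of the Serre quotient as germs at infinity\<close>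

lemma graded_hom_iff:
  "f \<in> graded_hom M N \<longleftrightarrow>
    (\<forall>x\<in>carrier M. f x \<in> carrier N) \<and>
    (\<forall>x\<in>carrier M. \<forall>y\<in>carrier M. f (x \<oplus>\<^bsub>M\<^esub> y) = f x \<oplus>\<^bsub>N\<^esub> f y) \<and>
    (\<forall>r. \<forall>x\<in>carrier M. f (r \<odot>\<^bsub>M\<^esub> x) = r \<odot>\<^bsub>N\<^esub> f x) \<and>
    (\<forall>d. \<forall>x\<in>piece M d. f x \<in> piece N d)"
  by (auto simp: graded_hom_def hom_def Pi_iff)

text \<open>
  A germ \<open>\<phi>\<close> from \<open>M\<close> to \<open>N\<close> consists of additive maps \<open>M\<^sub>d \<rightarrow> N\<^sub>d\<close> that commute with all monomials; only
  their values for almost all \<open>d\<close> matter. Linearity over \<open>k\<close> is the case \<open>e = 0\<close>.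
\<close>

definition germ_at ::
    "('k::field kst, 'm) gmodule \<Rightarrow> ('k kst, 'n) gmodule \<Rightarrow> nat \<times> nat \<Rightarrow> (nat \<times> nat \<Rightarrow> 'm \<Rightarrow> 'n) \<Rightarrow> bool" where
  "germ_at M N d \<phi> \<longleftrightarrow>
     (\<forall>x\<in>piece M d. \<phi> d x \<in> piece N d) \<and>
     (\<forall>x\<in>piece M d. \<forall>y\<in>piece M d. \<phi> d (x \<oplus>\<^bsub>M\<^esub> y) = \<phi> d x \<oplus>\<^bsub>N\<^esub> \<phi> d y) \<and>
     (\<forall>x\<in>piece M d. \<forall>e c. \<phi> (e + d) (mact M e c x) = mact N e c (\<phi> d x))"

definition germ ::
    "('k::field kst, 'm) gmodule \<Rightarrow> ('k kst, 'n) gmodule \<Rightarrow> (nat \<times> nat \<Rightarrow> 'm \<Rightarrow> 'n) \<Rightarrow> bool" where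
  "germ M N \<phi> \<longleftrightarrow> (\<forall>\<^sub>F d in cofinite. germ_at M N d \<phi>)"

text \<open>
  The value \<open>\<phi>\<^sub>d x\<close> is the homogeneous element of the coset \<open>f x\<close>. For almost all \<open>d\<close> it is the only
  one, because \<open>V\<^sub>d = 0\<close>.
\<close>

definition represents ::
    "('k::field kst, 'm) gmodule \<Rightarrow> ('k kst, 'n) gmodule \<Rightarrow> ('m, 'n) qrep \<Rightarrow> (nat \<times> nat \<Rightarrow> 'm \<Rightarrow> 'n) \<Rightarrow> bool" where
  "represents M N = (\<lambda>(U, V, f) \<phi>. \<forall>\<^sub>F d in cofinite. \<forall>x\<in>piece M d. x \<in> U \<and> \<phi> d x \<in> f x \<inter> piece N d)"

definition germ_class ::
    "('k::field kst, 'm) gmodule \<Rightarrow> ('k kst, 'n) gmodule \<Rightarrow> (nat \<times> nat \<Rightarrow> 'm \<Rightarrow> 'n) \<Rightarrow> ('m, 'n) qrep set" where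
  "germ_class M N \<phi> = {r \<in> qreps M N. represents M N r \<phi>}"

text \<open>
  The extension of a germ by linearity to elements that are not homogeneous.
\<close>

definition extend_germ ::
    "('k::field kst, 'm) gmodule \<Rightarrow> ('k kst, 'n) gmodule \<Rightarrow> (nat \<times> nat \<Rightarrow> 'm \<Rightarrow> 'n) \<Rightarrow> 'm \<Rightarrow> 'n" where
  "extend_germ M N \<phi> x = (\<Oplus>\<^bsub>N\<^esub>d\<in>{d. component M x d \<noteq> \<zero>\<^bsub>M\<^esub>}. \<phi> d (component M x d))"

text \<open>
  The projection from the quotient by \<open>W\<close> to the quotient by \<open>U\<close> sends the coset of \<open>y\<close> to the coset
  of \<open>y\<close>.
\<close>

lemma (in graded_sub) set_add_coset:
  assumes "W \<subseteq> U" "\<zero> \<in> W" "y \<in> carrier M"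
  shows "U <+>\<^bsub>M\<^esub> (W +> y) = U +> y"
proof (intro equalityI subsetI)
  fix z assume "z \<in> U <+>\<^bsub>M\<^esub> (W +> y)"
  then obtain u w where u: "u \<in> U" "w \<in> W" "z = u \<oplus> (w \<oplus> y)"
    by (auto simp: set_add_def' a_r_coset_def')
  have c: "u \<in> carrier M" "w \<in> carrier M" "w \<in> U" using u assms(1) U_carrier by blast+
  have "z = (u \<oplus> w) \<oplus> y" using u c assms(3) by (simp add: M.add.m_assoc)
  moreover have "u \<oplus> w \<in> U" using u c by blast
  ultimately show "z \<in> U +> y" by (auto simp: a_r_coset_def')
next
  fix z assume "z \<in> U +> y"
  then obtain u where u: "u \<in> U" "z = u \<oplus> y" by (auto simp: a_r_coset_def')
  have "y \<in> W +> y" using assms(2,3) by (auto simp: a_r_coset_def' intro!: bexI[of _ \<zero>])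
  then show "z \<in> U <+>\<^bsub>M\<^esub> (W +> y)" using u by (auto simp: set_add_def')
qed

locale fg_pair = M: fg_kst_module M + N: fg_kst_module N
  for M :: "('k::field kst, 'm) gmodule" and N :: "('k kst, 'n) gmodule"
begin

lemma germ_zero:
  assumes "germ_at M N d \<phi>"
  shows "\<phi> d \<zero>\<^bsub>M\<^esub> = \<zero>\<^bsub>N\<^esub>"
proof -
  have *: "\<phi> d \<zero>\<^bsub>M\<^esub> = \<phi> d \<zero>\<^bsub>M\<^esub> \<oplus>\<^bsub>N\<^esub> \<phi> d \<zero>\<^bsub>M\<^esub>"
  proof -
    have "\<phi> d (\<zero>\<^bsub>M\<^esub> \<oplus>\<^bsub>M\<^esub> \<zero>\<^bsub>M\<^esub>) = \<phi> d \<zero>\<^bsub>M\<^esub> \<oplus>\<^bsub>N\<^esub> \<phi> d \<zero>\<^bsub>M\<^esub>"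
      using assms M.zero_piece unfolding germ_at_def by blast
    then show ?thesis by simp
  qed
  have "\<phi> d \<zero>\<^bsub>M\<^esub> \<in> carrier N"
    using assms M.zero_piece N.piece_closed unfolding germ_at_def by blast
  then show ?thesis using * by (simp only: N.M.add.l_cancel_one')
qed

lemma qrepsD:
  assumes "(U, V, f) \<in> qreps M N"
  shows "graded_sub M U" "graded_sub N V"
    and "\<And>x y. x \<in> U \<Longrightarrow> y \<in> f x \<Longrightarrow> y \<in> carrier N \<and> f x = V +>\<^bsub>N\<^esub> y"
    and "\<And>x y. x \<in> U \<Longrightarrow> y \<in> U \<Longrightarrow> f (x \<oplus>\<^bsub>M\<^esub> y) = f x <+>\<^bsub>N\<^esub> f y"
    and "\<And>r x y. x \<in> U \<Longrightarrow> y \<in> f x \<Longrightarrow> f (r \<odot>\<^bsub>M\<^esub> x) = V +>\<^bsub>N\<^esub> (r \<odot>\<^bsub>N\<^esub> y)"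
    and "\<And>x d. x \<in> U \<Longrightarrow> x \<in> piece M d \<Longrightarrow> \<exists>y\<in>piece N d. y \<in> f x"
    and "\<And>x. x \<in> U \<Longrightarrow> \<exists>y\<in>carrier N. y \<in> f x"
    and "\<forall>\<^sub>F d in cofinite. piece M d \<subseteq> U \<and> V \<inter> piece N d \<subseteq> {\<zero>\<^bsub>N\<^esub>}"
proof -
  have r: "cofinite_sub M U" "finite_sub N V" "f \<in> graded_hom (restrict_module M U) (quotient_module N V)"
    using assms by (auto simp: qreps_def)
  show 1: "graded_sub M U" using r by unfold_locales (simp add: cofinite_sub_def)
  show 2: "graded_sub N V" using r by unfold_locales (simp add: finite_sub_def)
  interpret V: graded_sub N V by (rule 2)
  note f = r(3)[unfolded graded_hom_iff]
  have ex: "\<exists>y\<in>carrier N. f x = V +>\<^bsub>N\<^esub> y" if "x \<in> U" for x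
    using f that unfolding restrict_module_simps V.quotient_carrier by blast
  show co: "y \<in> carrier N \<and> f x = V +>\<^bsub>N\<^esub> y" if x: "x \<in> U" "y \<in> f x" for x y
  proof -
    obtain z where z: "z \<in> carrier N" "f x = V +>\<^bsub>N\<^esub> z" using ex[OF x(1)] by blast
    then have "y \<in> carrier N" "y \<ominus>\<^bsub>N\<^esub> z \<in> V"
      using V.coset_mem_iff[OF z(1), of y] x(2) by blast+
    then show ?thesis using V.coset_eq_iff[OF _ z(1), of y] z(2) by simp
  qed
  show "\<exists>y\<in>carrier N. y \<in> f x" if x: "x \<in> U" for x
  proof -
    obtain z where z: "z \<in> carrier N" "f x = V +>\<^bsub>N\<^esub> z" using ex[OF x] by blast
    then show ?thesis using V.coset_self by blast
  qed
  show "f (x \<oplus>\<^bsub>M\<^esub> y) = f x <+>\<^bsub>N\<^esub> f y" if "x \<in> U" "y \<in> U" for x y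
    using f that by simp
  show "f (r \<odot>\<^bsub>M\<^esub> x) = V +>\<^bsub>N\<^esub> (r \<odot>\<^bsub>N\<^esub> y)" if "x \<in> U" "y \<in> f x" for r x y
  proof -
    have "f (r \<odot>\<^bsub>M\<^esub> x) = r \<odot>\<^bsub>quotient_module N V\<^esub> f x" using f that(1) by simp
    then show ?thesis using co[OF that] V.quotient_smult by simp
  qed
  show "\<exists>y\<in>piece N d. y \<in> f x" if "x \<in> U" "x \<in> piece M d" for x d
  proof -
    have "f x \<in> piece (quotient_module N V) d" using f that by simp
    then obtain y where "y \<in> piece N d" "f x = V +>\<^bsub>N\<^esub> y" by auto
    then show ?thesis using V.coset_self N.piece_closed by blast
  qed
  show "\<forall>\<^sub>F d in cofinite. piece M d \<subseteq> U \<and> V \<inter> piece N d \<subseteq> {\<zero>\<^bsub>N\<^esub>}"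
    using M.cofinite_sub_support[OF r(1)] N.finite_sub_support[OF r(2)] by (rule eventually_conj)
qed

lemma represents_exists:
  assumes "r \<in> qreps M N"
  shows "\<exists>\<phi>. represents M N r \<phi>"
proof -
  obtain U V f where r: "r = (U, V, f)" by (cases r)
  note q = qrepsD[OF assms[unfolded r]]
  let ?\<phi> = "\<lambda>d x. SOME y. y \<in> f x \<inter> piece N d"
  have "\<forall>\<^sub>F d in cofinite. \<forall>x\<in>piece M d. x \<in> U \<and> ?\<phi> d x \<in> f x \<inter> piece N d"
    using q(8)
  proof eventually_elim
    case (elim d)
    show ?case
    proof
      fix x assume x: "x \<in> piece M d"
      then have "x \<in> U" using elim by blast
      moreover from this obtain y where "y \<in> f x \<inter> piece N d" using q(6) x by blast
      then have "?\<phi> d x \<in> f x \<inter> piece N d" by (rule someI)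
      ultimately show "x \<in> U \<and> ?\<phi> d x \<in> f x \<inter> piece N d" by simp
    qed
  qed
  then have "represents M N r ?\<phi>" by (simp add: represents_def r)
  then show ?thesis by blast
qed

lemma coset_piece_unique:
  assumes "graded_sub N V" "V \<inter> piece N d \<subseteq> {\<zero>\<^bsub>N\<^esub>}" "y \<in> piece N d" "z \<in> piece N d"
    and "z \<in> V +>\<^bsub>N\<^esub> y"
  shows "z = y"
proof -
  interpret V: graded_sub N V by fact
  have c: "y \<in> carrier N" "z \<in> carrier N" using assms(3,4) by blast+
  have "z \<ominus>\<^bsub>N\<^esub> y \<in> V" using V.coset_mem_iff[OF c(1)] assms(5) by blast
  moreover have "z \<ominus>\<^bsub>N\<^esub> y \<in> piece N d"
    unfolding N.M.minus_eq using assms(3,4) by (intro N.add_piece N.neg_piece)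
  ultimately have "z \<ominus>\<^bsub>N\<^esub> y = \<zero>\<^bsub>N\<^esub>" using assms(2) by blast
  then show ?thesis by (rule N.M.minus_zeroD[OF c(2,1)])
qed

lemma eventually_shift:
  assumes "\<forall>\<^sub>F d in cofinite. P (d :: nat \<times> nat)"
  shows "\<forall>\<^sub>F d in cofinite. \<forall>e. P (e + d)"
  using assms unfolding eventually_far by (blast intro: far_add)

text \<open>
  The representative is linear up to elements of \<open>V\<close>. Between homogeneous elements of one bidegree
  where \<open>V\<close> vanishes this is linearity.
\<close>

lemma represents_germ:
  assumes "r \<in> qreps M N" "represents M N r \<phi>"
  shows "germ M N \<phi>"
proof -
  obtain U V f where r: "r = (U, V, f)" by (cases r)
  note q = qrepsD[OF assms(1)[unfolded r]]
  interpret V: graded_sub N V by (rule q(2))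
  have "\<forall>\<^sub>F d in cofinite. \<forall>x\<in>piece M d. x \<in> U \<and> \<phi> d x \<in> f x \<inter> piece N d"
    using assms(2) by (simp add: represents_def r)
  note ev = eventually_shift[OF eventually_conj[OF this q(8)]]
  show ?thesis
    unfolding germ_def using ev
  proof eventually_elim
    case (elim d)
    have d: "x \<in> U" "\<phi> (e + d) x \<in> f x" "\<phi> (e + d) x \<in> piece N (e + d)" if "x \<in> piece M (e + d)" for e x
      using elim[rule_format, of e] that by blast+
    have d0: "x \<in> U" "\<phi> d x \<in> f x" "\<phi> d x \<in> piece N d" if "x \<in> piece M d" for x
      using d[of x "(0, 0)"] that by (auto simp: zero_prod_def[symmetric])
    have V0: "V \<inter> piece N (e + d) \<subseteq> {\<zero>\<^bsub>N\<^esub>}" for e using elim by blast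
    have V00: "V \<inter> piece N d \<subseteq> {\<zero>\<^bsub>N\<^esub>}" using V0[of "(0, 0)"] by (simp add: zero_prod_def[symmetric])
    show ?case
      unfolding germ_at_def
    proof (intro conjI ballI allI)
      fix x assume x: "x \<in> piece M d"
      note dx = d0[OF x]
      have fx: "f x = V +>\<^bsub>N\<^esub> \<phi> d x" "\<phi> d x \<in> carrier N" using q(3)[OF dx(1,2)] by blast+
      show "\<phi> d x \<in> piece N d" by (rule dx(3))
      {
        fix y assume y: "y \<in> piece M d"
        note dy = d0[OF y]
        have fy: "f y = V +>\<^bsub>N\<^esub> \<phi> d y" "\<phi> d y \<in> carrier N" using q(3)[OF dy(1,2)] by blast+
        note dxy = d0[OF M.add_piece[OF x y]]
        have "f (x \<oplus>\<^bsub>M\<^esub> y) = V +>\<^bsub>N\<^esub> (\<phi> d x \<oplus>\<^bsub>N\<^esub> \<phi> d y)"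
          unfolding q(4)[OF dx(1) dy(1)] fx(1) fy(1) by (rule V.quotient_add[OF fx(2) fy(2)])
        then show "\<phi> d (x \<oplus>\<^bsub>M\<^esub> y) = \<phi> d x \<oplus>\<^bsub>N\<^esub> \<phi> d y"
          using coset_piece_unique[OF q(2) V00 N.add_piece[OF dx(3) dy(3)] dxy(3)] dxy(2) by simp
      }
      fix e c
      note de = d[OF M.act_piece[OF x], of e c]
      have "f (mact M e c x) = V +>\<^bsub>N\<^esub> (mact N e c (\<phi> d x))" by (rule q(5)[OF dx(1,2)])
      then show "\<phi> (e + d) (mact M e c x) = mact N e c (\<phi> d x)"
        using coset_piece_unique[OF q(2) V0 N.act_piece[OF dx(3)] de(3)] de(2) by simp
    qed
  qed
qed

text \<open>
  A representative is additive, hence determined on a truncation by its values on homogeneous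
  elements.
\<close>

lemma represents_value:
  assumes "(U, V, f) \<in> qreps M N"
    and rep: "\<forall>d. far n d \<longrightarrow> (\<forall>x\<in>piece M d. x \<in> U \<and> \<phi> d x \<in> f x \<inter> piece N d)"
    and x: "x \<in> truncation M n"
  shows "f x = V +>\<^bsub>N\<^esub> extend_germ M N \<phi> x" "extend_germ M N \<phi> x \<in> carrier N" "x \<in> U"
proof -
  note q = qrepsD[OF assms(1)]
  interpret U: graded_sub M U by (rule q(1))
  interpret V: graded_sub N V by (rule q(2))
  interpret Q: abelian_group "quotient_module N V" by (rule V.quotient_abelian_group)
  let ?D = "{d. component M x d \<noteq> \<zero>\<^bsub>M\<^esub>}"
  have xc: "x \<in> carrier M" using x by (rule M.truncation_closed)
  have D: "component M x d \<in> U" "\<phi> d (component M x d) \<in> f (component M x d)"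
    "\<phi> d (component M x d) \<in> carrier N" if "d \<in> ?D" for d
  proof -
    have "far n d" using M.truncation_support[OF x] that by blast
    then show "component M x d \<in> U" "\<phi> d (component M x d) \<in> f (component M x d)"
      "\<phi> d (component M x d) \<in> carrier N"
      using rep M.component_piece[OF xc, of d] N.piece_closed by blast+
  qed
  have f0: "f \<zero>\<^bsub>M\<^esub> = V"
  proof -
    obtain y where y: "y \<in> carrier N" "y \<in> f \<zero>\<^bsub>M\<^esub>" using q(7)[OF U.U_zero] by blast
    show ?thesis using q(5)[OF U.U_zero y(2), of 0] y(1) by simp
  qed
  have fQ: "f y \<in> carrier (quotient_module N V)" if "y \<in> U" for y
    using q(7)[OF that] q(3)[OF that] unfolding V.quotient_carrier by blast
  have "(\<Oplus>\<^bsub>M\<^esub>d\<in>?D. component M x d) \<in> U \<and> f (\<Oplus>\<^bsub>M\<^esub>d\<in>?D. component M x d) =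
    (\<Oplus>\<^bsub>quotient_module N V\<^esub>d\<in>?D. f (component M x d))"
    by (rule hom_finsum[OF M.M.abelian_monoid_axioms Q.abelian_monoid_axioms U.U_subset])
      (use f0 fQ q(4) D(1) M.finite_support[OF xc] U.U_add in auto)
  then have "x \<in> U" "f x = (\<Oplus>\<^bsub>quotient_module N V\<^esub>d\<in>?D. f (component M x d))"
    unfolding M.component_sum[OF xc, symmetric] by blast+
  moreover have "(\<Oplus>\<^bsub>quotient_module N V\<^esub>d\<in>?D. f (component M x d)) =
      (\<Oplus>\<^bsub>quotient_module N V\<^esub>d\<in>?D. V +>\<^bsub>N\<^esub> \<phi> d (component M x d))"
  proof (rule Q.finsum_cong')
    show "(\<lambda>d. V +>\<^bsub>N\<^esub> \<phi> d (component M x d)) \<in> ?D \<rightarrow> carrier (quotient_module N V)"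
      using D(3) unfolding Pi_iff V.quotient_carrier by blast
    show "f (component M x d) = V +>\<^bsub>N\<^esub> \<phi> d (component M x d)" if "d \<in> ?D" for d
      using q(3)[OF D(1,2)[OF that]] by blast
  qed simp
  ultimately show "f x = V +>\<^bsub>N\<^esub> extend_germ M N \<phi> x" "x \<in> U"
    using V.quotient_finsum[OF M.finite_support[OF xc] D(3)] unfolding extend_germ_def by simp_all
  show "extend_germ M N \<phi> x \<in> carrier N"
    unfolding extend_germ_def using D(3) by (intro N.M.finsum_closed) blast
qed

text \<open>
  Where \<open>V''\<close> vanishes, homogeneous elements that agree modulo \<open>V''\<close> are equal.
\<close>

lemma qrel_imp_represents:
  assumes "(r, r') \<in> qrel M N" "represents M N r \<phi>"
  shows "represents M N r' \<phi>"
proof -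
  obtain U V f U' V' f' where r: "r = (U, V, f)" "r' = (U', V', f')" by (cases r; cases r')
  obtain U'' V'' where q: "(U, V, f) \<in> qreps M N" "(U', V', f') \<in> qreps M N"
    and U: "cofinite_sub M U''" "U'' \<subseteq> U \<inter> U'" and V: "finite_sub N V''" "V \<union> V' \<subseteq> V''"
    and eq: "\<forall>x\<in>U''. V'' <+>\<^bsub>N\<^esub> f x = V'' <+>\<^bsub>N\<^esub> f' x"
    using assms(1) by (auto simp: qrel_def r)
  have gV: "graded_sub N V''" using V(1) by unfold_locales (simp add: finite_sub_def)
  interpret V'': graded_sub N V'' by (rule gV)
  note Q = qrepsD[OF q(1)] and Q' = qrepsD[OF q(2)]
  interpret V: graded_sub N V by (rule Q(2))
  interpret V': graded_sub N V' by (rule Q'(2))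
  have "\<forall>\<^sub>F d in cofinite. \<forall>x\<in>piece M d. x \<in> U \<and> \<phi> d x \<in> f x \<inter> piece N d"
    using assms(2) by (simp add: represents_def r)
  then have "\<forall>\<^sub>F d in cofinite. \<forall>x\<in>piece M d. x \<in> U' \<and> \<phi> d x \<in> f' x \<inter> piece N d"
    using M.cofinite_sub_support[OF U(1)] N.finite_sub_support[OF V(1)]
  proof eventually_elim
    case (elim d)
    show ?case
    proof
      fix x assume x: "x \<in> piece M d"
      have xU: "x \<in> U''" "x \<in> U" "x \<in> U'" using x elim(2) U(2) by blast+
      have \<phi>: "\<phi> d x \<in> f x" "\<phi> d x \<in> piece N d" using elim(1) x by blast+
      obtain y where y: "y \<in> piece N d" "y \<in> f' x" using Q'(6)[OF xU(3) x] by blast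
      have c: "\<phi> d x \<in> carrier N" "y \<in> carrier N" using \<phi> y by blast+
      have f: "f x = V +>\<^bsub>N\<^esub> \<phi> d x" "f' x = V' +>\<^bsub>N\<^esub> y"
        using Q(3)[OF xU(2) \<phi>(1)] Q'(3)[OF xU(3) y(2)] by blast+
      have "V'' +>\<^bsub>N\<^esub> \<phi> d x = V'' <+>\<^bsub>N\<^esub> f x"
        unfolding f(1) using V(2) c by (intro V''.set_add_coset[symmetric]) auto
      also have "\<dots> = V'' <+>\<^bsub>N\<^esub> f' x" using eq xU(1) by blast
      also have "\<dots> = V'' +>\<^bsub>N\<^esub> y"
        unfolding f(2) using V(2) c by (intro V''.set_add_coset) auto
      finally have "\<phi> d x = y"
        using V''.coset_self[OF c(1)] coset_piece_unique[OF gV elim(3) y(1) \<phi>(2)] by simp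
      then show "x \<in> U' \<and> \<phi> d x \<in> f' x \<inter> piece N d" using xU y by simp
    qed
  qed
  then show ?thesis by (simp add: represents_def r)
qed

text \<open>
  Both representatives agree modulo \<open>V + V'\<close> on a truncation, as both are given there by the linear
  extension of the common germ.
\<close>

lemma represents_imp_qrel:
  assumes "r \<in> qreps M N" "r' \<in> qreps M N" "represents M N r \<phi>" "represents M N r' \<phi>"
  shows "(r, r') \<in> qrel M N"
proof -
  obtain U V f U' V' f' where r: "r = (U, V, f)" "r' = (U', V', f')" by (cases r; cases r')
  note q = assms(1,2)[unfolded r]
  note Q = qrepsD[OF q(1)] and Q' = qrepsD[OF q(2)]
  interpret V: graded_sub N V by (rule Q(2))
  interpret V': graded_sub N V' by (rule Q'(2))
  have fin: "finite_sub N (V <+>\<^bsub>N\<^esub> V')"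
    using q by (intro N.finite_sub_set_add) (auto simp: qreps_def)
  then have gV: "graded_sub N (V <+>\<^bsub>N\<^esub> V')" by unfold_locales (simp add: finite_sub_def)
  interpret V'': graded_sub N "V <+>\<^bsub>N\<^esub> V'" by (rule gV)
  have sub: "V \<subseteq> V <+>\<^bsub>N\<^esub> V'" "V' \<subseteq> V <+>\<^bsub>N\<^esub> V'"
  proof -
    have mem: "v \<oplus>\<^bsub>N\<^esub> w \<in> V <+>\<^bsub>N\<^esub> V'" if "v \<in> V" "w \<in> V'" for v w
      using that by (auto simp: set_add_def')
    show "V \<subseteq> V <+>\<^bsub>N\<^esub> V'"
      using mem[OF _ V'.U_zero] V.U_carrier by fastforce
    show "V' \<subseteq> V <+>\<^bsub>N\<^esub> V'"
      using mem[OF V.U_zero] V'.U_carrier by fastforce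
  qed
  have "\<forall>\<^sub>F d in cofinite. \<forall>x\<in>piece M d. x \<in> U \<and> \<phi> d x \<in> f x \<inter> piece N d"
    "\<forall>\<^sub>F d in cofinite. \<forall>x\<in>piece M d. x \<in> U' \<and> \<phi> d x \<in> f' x \<inter> piece N d"
    using assms(3,4) by (simp_all add: represents_def r)
  from eventually_conj[OF this] obtain n where
    n: "\<forall>d. far n d \<longrightarrow> (\<forall>x\<in>piece M d. x \<in> U \<and> \<phi> d x \<in> f x \<inter> piece N d)"
    "\<forall>d. far n d \<longrightarrow> (\<forall>x\<in>piece M d. x \<in> U' \<and> \<phi> d x \<in> f' x \<inter> piece N d)"
    unfolding eventually_far by blast
  note v = represents_value[OF q(1) n(1)] and v' = represents_value[OF q(2) n(2)]
  have "(V <+>\<^bsub>N\<^esub> V') <+>\<^bsub>N\<^esub> f x = (V <+>\<^bsub>N\<^esub> V') <+>\<^bsub>N\<^esub> f' x" if x: "x \<in> truncation M n" for x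
    unfolding v(1)[OF x] v'(1)[OF x]
    using V''.set_add_coset[OF sub(1) V.U_zero v(2)[OF x]]
      V''.set_add_coset[OF sub(2) V'.U_zero v(2)[OF x]] by simp
  moreover have "truncation M n \<subseteq> U \<inter> U'" using v(3) v'(3) by blast
  ultimately have "\<exists>U'' V''. cofinite_sub M U'' \<and> U'' \<subseteq> U \<inter> U' \<and> finite_sub N V'' \<and> V \<union> V' \<subseteq> V'' \<and>
        (\<forall>x\<in>U''. V'' <+>\<^bsub>N\<^esub> f x = V'' <+>\<^bsub>N\<^esub> f' x)"
    using M.cofinite_sub_truncation[of n] fin sub
    by (intro exI[of _ "truncation M n"] exI[of _ "V <+>\<^bsub>N\<^esub> V'"]) blast
  then show ?thesis using q by (simp add: qrel_def r)
qed

lemma qrel_image_eq: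
  assumes "r \<in> qreps M N" "represents M N r \<phi>"
  shows "qrel M N `` {r} = germ_class M N \<phi>"
proof (intro equalityI subsetI)
  fix r' assume "r' \<in> qrel M N `` {r}"
  then have *: "(r, r') \<in> qrel M N" by simp
  then have "r' \<in> qreps M N" by (auto simp: qrel_def)
  then show "r' \<in> germ_class M N \<phi>" using qrel_imp_represents[OF * assms(2)] by (simp add: germ_class_def)
next
  fix r' assume "r' \<in> germ_class M N \<phi>"
  then show "r' \<in> qrel M N `` {r}"
    using represents_imp_qrel[OF assms(1) _ assms(2), of r'] by (simp add: germ_class_def)
qed

lemma germ_at_n:
  assumes "germ M N \<phi>"
  obtains n where "\<forall>m\<ge>n. \<forall>d. far m d \<longrightarrow> germ_at M N d \<phi>"
  using assms far_mono unfolding germ_def eventually_far by blast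

lemma extend_germ_eq:
  assumes germ: "\<forall>d. far n d \<longrightarrow> germ_at M N d \<phi>" and x: "x \<in> truncation M n"
    and D: "finite D" "\<forall>d\<in>D. far n d" "\<forall>d. d \<notin> D \<longrightarrow> component M x d = \<zero>\<^bsub>M\<^esub>"
  shows "extend_germ M N \<phi> x = (\<Oplus>\<^bsub>N\<^esub>d\<in>D. \<phi> d (component M x d))"
  unfolding extend_germ_def
proof (rule N.M.add.finprod_mono_neutral_cong_left[OF D(1)])
  have xc: "x \<in> carrier M" using x by (rule M.truncation_closed)
  show "{d. component M x d \<noteq> \<zero>\<^bsub>M\<^esub>} \<subseteq> D" using D(3) by blast
  show "\<phi> i (component M x i) = \<zero>\<^bsub>N\<^esub>" if "i \<in> D - {d. component M x d \<noteq> \<zero>\<^bsub>M\<^esub>}" for i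
    using germ_zero[OF germ[rule_format, OF D(2)[rule_format], of i]] that by simp
  show "(\<lambda>d. \<phi> d (component M x d)) \<in> D \<rightarrow> carrier N"
  proof
    fix d assume "d \<in> D"
    then have "\<phi> d (component M x d) \<in> piece N d"
      using germ[rule_format, OF D(2)[rule_format]] M.component_piece[OF xc, of d] unfolding germ_at_def by blast
    then show "\<phi> d (component M x d) \<in> carrier N" by blast
  qed
qed simp

lemma extend_germ_homogeneous:
  assumes germ: "\<forall>d. far n d \<longrightarrow> germ_at M N d \<phi>" and d: "far n d" and x: "x \<in> piece M d"
  shows "extend_germ M N \<phi> x = \<phi> d x"
proof -
  have p: "\<phi> d x \<in> carrier N" using germ[rule_format, OF d] x N.piece_closed unfolding germ_at_def by blast
  have "extend_germ M N \<phi> x = (\<Oplus>\<^bsub>N\<^esub>e\<in>{d}. \<phi> e (component M x e))"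
    by (rule extend_germ_eq[OF germ M.truncation_piece[OF d x]]) (use d M.component_homogeneous[OF x] in auto)
  also have "\<dots> = \<phi> d x"
    using M.component_homogeneous[OF x, of d] p by simp
  finally show ?thesis .
qed

lemma extend_germ_closed:
  assumes germ: "\<forall>d. far n d \<longrightarrow> germ_at M N d \<phi>" and x: "x \<in> truncation M n"
  shows "extend_germ M N \<phi> x \<in> carrier N"
  unfolding extend_germ_def
proof (rule N.M.finsum_closed, rule)
  fix d assume "d \<in> {d. component M x d \<noteq> \<zero>\<^bsub>M\<^esub>}"
  then have "far n d" using M.truncation_support[OF x] by blast
  then have "\<phi> d (component M x d) \<in> piece N d"
    using germ[rule_format] M.component_piece[OF M.truncation_closed[OF x], of d] unfolding germ_at_def by blast
  then show "\<phi> d (component M x d) \<in> carrier N" by blast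
qed

lemma extend_germ_add:
  assumes germ: "\<forall>d. far n d \<longrightarrow> germ_at M N d \<phi>" and x: "x \<in> truncation M n" and y: "y \<in> truncation M n"
  shows "extend_germ M N \<phi> (x \<oplus>\<^bsub>M\<^esub> y) = extend_germ M N \<phi> x \<oplus>\<^bsub>N\<^esub> extend_germ M N \<phi> y"
proof -
  have c: "x \<in> carrier M" "y \<in> carrier M" using x y M.truncation_closed by blast+
  let ?D = "{d. component M x d \<noteq> \<zero>\<^bsub>M\<^esub>} \<union> {d. component M y d \<noteq> \<zero>\<^bsub>M\<^esub>}"
  have D: "finite ?D" "\<forall>d\<in>?D. far n d"
    using M.finite_support c M.truncation_support[OF x] M.truncation_support[OF y] by blast+
  have p: "component M x d \<in> piece M d" "component M y d \<in> piece M d" for d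
    using M.component_piece c by blast+
  have cl: "\<phi> d (component M x d) \<in> carrier N" "\<phi> d (component M y d) \<in> carrier N" if "d \<in> ?D" for d
    using germ[rule_format, OF D(2)[rule_format, OF that]] p[of d] N.piece_closed unfolding germ_at_def by blast+
  have "extend_germ M N \<phi> (x \<oplus>\<^bsub>M\<^esub> y) = (\<Oplus>\<^bsub>N\<^esub>d\<in>?D. \<phi> d (component M (x \<oplus>\<^bsub>M\<^esub> y) d))"
    by (rule extend_germ_eq[OF germ M.truncation_add[OF x y] D]) (use c M.component_add in auto)
  also have "\<dots> = (\<Oplus>\<^bsub>N\<^esub>d\<in>?D. \<phi> d (component M x d) \<oplus>\<^bsub>N\<^esub> \<phi> d (component M y d))"
  proof (rule N.M.finsum_cong')
    show "\<phi> d (component M (x \<oplus>\<^bsub>M\<^esub> y) d) = \<phi> d (component M x d) \<oplus>\<^bsub>N\<^esub> \<phi> d (component M y d)"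
      if "d \<in> ?D" for d
      using germ[rule_format, OF D(2)[rule_format, OF that]] p[of d] unfolding germ_at_def M.component_add[OF c] by blast
    show "(\<lambda>d. \<phi> d (component M x d) \<oplus>\<^bsub>N\<^esub> \<phi> d (component M y d)) \<in> ?D \<rightarrow> carrier N"
      using cl by blast
  qed simp
  also have "\<dots> = (\<Oplus>\<^bsub>N\<^esub>d\<in>?D. \<phi> d (component M x d)) \<oplus>\<^bsub>N\<^esub> (\<Oplus>\<^bsub>N\<^esub>d\<in>?D. \<phi> d (component M y d))"
    using cl by (intro N.M.finsum_addf) blast+
  also have "(\<Oplus>\<^bsub>N\<^esub>d\<in>?D. \<phi> d (component M x d)) = extend_germ M N \<phi> x"
    by (rule extend_germ_eq[OF germ x D, symmetric]) auto
  also have "(\<Oplus>\<^bsub>N\<^esub>d\<in>?D. \<phi> d (component M y d)) = extend_germ M N \<phi> y"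
    by (rule extend_germ_eq[OF germ y D, symmetric]) auto
  finally show ?thesis .
qed

lemma extend_germ_zero: "extend_germ M N \<phi> \<zero>\<^bsub>M\<^esub> = \<zero>\<^bsub>N\<^esub>"
  by (simp add: extend_germ_def)

lemma extend_germ_act:
  assumes germ: "\<forall>d. far n d \<longrightarrow> germ_at M N d \<phi>" and x: "x \<in> truncation M n"
  shows "extend_germ M N \<phi> (mact M e c x) = mact N e c (extend_germ M N \<phi> x)"
proof -
  have "x \<in> truncation M n \<and> extend_germ M N \<phi> (mact M e c x) = mact N e c (extend_germ M N \<phi> x)"
    using M.truncation_closed[OF x]
  proof (induction x rule: M.component_induct)
    case zero
    then show ?case using extend_germ_zero by simp
  next
    case (add d y)
    let ?x = "component M x d"
    have xp: "?x \<in> piece M d" "?x \<in> truncation M n"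
      using M.component_piece[OF M.truncation_closed[OF x]] M.truncation_component[OF x] by blast+
    have 1: "extend_germ M N \<phi> (mact M e c ?x) = mact N e c (extend_germ M N \<phi> ?x)"
    proof (cases "far n d")
      case True
      have "extend_germ M N \<phi> (mact M e c ?x) = \<phi> (e + d) (mact M e c ?x)"
        by (rule extend_germ_homogeneous[OF germ far_add[OF True] M.act_piece[OF xp(1)]])
      also have "\<dots> = mact N e c (\<phi> d ?x)"
        using germ[rule_format, OF True] xp(1) unfolding germ_at_def by blast
      also have "\<phi> d ?x = extend_germ M N \<phi> ?x"
        by (rule extend_germ_homogeneous[OF germ True xp(1), symmetric])
      finally show ?thesis .
    next
      case False
      then have "?x = \<zero>\<^bsub>M\<^esub>" by (rule M.truncation_piece_zero[OF _ xp])
      then show ?thesis using extend_germ_zero by simp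
    qed
    have y: "y \<in> truncation M n" "extend_germ M N \<phi> (mact M e c y) = mact N e c (extend_germ M N \<phi> y)" using add by blast+
    have "mact M e c (?x \<oplus>\<^bsub>M\<^esub> y) = mact M e c ?x \<oplus>\<^bsub>M\<^esub> mact M e c y"
      using M.truncation_closed xp(2) y(1) by (intro M.act_add_right) blast+
    then have "extend_germ M N \<phi> (mact M e c (?x \<oplus>\<^bsub>M\<^esub> y)) = extend_germ M N \<phi> (mact M e c ?x) \<oplus>\<^bsub>N\<^esub> extend_germ M N \<phi> (mact M e c y)"
      using extend_germ_add[OF germ M.truncation_smult[OF xp(2)] M.truncation_smult[OF y(1)]] by simp
    also have "\<dots> = mact N e c (extend_germ M N \<phi> ?x \<oplus>\<^bsub>N\<^esub> extend_germ M N \<phi> y)"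
      unfolding 1 y(2) by (rule N.act_add_right[symmetric, OF extend_germ_closed[OF germ xp(2)] extend_germ_closed[OF germ y(1)]])
    also have "extend_germ M N \<phi> ?x \<oplus>\<^bsub>N\<^esub> extend_germ M N \<phi> y = extend_germ M N \<phi> (?x \<oplus>\<^bsub>M\<^esub> y)"
      by (rule extend_germ_add[OF germ xp(2) y(1), symmetric])
    finally show ?case using M.truncation_add[OF xp(2) y(1)] by blast
  qed
  then show ?thesis by blast
qed

lemma extend_germ_smult:
  assumes germ: "\<forall>d. far n d \<longrightarrow> germ_at M N d \<phi>" and x: "x \<in> truncation M n"
  shows "extend_germ M N \<phi> (r \<odot>\<^bsub>M\<^esub> x) = r \<odot>\<^bsub>N\<^esub> extend_germ M N \<phi> x"
proof (induction r rule: kst_induct)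
  case zero
  then show ?case using M.truncation_closed[OF x] extend_germ_closed[OF germ x] extend_germ_zero by simp
next
  case (add r e c)
  have "(Poly_Mapping.single e c + r) \<odot>\<^bsub>M\<^esub> x = mact M e c x \<oplus>\<^bsub>M\<^esub> r \<odot>\<^bsub>M\<^esub> x"
    using M.smult_l_distr[of "Poly_Mapping.single e c" r x] M.truncation_closed[OF x] by simp
  moreover have "(Poly_Mapping.single e c + r) \<odot>\<^bsub>N\<^esub> extend_germ M N \<phi> x =
      mact N e c (extend_germ M N \<phi> x) \<oplus>\<^bsub>N\<^esub> r \<odot>\<^bsub>N\<^esub> extend_germ M N \<phi> x"
    using N.smult_l_distr[of "Poly_Mapping.single e c" r "extend_germ M N \<phi> x"] extend_germ_closed[OF germ x] by simp
  ultimately show ?case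
    using extend_germ_add[OF germ M.truncation_smult[OF x] M.truncation_smult[OF x], of "Poly_Mapping.single e c" r]
      extend_germ_act[OF germ x, of e c] add by simp
qed

text \<open>
  On a truncation the linear extension only involves bidegrees in which \<open>\<phi>\<close> is linear and commutes
  with the monomials, so it is a morphism of graded modules.
\<close>

lemma extend_germ_graded_hom:
  assumes germ: "\<forall>d. far n d \<longrightarrow> germ_at M N d \<phi>"
  shows "extend_germ M N \<phi> \<in> graded_hom (restrict_module M (truncation M n)) N"
  unfolding graded_hom_iff restrict_module_simps
proof (intro conjI ballI allI)
  fix d x assume x: "x \<in> truncation M n \<inter> piece M d"
  show "extend_germ M N \<phi> x \<in> piece N d"
  proof (cases "far n d")
    case True
    then show ?thesis
      using extend_germ_homogeneous[OF germ True, of x] germ[rule_format, OF True] x unfolding germ_at_def by simp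
  next
    case False
    then have "x = \<zero>\<^bsub>M\<^esub>" using M.truncation_piece_zero[OF False, of x] x by blast
    then show ?thesis using extend_germ_zero by simp
  qed
qed (use extend_germ_closed[OF germ] extend_germ_add[OF germ] extend_germ_smult[OF germ] in blast)+

lemma graded_hom_truncation:
  assumes h: "h \<in> graded_hom (restrict_module M (truncation M n)) N" and x: "x \<in> truncation M n"
  shows "h x \<in> truncation N n"
proof -
  note H = h[unfolded graded_hom_iff restrict_module_simps]
  have xc: "x \<in> carrier M" using x by (rule M.truncation_closed)
  let ?D = "{d. component M x d \<noteq> \<zero>\<^bsub>M\<^esub>}"
  have h0: "h \<zero>\<^bsub>M\<^esub> = \<zero>\<^bsub>N\<^esub>"
  proof -
    have "h ((0 :: 'k kst) \<odot>\<^bsub>M\<^esub> \<zero>\<^bsub>M\<^esub>) = (0 :: 'k kst) \<odot>\<^bsub>N\<^esub> h \<zero>\<^bsub>M\<^esub>" "h \<zero>\<^bsub>M\<^esub> \<in> carrier N"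
      using H M.truncation_zero by blast+
    then show ?thesis by simp
  qed
  have hp: "h (component M x d) \<in> truncation N n" if "d \<in> ?D" for d
  proof -
    have "far n d" using M.truncation_support[OF x] that by blast
    moreover have "h (component M x d) \<in> piece N d"
      using H M.truncation_component[OF x, of d] M.component_piece[OF xc, of d] by blast
    ultimately show ?thesis by (rule N.truncation_piece)
  qed
  have tc: "truncation M n \<subseteq> carrier M" "truncation N n \<subseteq> carrier N" using M.truncation_closed N.truncation_closed by blast+
  have "h (\<Oplus>\<^bsub>M\<^esub>d\<in>?D. component M x d) = (\<Oplus>\<^bsub>N\<^esub>d\<in>?D. h (component M x d))"
    by (rule conjunct2[OF hom_finsum[OF M.M.abelian_monoid_axioms N.M.abelian_monoid_axioms tc(1)]])
      (use H h0 M.truncation_add M.truncation_component[OF x] M.finite_support[OF xc] in auto)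
  also have "\<dots> \<in> truncation N n"
    by (rule finsum_in[OF N.M.abelian_monoid_axioms tc(2)])
      (use hp N.truncation_add M.finite_support[OF xc] in auto)
  finally show ?thesis unfolding M.component_sum[OF xc, symmetric] .
qed

text \<open>
  A morphism defined on a truncation is a representative with \<open>V = 0\<close>; its value at \<open>x\<close> is then the
  one-element coset of \<open>h x\<close>.
\<close>

lemma qrepI:
  assumes h: "h \<in> graded_hom (restrict_module M (truncation M n)) N"
    and f: "\<forall>x\<in>truncation M n. f x = {h x}"
  shows "(truncation M n, {\<zero>\<^bsub>N\<^esub>}, f) \<in> qreps M N"
    and "\<forall>d. far n d \<longrightarrow> (\<forall>x\<in>piece M d. h x = \<phi> d x) \<Longrightarrow>
      represents M N (truncation M n, {\<zero>\<^bsub>N\<^esub>}, f) \<phi>"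
proof -
  note H = h[unfolded graded_hom_iff restrict_module_simps]
  interpret Z: graded_sub N "{\<zero>\<^bsub>N\<^esub>}"
    using N.finite_sub_zero by unfold_locales (simp add: finite_sub_def)
  have fc: "f x = {\<zero>\<^bsub>N\<^esub>} +>\<^bsub>N\<^esub> h x" "h x \<in> carrier N" if "x \<in> truncation M n" for x
    using H f that by (simp_all add: a_r_coset_def')
  have "f \<in> graded_hom (restrict_module M (truncation M n)) (quotient_module N {\<zero>\<^bsub>N\<^esub>})"
    unfolding graded_hom_iff restrict_module_simps
  proof (intro conjI ballI allI)
    fix x assume x: "x \<in> truncation M n"
    show "f x \<in> carrier (quotient_module N {\<zero>\<^bsub>N\<^esub>})"
      unfolding Z.quotient_carrier using fc[OF x] by blast
    show "f (r \<odot>\<^bsub>M\<^esub> x) = r \<odot>\<^bsub>quotient_module N {\<zero>\<^bsub>N\<^esub>}\<^esub> f x" for r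
      unfolding fc(1)[OF x] fc(1)[OF M.truncation_smult[OF x]] Z.quotient_smult[OF fc(2)[OF x]] using H x by simp
    fix y assume y: "y \<in> truncation M n"
    show "f (x \<oplus>\<^bsub>M\<^esub> y) = f x \<oplus>\<^bsub>quotient_module N {\<zero>\<^bsub>N\<^esub>}\<^esub> f y"
      unfolding fc(1)[OF x] fc(1)[OF y] fc(1)[OF M.truncation_add[OF x y]] quotient_module_simps
        Z.quotient_add[OF fc(2)[OF x] fc(2)[OF y]] using H x y by simp
  next
    fix d x assume x: "x \<in> truncation M n \<inter> piece M d"
    then show "f x \<in> piece (quotient_module N {\<zero>\<^bsub>N\<^esub>}) d"
      using fc(1)[of x] H by simp
  qed
  then show "(truncation M n, {\<zero>\<^bsub>N\<^esub>}, f) \<in> qreps M N"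
    using M.cofinite_sub_truncation N.finite_sub_zero by (simp add: qreps_def)
  assume eq: "\<forall>d. far n d \<longrightarrow> (\<forall>x\<in>piece M d. h x = \<phi> d x)"
  have "x \<in> truncation M n \<and> \<phi> d x \<in> f x \<inter> piece N d" if "far n d" "x \<in> piece M d" for d x
  proof -
    have x: "x \<in> truncation M n" using that by (rule M.truncation_piece)
    have "h x \<in> piece N d" using H x that(2) by blast
    then show ?thesis using x f eq that by simp
  qed
  then show "represents M N (truncation M n, {\<zero>\<^bsub>N\<^esub>}, f) \<phi>"
    unfolding represents_def case_prod_conv eventually_far by blast
qed

lemma germ_class_memberI:
  assumes "h \<in> graded_hom (restrict_module M (truncation M n)) N"
    and "\<forall>x\<in>truncation M n. f x = {h x}"
    and "\<forall>d. far n d \<longrightarrow> (\<forall>x\<in>piece M d. h x = \<phi> d x)"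
  shows "(truncation M n, {\<zero>\<^bsub>N\<^esub>}, f) \<in> germ_class M N \<phi>"
  unfolding germ_class_def using qrepI(1)[OF assms(1,2)] qrepI(2)[OF assms(1,2,3)] by blast

lemma germ_representative:
  assumes "germ M N \<phi>"
  obtains n where "\<forall>m\<ge>n. (truncation M m, {\<zero>\<^bsub>N\<^esub>}, \<lambda>x. {extend_germ M N \<phi> x}) \<in> germ_class M N \<phi> \<and>
    extend_germ M N \<phi> \<in> graded_hom (restrict_module M (truncation M m)) N \<and>
    (\<forall>d. far m d \<longrightarrow> (\<forall>x\<in>piece M d. extend_germ M N \<phi> x = \<phi> d x))"
proof -
  obtain n where n: "\<forall>m\<ge>n. \<forall>d. far m d \<longrightarrow> germ_at M N d \<phi>"
    using germ_at_n[OF assms] by blast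
  have "(truncation M m, {\<zero>\<^bsub>N\<^esub>}, \<lambda>x. {extend_germ M N \<phi> x}) \<in> germ_class M N \<phi> \<and>
      extend_germ M N \<phi> \<in> graded_hom (restrict_module M (truncation M m)) N \<and>
      (\<forall>d. far m d \<longrightarrow> (\<forall>x\<in>piece M d. extend_germ M N \<phi> x = \<phi> d x))" if "n \<le> m" for m
  proof -
    have g: "\<forall>d. far m d \<longrightarrow> germ_at M N d \<phi>" using n that by blast
    have e: "\<forall>d. far m d \<longrightarrow> (\<forall>x\<in>piece M d. extend_germ M N \<phi> x = \<phi> d x)"
      using extend_germ_homogeneous[OF g] by blast
    show ?thesis
      using germ_class_memberI[OF extend_germ_graded_hom[OF g] _ e, of "\<lambda>x. {extend_germ M N \<phi> x}"] extend_germ_graded_hom[OF g] e by simp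
  qed
  then show thesis using that by blast
qed

lemma germ_class_nonempty: "germ M N \<phi> \<Longrightarrow> \<exists>r. r \<in> germ_class M N \<phi>"
  by (rule germ_representative) blast+

lemma germ_class_in_qhom:
  assumes "germ M N \<phi>"
  shows "germ_class M N \<phi> \<in> qhom M N"
proof -
  obtain r where r: "r \<in> germ_class M N \<phi>" using germ_class_nonempty[OF assms] by blast
  then have "germ_class M N \<phi> = qrel M N `` {r}"
    using qrel_image_eq[of r \<phi>] unfolding germ_class_def by blast
  then show ?thesis using r unfolding qhom_def germ_class_def by (auto intro: quotientI)
qed

lemma qhom_germ:
  assumes "F \<in> qhom M N"
  obtains \<phi> where "germ M N \<phi>" "F = germ_class M N \<phi>"
proof -
  obtain r where r: "r \<in> qreps M N" "F = qrel M N `` {r}"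
    using assms unfolding qhom_def by (auto elim: quotientE)
  obtain \<phi> where "represents M N r \<phi>" using represents_exists[OF r(1)] by blast
  then show thesis using that[of \<phi>] represents_germ[OF r(1)] qrel_image_eq[OF r(1)] r(2) by blast
qed

lemma germ_class_eq_iff:
  assumes "germ M N \<phi>"
  shows "germ_class M N \<phi> = germ_class M N \<psi> \<longleftrightarrow> (\<forall>\<^sub>F d in cofinite. \<forall>x\<in>piece M d. \<phi> d x = \<psi> d x)"
proof
  assume eq: "germ_class M N \<phi> = germ_class M N \<psi>"
  obtain r where "r \<in> germ_class M N \<phi>" using germ_class_nonempty[OF assms] by blast
  then have r: "r \<in> qreps M N" "represents M N r \<phi>" "represents M N r \<psi>"
    using eq by (auto simp: germ_class_def)
  obtain U V f where r': "r = (U, V, f)" by (cases r)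
  note q = qrepsD[OF r(1)[unfolded r']]
  have "\<forall>\<^sub>F d in cofinite. \<forall>x\<in>piece M d. x \<in> U \<and> \<phi> d x \<in> f x \<inter> piece N d"
    "\<forall>\<^sub>F d in cofinite. \<forall>x\<in>piece M d. x \<in> U \<and> \<psi> d x \<in> f x \<inter> piece N d"
    using r(2,3) by (simp_all add: represents_def r')
  then show "\<forall>\<^sub>F d in cofinite. \<forall>x\<in>piece M d. \<phi> d x = \<psi> d x"
    using q(8)
  proof eventually_elim
    case (elim d)
    show ?case
    proof
      fix x assume x: "x \<in> piece M d"
      have *: "x \<in> U" "\<phi> d x \<in> f x" "\<phi> d x \<in> piece N d" "\<psi> d x \<in> f x" "\<psi> d x \<in> piece N d"
        using elim(1,2) x by blast+
      then show "\<phi> d x = \<psi> d x"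
        using coset_piece_unique[OF q(2) _ *(5,3)] q(3)[OF *(1,4)] elim(3) by blast
    qed
  qed
next
  assume *: "\<forall>\<^sub>F d in cofinite. \<forall>x\<in>piece M d. \<phi> d x = \<psi> d x"
  have "represents M N r \<phi> \<longleftrightarrow> represents M N r \<psi>" for r
  proof -
    obtain U V f where r: "r = (U, V, f)" by (cases r)
    show ?thesis
      unfolding r represents_def case_prod_conv
      by (rule eventually_cong[OF *]) auto
  qed
  then show "germ_class M N \<phi> = germ_class M N \<psi>" by (simp add: germ_class_def)
qed

lemma represents_add:
  assumes "r \<in> germ_class M N \<phi>" "s \<in> germ_class M N \<psi>" "rep_add N r s \<in> qreps M N"
  shows "represents M N (rep_add N r s) (\<lambda>d x. \<phi> d x \<oplus>\<^bsub>N\<^esub> \<psi> d x)"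
proof -
  obtain U V f U' V' f' where r: "r = (U, V, f)" "s = (U', V', f')" by (cases r; cases s)
  have "\<forall>\<^sub>F d in cofinite. \<forall>x\<in>piece M d. x \<in> U \<and> \<phi> d x \<in> f x \<inter> piece N d"
    "\<forall>\<^sub>F d in cofinite. \<forall>x\<in>piece M d. x \<in> U' \<and> \<psi> d x \<in> f' x \<inter> piece N d"
    using assms(1,2) by (simp_all add: germ_class_def represents_def r)
  then show ?thesis
    unfolding represents_def rep_add_def r case_prod_conv
    by eventually_elim (auto simp: set_add_def' intro: N.add_piece)
qed

lemma graded_hom_add:
  assumes "h \<in> graded_hom (restrict_module M U) N" "h' \<in> graded_hom (restrict_module M U) N"
  shows "(\<lambda>x. h x \<oplus>\<^bsub>N\<^esub> h' x) \<in> graded_hom (restrict_module M U) N"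
  using assms unfolding graded_hom_iff restrict_module_simps
  by (auto simp: N.act_add_right N.M.add.m_ac intro: N.add_piece)

lemma germ_add:
  assumes "germ M N \<phi>" "germ M N \<psi>"
  shows "germ M N (\<lambda>d x. \<phi> d x \<oplus>\<^bsub>N\<^esub> \<psi> d x)"
  using assms unfolding germ_def
proof eventually_elim
  case (elim d)
  have cl: "\<phi> d x \<in> carrier N" "\<psi> d x \<in> carrier N" if "x \<in> piece M d" for x
    using elim that N.piece_closed unfolding germ_at_def by blast+
  show ?case
    using elim unfolding germ_at_def
    by (simp add: N.act_add_right N.M.add.m_ac N.add_piece cl)
qed

text \<open>
  The sum in the colimit is a union over all pairs of representatives. A pair whose sum is a
  representative contributes the class of the sum of the germs, any other pair contributes nothing, and
  the pair of linear extensions on a common truncation is of the first kind.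
\<close>

lemma qadd_germ_class:
  assumes "germ M N \<phi>" "germ M N \<psi>"
  shows "qadd M N (germ_class M N \<phi>) (germ_class M N \<psi>) = germ_class M N (\<lambda>d x. \<phi> d x \<oplus>\<^bsub>N\<^esub> \<psi> d x)"
    (is "_ = ?R")
proof
  have "qrel M N `` {rep_add N r s} \<subseteq> ?R" if "r \<in> germ_class M N \<phi>" "s \<in> germ_class M N \<psi>" for r s
  proof (cases "rep_add N r s \<in> qreps M N")
    case True
    then show ?thesis using qrel_image_eq[OF True represents_add[OF that True]] by simp
  next
    case False
    then show ?thesis by (auto simp: qrel_def)
  qed
  then show "qadd M N (germ_class M N \<phi>) (germ_class M N \<psi>) \<subseteq> ?R"
    unfolding qadd_def by blast
  obtain n where n: "\<forall>m\<ge>n. (truncation M m, {\<zero>\<^bsub>N\<^esub>}, \<lambda>x. {extend_germ M N \<phi> x}) \<in> germ_class M N \<phi> \<and>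
    extend_germ M N \<phi> \<in> graded_hom (restrict_module M (truncation M m)) N \<and>
    (\<forall>d. far m d \<longrightarrow> (\<forall>x\<in>piece M d. extend_germ M N \<phi> x = \<phi> d x))"
    using germ_representative[OF assms(1)] by blast
  obtain n' where n': "\<forall>m\<ge>n'. (truncation M m, {\<zero>\<^bsub>N\<^esub>}, \<lambda>x. {extend_germ M N \<psi> x}) \<in> germ_class M N \<psi> \<and>
    extend_germ M N \<psi> \<in> graded_hom (restrict_module M (truncation M m)) N \<and>
    (\<forall>d. far m d \<longrightarrow> (\<forall>x\<in>piece M d. extend_germ M N \<psi> x = \<psi> d x))"
    using germ_representative[OF assms(2)] by blast
  let ?m = "max n n'"
  note a = n[rule_format, of ?m, OF max.cobounded1] and b = n'[rule_format, of ?m, OF max.cobounded2]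
  let ?r = "(truncation M ?m, {\<zero>\<^bsub>N\<^esub>}, \<lambda>x. {extend_germ M N \<phi> x})" and ?s = "(truncation M ?m, {\<zero>\<^bsub>N\<^esub>}, \<lambda>x. {extend_germ M N \<psi> x})"
  have eq: "rep_add N ?r ?s = (truncation M ?m, {\<zero>\<^bsub>N\<^esub>}, \<lambda>x. {extend_germ M N \<phi> x \<oplus>\<^bsub>N\<^esub> extend_germ M N \<psi> x})"
    by (simp add: rep_add_def set_add_def')
  have "rep_add N ?r ?s \<in> ?R"
    unfolding eq
    using a b by (intro germ_class_memberI[OF graded_hom_add[of "extend_germ M N \<phi>" _ "extend_germ M N \<psi>"]]) auto
  then have "qrel M N `` {rep_add N ?r ?s} = ?R"
    using qrel_image_eq unfolding germ_class_def by blast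
  then show "?R \<subseteq> qadd M N (germ_class M N \<phi>) (germ_class M N \<psi>)"
    unfolding qadd_def using a b by blast
qed

lemma qzero_germ_class:
  "qzero M N = germ_class M N (\<lambda>d x. \<zero>\<^bsub>N\<^esub>)"
proof -
  have t0: "truncation M 0 = carrier M" by (auto simp: truncation_def far_def)
  have "(\<lambda>x. \<zero>\<^bsub>N\<^esub>) \<in> graded_hom (restrict_module M (truncation M 0)) N"
    unfolding graded_hom_iff by simp
  from germ_class_memberI[OF this, of "\<lambda>x. {\<zero>\<^bsub>N\<^esub>}" "\<lambda>d x. \<zero>\<^bsub>N\<^esub>"]
  have "(carrier M, {\<zero>\<^bsub>N\<^esub>}, \<lambda>x. {\<zero>\<^bsub>N\<^esub>}) \<in> germ_class M N (\<lambda>d x. \<zero>\<^bsub>N\<^esub>)"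
    unfolding t0 by simp
  then show ?thesis
    unfolding qzero_def germ_class_def[of M N "\<lambda>d x. \<zero>\<^bsub>N\<^esub>", symmetric]
    using qrel_image_eq unfolding germ_class_def by blast
qed

lemma germ_zero_map: "germ M N (\<lambda>d x. \<zero>\<^bsub>N\<^esub>)"
  by (simp add: germ_def germ_at_def)

end

lemma (in fg_kst_module) qid_germ_class: "qid M = germ_class M M (\<lambda>d x. x)"
proof -
  interpret P: fg_pair M M by unfold_locales
  have t0: "truncation M 0 = carrier M" by (auto simp: truncation_def far_def)
  have "(\<lambda>x. x) \<in> graded_hom (restrict_module M (truncation M 0)) M"
    unfolding graded_hom_iff t0 by simp
  from P.germ_class_memberI[OF this, of "\<lambda>x. {\<zero>} +> x" "\<lambda>d x. x"]
  have "(carrier M, {\<zero>}, \<lambda>x. {\<zero>} +> x) \<in> germ_class M M (\<lambda>d x. x)"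
    unfolding t0 by (simp add: a_r_coset_def')
  then show ?thesis
    unfolding qid_def using P.qrel_image_eq unfolding germ_class_def by blast
qed

lemma germ_id: "germ M M (\<lambda>d x. x)"
  by (simp add: germ_def germ_at_def)

lemma germ_comp:
  assumes "germ M N \<phi>" "germ N L \<psi>"
  shows "germ M L (\<lambda>d x. \<psi> d (\<phi> d x))"
  using assms unfolding germ_def
proof eventually_elim
  case (elim d)
  then show ?case unfolding germ_at_def by auto
qed

locale fg_triple = MN: fg_pair M N + NL: fg_pair N L
  for M :: "('k::field kst, 'm) gmodule" and N :: "('k kst, 'n) gmodule" and L :: "('k kst, 'l) gmodule"

sublocale fg_triple \<subseteq> Comp: fg_pair M L
  by unfold_locales

context fg_triple
begin

lemma represents_comp:
  assumes "r \<in> germ_class M N \<phi>" "s \<in> germ_class N L \<psi>"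
  shows "represents M L (rep_comp s r) (\<lambda>d x. \<psi> d (\<phi> d x))"
proof -
  obtain U V f W X g where r: "r = (U, V, f)" "s = (W, X, g)" by (cases r; cases s)
  have "\<forall>\<^sub>F d in cofinite. \<forall>x\<in>piece M d. x \<in> U \<and> \<phi> d x \<in> f x \<inter> piece N d"
    "\<forall>\<^sub>F d in cofinite. \<forall>x\<in>piece N d. x \<in> W \<and> \<psi> d x \<in> g x \<inter> piece L d"
    using assms by (simp_all add: germ_class_def represents_def r)
  then show ?thesis
    unfolding represents_def rep_comp_def r case_prod_conv
  proof eventually_elim
    case (elim d)
    show ?case
    proof
      fix x assume "x \<in> piece M d"
      then have 1: "x \<in> U" "\<phi> d x \<in> f x" "\<phi> d x \<in> piece N d" using elim by blast+
      then have 2: "\<phi> d x \<in> W" "\<psi> d (\<phi> d x) \<in> g (\<phi> d x)" "\<psi> d (\<phi> d x) \<in> piece L d" using elim by blast+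
      show "x \<in> {x \<in> U. f x \<inter> W \<noteq> {}} \<and> \<psi> d (\<phi> d x) \<in> (\<Union>y\<in>f x \<inter> W. g y) \<inter> piece L d"
        using 1 2 by blast
    qed
  qed
qed

text \<open>
  As for the sum: linear extensions on a common truncation can be composed because a graded morphism
  maps a truncation into the truncation outside the same box.
\<close>

lemma qcomp_germ_class:
  assumes "germ M N \<phi>" "germ N L \<psi>"
  shows "qcomp M L (germ_class N L \<psi>) (germ_class M N \<phi>) = germ_class M L (\<lambda>d x. \<psi> d (\<phi> d x))"
    (is "_ = ?R")
proof
  have "qrel M L `` {rep_comp s r} \<subseteq> ?R" if "r \<in> germ_class M N \<phi>" "s \<in> germ_class N L \<psi>" for r s
  proof (cases "rep_comp s r \<in> qreps M L")
    case True
    then show ?thesis using Comp.qrel_image_eq[OF True represents_comp[OF that]] by simp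
  next
    case False
    then show ?thesis by (auto simp: qrel_def)
  qed
  then show "qcomp M L (germ_class N L \<psi>) (germ_class M N \<phi>) \<subseteq> ?R"
    unfolding qcomp_def by blast
  obtain n where n: "\<forall>m\<ge>n. (truncation M m, {\<zero>\<^bsub>N\<^esub>}, \<lambda>x. {extend_germ M N \<phi> x}) \<in> germ_class M N \<phi> \<and>
    extend_germ M N \<phi> \<in> graded_hom (restrict_module M (truncation M m)) N \<and>
    (\<forall>d. far m d \<longrightarrow> (\<forall>x\<in>piece M d. extend_germ M N \<phi> x = \<phi> d x))"
    using MN.germ_representative[OF assms(1)] by blast
  obtain n' where n': "\<forall>m\<ge>n'. (truncation N m, {\<zero>\<^bsub>L\<^esub>}, \<lambda>x. {extend_germ N L \<psi> x}) \<in> germ_class N L \<psi> \<and>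
    extend_germ N L \<psi> \<in> graded_hom (restrict_module N (truncation N m)) L \<and>
    (\<forall>d. far m d \<longrightarrow> (\<forall>x\<in>piece N d. extend_germ N L \<psi> x = \<psi> d x))"
    using NL.germ_representative[OF assms(2)] by blast
  let ?m = "max n n'"
  note a = n[rule_format, of ?m, OF max.cobounded1] and b = n'[rule_format, of ?m, OF max.cobounded2]
  let ?\<phi> = "extend_germ M N \<phi>" and ?\<psi> = "extend_germ N L \<psi>"
  let ?r = "(truncation M ?m, {\<zero>\<^bsub>N\<^esub>}, \<lambda>x. {?\<phi> x})" and ?s = "(truncation N ?m, {\<zero>\<^bsub>L\<^esub>}, \<lambda>x. {?\<psi> x})"
  have ha: "?\<phi> \<in> graded_hom (restrict_module M (truncation M ?m)) N"
    and hb: "?\<psi> \<in> graded_hom (restrict_module N (truncation N ?m)) L" using a b by blast+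
  note Ha = ha[unfolded graded_hom_iff restrict_module_simps]
    and Hb = hb[unfolded graded_hom_iff restrict_module_simps]
  have t: "?\<phi> x \<in> truncation N ?m" if "x \<in> truncation M ?m" for x by (rule MN.graded_hom_truncation[OF ha that])
  have h: "(\<lambda>x. ?\<psi> (?\<phi> x)) \<in> graded_hom (restrict_module M (truncation M ?m)) L"
    unfolding graded_hom_iff restrict_module_simps
  proof (intro conjI ballI allI)
    fix d x assume x: "x \<in> truncation M ?m \<inter> piece M d"
    then have "?\<phi> x \<in> truncation N ?m \<inter> piece N d" using t Ha by blast
    then show "?\<psi> (?\<phi> x) \<in> piece L d" using Hb by blast
  qed (use t Ha Hb in auto)
  have eq: "rep_comp ?s ?r = (truncation M ?m, {\<zero>\<^bsub>L\<^esub>}, \<lambda>x. \<Union>y\<in>{?\<phi> x} \<inter> truncation N ?m. {?\<psi> y})"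
    using t MN.N.truncation_zero[of ?m] by (auto simp: rep_comp_def NL.extend_germ_zero)
  have "rep_comp ?s ?r \<in> ?R"
    unfolding eq
  proof (rule Comp.germ_class_memberI[OF h]; intro ballI allI impI)
    show "(\<Union>y\<in>{?\<phi> x} \<inter> truncation N ?m. {?\<psi> y}) = {?\<psi> (?\<phi> x)}" if "x \<in> truncation M ?m" for x
      using t[OF that] by auto
    fix d x assume d: "far ?m d" "x \<in> piece M d"
    show "?\<psi> (?\<phi> x) = \<psi> d (\<phi> d x)"
    proof -
      have "?\<phi> x = \<phi> d x" using a d by blast
      moreover have "?\<phi> x \<in> piece N d" using Ha MN.M.truncation_piece[OF d] d(2) by blast
      ultimately show ?thesis using b d(1) by metis
    qed
  qed
  then have "qrel M L `` {rep_comp ?s ?r} = ?R"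
    using Comp.qrel_image_eq unfolding germ_class_def by blast
  then show "?R \<subseteq> qcomp M L (germ_class N L \<psi>) (germ_class M N \<phi>)"
    unfolding qcomp_def using a b by blast
qed

end

section \<open>Direct sums in the Serre quotient as frames\<close>

definition lin_comb :: "('k::field kst, 'm) gmodule \<Rightarrow> 'i set \<Rightarrow> ('i \<Rightarrow> 'k) \<Rightarrow> ('i \<Rightarrow> 'm) \<Rightarrow> 'm" where
  "lin_comb M J c w = (\<Oplus>\<^bsub>M\<^esub>i\<in>J. mact M 0 (c i) (w i))"

context graded_kst_module
begin

lemma lin_comb_closed: "(\<And>i. i \<in> J \<Longrightarrow> w i \<in> carrier M) \<Longrightarrow> lin_comb M J c w \<in> carrier M"
  unfolding lin_comb_def by (intro M.finsum_closed) auto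

lemma lin_comb_piece:
  assumes "finite J" "\<And>i. i \<in> J \<Longrightarrow> w i \<in> piece M d"
  shows "lin_comb M J c w \<in> piece M d"
  unfolding lin_comb_def
  by (rule finsum_in[OF M.abelian_monoid_axioms _ zero_piece add_piece assms(1)])
    (use assms(2) act0_piece in blast)+

lemma lin_comb_add:
  assumes "\<And>i. i \<in> J \<Longrightarrow> w i \<in> carrier M"
  shows "lin_comb M J (\<lambda>i. c i + c' i) w = lin_comb M J c w \<oplus> lin_comb M J c' w"
proof -
  have "lin_comb M J (\<lambda>i. c i + c' i) w = (\<Oplus>i\<in>J. mact M 0 (c i) (w i) \<oplus> mact M 0 (c' i) (w i))"
    unfolding lin_comb_def by (rule M.finsum_cong') (use assms act_add_left in auto)
  then show ?thesis
    unfolding lin_comb_def using assms by (subst (asm) M.finsum_addf) auto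
qed

lemma lin_comb_scale:
  assumes "finite J" "\<And>i. i \<in> J \<Longrightarrow> w i \<in> carrier M"
  shows "mact M 0 a (lin_comb M J c w) = lin_comb M J (\<lambda>i. a * c i) w"
proof -
  have "mact M 0 a (lin_comb M J c w) = (\<Oplus>i\<in>J. mact M 0 a (mact M 0 (c i) (w i)))"
    unfolding lin_comb_def using assms by (intro finsum_smult_ldistr) auto
  also have "\<dots> = lin_comb M J (\<lambda>i. a * c i) w"
    unfolding lin_comb_def by (rule M.finsum_cong') (use assms act_act in auto)
  finally show ?thesis .
qed

lemma lin_comb_cong:
  assumes "\<And>i. i \<in> J \<Longrightarrow> w i \<in> carrier M" "\<And>i. i \<in> J \<Longrightarrow> c i = c' i"
  shows "lin_comb M J c w = lin_comb M J c' w"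
  unfolding lin_comb_def by (rule M.finsum_cong') (use assms in auto)

lemma lin_comb_zero:
  assumes "\<And>i. i \<in> J \<Longrightarrow> w i \<in> carrier M" "\<And>i. i \<in> J \<Longrightarrow> c i = 0"
  shows "lin_comb M J c w = \<zero>"
  unfolding lin_comb_def by (rule M.add.finprod_one_eqI) (use assms in auto)

lemma lin_comb_mono_neutral:
  assumes "finite K" "J \<subseteq> K" "\<And>i. i \<in> J \<Longrightarrow> w i \<in> carrier M"
    and "\<And>i. i \<in> J \<Longrightarrow> f i = mact M 0 (c i) (w i)" "\<And>i. i \<in> K - J \<Longrightarrow> f i = \<zero>"
  shows "lin_comb M J c w = (\<Oplus>i\<in>K. f i)"
  unfolding lin_comb_def
proof (rule M.add.finprod_mono_neutral_cong_left[OF assms(1,2)])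
  show "f \<in> K \<rightarrow> carrier M"
  proof
    fix i assume "i \<in> K"
    then show "f i \<in> carrier M" using assms(3-5) by (cases "i \<in> J") auto
  qed
qed (use assms in auto)

lemma lin_comb_single:
  assumes "finite J" "j \<in> J" "\<And>i. i \<in> J \<Longrightarrow> w i \<in> carrier M"
  shows "mact M 0 a (w j) = lin_comb M J (\<lambda>i. if i = j then a else 0) w"
proof -
  have "mact M 0 a (w j) = lin_comb M {j} (\<lambda>_. a) w"
    using assms by (simp add: lin_comb_def)
  also have "\<dots> = (\<Oplus>i\<in>J. mact M 0 (if i = j then a else 0) (w i))"
    by (rule lin_comb_mono_neutral) (use assms in auto)
  finally show ?thesis by (simp only: lin_comb_def)
qed

lemma lin_comb_diff:
  assumes "finite J" "\<And>i. i \<in> J \<Longrightarrow> w i \<in> carrier M"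
  shows "lin_comb M J (\<lambda>i. c i - c' i) w = lin_comb M J c w \<ominus> lin_comb M J c' w"
proof -
  have "lin_comb M J (\<lambda>i. c i - c' i) w = lin_comb M J (\<lambda>i. c i + (- 1) * c' i) w" by simp
  also have "\<dots> = lin_comb M J c w \<oplus> mact M 0 (- 1) (lin_comb M J c' w)"
    by (simp only: lin_comb_add[OF assms(2)] lin_comb_scale[OF assms])
  finally show ?thesis
    using neg_eq[OF lin_comb_closed, of J w c'] assms(2) by (simp only: M.minus_eq)
qed

lemma lin_comb_unique:
  assumes "finite J" "\<And>i. i \<in> J \<Longrightarrow> w i \<in> carrier M"
    and indep: "\<forall>c. lin_comb M J c w = \<zero> \<longrightarrow> (\<forall>i\<in>J. c i = 0)"
    and "lin_comb M J c w = lin_comb M J c' w" "i \<in> J"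
  shows "c i = c' i"
proof -
  have "lin_comb M J (\<lambda>i. c i - c' i) w = \<zero>"
    using lin_comb_diff[OF assms(1,2)] lin_comb_closed[of J w] assms(2,4)
    by (simp add: M.minus_eq M.r_neg)
  then have "c i - c' i = 0" using indep assms(5) by blast
  then show ?thesis by simp
qed

end

text \<open>
  The vectors \<open>v\<^sub>i(d)\<close>, for the indices \<open>i\<close> with \<open>d \<in> D\<^sub>i\<close>, form a basis of \<open>M\<^sub>d\<close>, and a monomial sends
  \<open>v\<^sub>i(d)\<close> to \<open>v\<^sub>i(e + d)\<close>, or to zero when \<open>e + d\<close> is outside \<open>D\<^sub>i\<close>. Holding for almost all \<open>d\<close>,
  this is an isomorphism in the Serre quotient from a direct sum of modules with supports \<open>D\<^sub>i\<close> to \<open>M\<close>,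
  written in coordinates.
\<close>

definition frame_at :: "('k::field kst, 'm) gmodule \<Rightarrow> 'i set \<Rightarrow> ('i \<Rightarrow> (nat \<times> nat) set) \<Rightarrow>
    ('i \<Rightarrow> nat \<times> nat \<Rightarrow> 'm) \<Rightarrow> nat \<times> nat \<Rightarrow> bool" where
  "frame_at M I D v d \<longleftrightarrow>
     (\<forall>i\<in>I. d \<in> D i \<longrightarrow> v i d \<in> piece M d \<and>
        (\<forall>e c. mact M e c (v i d) = (if e + d \<in> D i then mact M 0 c (v i (e + d)) else \<zero>\<^bsub>M\<^esub>))) \<and>
     (\<forall>x\<in>piece M d. \<exists>c. x = lin_comb M {i \<in> I. d \<in> D i} c (\<lambda>i. v i d)) \<and>
     (\<forall>c. lin_comb M {i \<in> I. d \<in> D i} c (\<lambda>i. v i d) = \<zero>\<^bsub>M\<^esub> \<longrightarrow> (\<forall>i\<in>{i \<in> I. d \<in> D i}. c i = 0))"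

context graded_kst_module
begin

text \<open>
  A monomial acts on coordinates by deleting those whose support is left and filling those that are
  entered with zero.
\<close>

lemma frame_at_act:
  fixes v :: "'i \<Rightarrow> nat \<times> nat \<Rightarrow> 'm"
  assumes fin: "finite I" and d: "frame_at M I D v d" and ed: "frame_at M I D v (e + d)"
  shows "mact M e a (lin_comb M {i \<in> I. d \<in> D i} c (\<lambda>i. v i d)) =
    lin_comb M {i \<in> I. e + d \<in> D i} (\<lambda>i. if d \<in> D i then a * c i else 0) (\<lambda>i. v i (e + d))"
proof -
  let ?J = "\<lambda>d. {i \<in> I. d \<in> D i}"
  have wd: "v i d \<in> carrier M" if "i \<in> ?J d" for i
    using d that piece_closed unfolding frame_at_def by blast
  have wed: "v i (e + d) \<in> carrier M" if "i \<in> ?J (e + d)" for i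
    using ed that piece_closed unfolding frame_at_def by blast
  have act: "mact M e b (v i d) = (if e + d \<in> D i then mact M 0 b (v i (e + d)) else \<zero>)" if "i \<in> ?J d" for i b
    using d that unfolding frame_at_def by blast
  have "mact M e a (lin_comb M (?J d) c (\<lambda>i. v i d)) = (\<Oplus>i\<in>?J d. mact M e a (mact M 0 (c i) (v i d)))"
    unfolding lin_comb_def by (rule finsum_smult_ldistr) (use wd fin in auto)
  also have "\<dots> = (\<Oplus>i\<in>?J d. if e + d \<in> D i then mact M 0 (a * c i) (v i (e + d)) else \<zero>)"
  proof (rule M.finsum_cong')
    show "(\<lambda>i. if e + d \<in> D i then mact M 0 (a * c i) (v i (e + d)) else \<zero>) \<in> ?J d \<rightarrow> carrier M"
      using wed by auto
    show "mact M e a (mact M 0 (c i) (v i d)) = (if e + d \<in> D i then mact M 0 (a * c i) (v i (e + d)) else \<zero>)"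
      if "i \<in> ?J d" for i
      using act_act[OF wd[OF that], of e a 0 "c i"] act[OF that, of "a * c i"] by simp
  qed simp
  also have "\<dots> = (\<Oplus>i\<in>?J d \<union> ?J (e + d). if d \<in> D i \<and> e + d \<in> D i then mact M 0 (a * c i) (v i (e + d)) else \<zero>)"
    by (rule M.add.finprod_mono_neutral_cong_left) (use wed fin in auto)
  also have "\<dots> = lin_comb M (?J (e + d)) (\<lambda>i. if d \<in> D i then a * c i else 0) (\<lambda>i. v i (e + d))"
    by (rule lin_comb_mono_neutral[symmetric]) (use wed fin in auto)
  finally show ?thesis .
qed

end

definition frame where
  "frame M I D v \<longleftrightarrow> finite I \<and> (\<forall>\<^sub>F d in cofinite. frame_at M I D v d)"

text \<open>
  A module that is one-dimensional with basis vector \<open>e(d)\<close> for \<open>d \<in> D\<close> and zero elsewhere, and in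
  which monomials send these basis vectors to one another as long as they stay inside \<open>D\<close>.
\<close>

definition interval_module :: "('k::field kst, 'm) gmodule \<Rightarrow> (nat \<times> nat) set \<Rightarrow> (nat \<times> nat \<Rightarrow> 'm) \<Rightarrow> bool" where
  "interval_module S D e \<longleftrightarrow> fg_kst_module S \<and>
     (\<forall>d. d \<notin> D \<longrightarrow> piece S d = {\<zero>\<^bsub>S\<^esub>}) \<and>
     (\<forall>d\<in>D. e d \<in> piece S d \<and> (\<forall>y\<in>piece S d. \<exists>c. y = mact S 0 c (e d)) \<and>
        (\<forall>c. mact S 0 c (e d) = \<zero>\<^bsub>S\<^esub> \<longrightarrow> c = 0) \<and>
        (\<forall>b c. mact S b c (e d) = (if b + d \<in> D then mact S 0 c (e (b + d)) else \<zero>\<^bsub>S\<^esub>)))"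

lemma interval_moduleD:
  assumes "interval_module S D e"
  shows "fg_kst_module S" "d \<notin> D \<Longrightarrow> y \<in> piece S d \<Longrightarrow> y = \<zero>\<^bsub>S\<^esub>"
    "d \<in> D \<Longrightarrow> e d \<in> piece S d" "d \<in> D \<Longrightarrow> y \<in> piece S d \<Longrightarrow> \<exists>c. y = mact S 0 c (e d)"
    "d \<in> D \<Longrightarrow> mact S 0 c (e d) = \<zero>\<^bsub>S\<^esub> \<Longrightarrow> c = 0"
    "d \<in> D \<Longrightarrow> mact S b c (e d) = (if b + d \<in> D then mact S 0 c (e (b + d)) else \<zero>\<^bsub>S\<^esub>)"
  using assms unfolding interval_module_def by blast+

context fg_pair
begin

lemma qhom_group_comm_monoid: "comm_monoid (qhom_group M N)"
proof (rule comm_monoidI)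
  show "\<one>\<^bsub>qhom_group M N\<^esub> \<in> carrier (qhom_group M N)"
    using germ_class_in_qhom[OF germ_zero_map] by (simp add: qhom_group_def qzero_germ_class)
  fix F assume "F \<in> carrier (qhom_group M N)"
  then obtain \<phi> where f: "germ M N \<phi>" "F = germ_class M N \<phi>"
    using qhom_germ by (auto simp: qhom_group_def)
  have "\<forall>\<^sub>F d in cofinite. \<forall>x\<in>piece M d. \<zero>\<^bsub>N\<^esub> \<oplus>\<^bsub>N\<^esub> \<phi> d x = \<phi> d x"
    using f(1) unfolding germ_def germ_at_def
    by (rule eventually_mono) (use N.piece_closed N.M.l_zero in blast)
  then show "\<one>\<^bsub>qhom_group M N\<^esub> \<otimes>\<^bsub>qhom_group M N\<^esub> F = F"
    using germ_class_eq_iff[OF germ_add[OF germ_zero_map f(1)], of \<phi>] f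
    by (simp add: qhom_group_def qzero_germ_class qadd_germ_class germ_zero_map)
  fix G assume "G \<in> carrier (qhom_group M N)"
  then obtain \<psi> where g: "germ M N \<psi>" "G = germ_class M N \<psi>"
    using qhom_germ by (auto simp: qhom_group_def)
  show "F \<otimes>\<^bsub>qhom_group M N\<^esub> G \<in> carrier (qhom_group M N)"
    using germ_class_in_qhom[OF germ_add[OF f(1) g(1)]] f g by (simp add: qhom_group_def qadd_germ_class)
  have "\<forall>\<^sub>F d in cofinite. \<forall>x\<in>piece M d. \<phi> d x \<oplus>\<^bsub>N\<^esub> \<psi> d x = \<psi> d x \<oplus>\<^bsub>N\<^esub> \<phi> d x"
    using f(1) g(1) unfolding germ_def germ_at_def
    by eventually_elim (use N.piece_closed N.M.add.m_comm in blast)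
  then show "F \<otimes>\<^bsub>qhom_group M N\<^esub> G = G \<otimes>\<^bsub>qhom_group M N\<^esub> F"
    using germ_class_eq_iff[OF germ_add[OF f(1) g(1)]] f g
    by (simp add: qhom_group_def qadd_germ_class)
  fix H assume "H \<in> carrier (qhom_group M N)"
  then obtain \<theta> where h: "germ M N \<theta>" "H = germ_class M N \<theta>"
    using qhom_germ by (auto simp: qhom_group_def)
  have "\<forall>\<^sub>F d in cofinite. \<forall>x\<in>piece M d.
      \<phi> d x \<oplus>\<^bsub>N\<^esub> \<psi> d x \<oplus>\<^bsub>N\<^esub> \<theta> d x = \<phi> d x \<oplus>\<^bsub>N\<^esub> (\<psi> d x \<oplus>\<^bsub>N\<^esub> \<theta> d x)"
    using f(1) g(1) h(1) unfolding germ_def germ_at_def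
  proof eventually_elim
    case (elim d)
    then have "\<phi> d x \<in> carrier N" "\<psi> d x \<in> carrier N" "\<theta> d x \<in> carrier N" if "x \<in> piece M d" for x
      using that N.piece_closed by blast+
    then show ?case using N.M.add.m_assoc by blast
  qed
  then show "F \<otimes>\<^bsub>qhom_group M N\<^esub> G \<otimes>\<^bsub>qhom_group M N\<^esub> H = F \<otimes>\<^bsub>qhom_group M N\<^esub> (G \<otimes>\<^bsub>qhom_group M N\<^esub> H)"
    using germ_class_eq_iff[OF germ_add[OF germ_add[OF f(1) g(1)] h(1)]] f g h
    by (simp add: qhom_group_def qadd_germ_class germ_add)
qed

lemma finprod_germ_class:
  assumes "finite A" "\<forall>j\<in>A. germ M N (\<phi> j)"
  shows "germ M N (\<lambda>d x. \<Oplus>\<^bsub>N\<^esub>j\<in>A. \<phi> j d x) \<and>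
    finprod (qhom_group M N) (\<lambda>j. germ_class M N (\<phi> j)) A = germ_class M N (\<lambda>d x. \<Oplus>\<^bsub>N\<^esub>j\<in>A. \<phi> j d x)"
  using assms
proof (induction A)
  case empty
  then show ?case
    using comm_monoid.finprod_empty[OF qhom_group_comm_monoid, of "\<lambda>j. germ_class M N (\<phi> j)"] germ_zero_map
    by (simp add: qhom_group_def qzero_germ_class)
next
  case (insert a A)
  let ?\<sigma> = "\<lambda>d x. \<Oplus>\<^bsub>N\<^esub>j\<in>A. \<phi> j d x"
  have g: "germ M N ?\<sigma>" "germ M N (\<phi> a)" "\<forall>j\<in>A. germ M N (\<phi> j)" using insert by blast+
  have "\<forall>\<^sub>F d in cofinite. \<forall>j\<in>insert a A. germ_at M N d (\<phi> j)"
    using insert by (intro eventually_ball_finite) (auto simp: germ_def)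
  then have ev: "\<forall>\<^sub>F d in cofinite. \<forall>x\<in>piece M d. \<phi> a d x \<oplus>\<^bsub>N\<^esub> ?\<sigma> d x = (\<Oplus>\<^bsub>N\<^esub>j\<in>insert a A. \<phi> j d x)"
  proof eventually_elim
    case (elim d)
    show ?case
    proof
      fix x assume "x \<in> piece M d"
      then have "\<phi> j d x \<in> carrier N" if "j \<in> insert a A" for j
        using elim that N.piece_closed unfolding germ_at_def by blast
      then show "\<phi> a d x \<oplus>\<^bsub>N\<^esub> ?\<sigma> d x = (\<Oplus>\<^bsub>N\<^esub>j\<in>insert a A. \<phi> j d x)"
        using insert(1,2) by (intro N.M.finsum_insert[symmetric]) blast+
    qed
  qed
  have eq: "germ_class M N (\<lambda>d x. \<phi> a d x \<oplus>\<^bsub>N\<^esub> ?\<sigma> d x) = germ_class M N (\<lambda>d x. \<Oplus>\<^bsub>N\<^esub>j\<in>insert a A. \<phi> j d x)"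
    using germ_class_eq_iff[OF germ_add[OF g(2,1)]] ev by blast
  obtain r where "r \<in> germ_class M N (\<lambda>d x. \<phi> a d x \<oplus>\<^bsub>N\<^esub> ?\<sigma> d x)"
    using germ_class_nonempty[OF germ_add[OF g(2,1)]] by blast
  then have germ: "germ M N (\<lambda>d x. \<Oplus>\<^bsub>N\<^esub>j\<in>insert a A. \<phi> j d x)"
    unfolding eq using represents_germ[of r] unfolding germ_class_def by blast
  have "finprod (qhom_group M N) (\<lambda>j. germ_class M N (\<phi> j)) (insert a A) =
    germ_class M N (\<phi> a) \<otimes>\<^bsub>qhom_group M N\<^esub> finprod (qhom_group M N) (\<lambda>j. germ_class M N (\<phi> j)) A"
    using insert(1,2) germ_class_in_qhom g
    by (intro comm_monoid.finprod_insert[OF qhom_group_comm_monoid]) (auto simp: qhom_group_def)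
  also have "\<dots> = germ_class M N (\<lambda>d x. \<phi> a d x \<oplus>\<^bsub>N\<^esub> ?\<sigma> d x)"
    using insert g by (simp add: qhom_group_def qadd_germ_class)
  finally show ?case using germ eq by simp
qed

end

locale interval_family = fg_kst_module M for M :: "('k::field kst, 'm) gmodule" (structure) +
  fixes Ss :: "('k kst, 's) gmodule list" and D e
  assumes intervals: "\<forall>j<length Ss. interval_module (Ss ! j) (D j) (e j)"
begin

abbreviation "I \<equiv> {..<length Ss}"

lemma S: "j \<in> I \<Longrightarrow> interval_module (Ss ! j) (D j) (e j)"
  using intervals by simp

lemma pair_in: "j \<in> I \<Longrightarrow> fg_pair (Ss ! j) M"
  using interval_moduleD(1)[OF S] fg_kst_module_axioms by (intro fg_pair.intro)

lemma pair_out: "j \<in> I \<Longrightarrow> fg_pair M (Ss ! j)"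
  using interval_moduleD(1)[OF S] fg_kst_module_axioms by (intro fg_pair.intro)

lemma S_graded: "j \<in> I \<Longrightarrow> graded_kst_module (Ss ! j)"
  using interval_moduleD(1)[OF S] by (simp add: fg_kst_module_def)

lemma triple: "j \<in> I \<Longrightarrow> l \<in> I \<Longrightarrow> fg_triple (Ss ! l) M (Ss ! j)"
  using pair_in pair_out by (intro fg_triple.intro)

lemma triple': "j \<in> I \<Longrightarrow> fg_triple M (Ss ! j) M"
  using pair_in pair_out by (intro fg_triple.intro)

lemma frame_atD:
  assumes "frame_at M I D v d"
  shows "\<And>i. i \<in> I \<Longrightarrow> d \<in> D i \<Longrightarrow> v i d \<in> piece M d"
    "\<And>i e c. i \<in> I \<Longrightarrow> d \<in> D i \<Longrightarrow>
       mact M e c (v i d) = (if e + d \<in> D i then mact M 0 c (v i (e + d)) else \<zero>)"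
    "\<And>x. x \<in> piece M d \<Longrightarrow> \<exists>c. x = lin_comb M {i \<in> I. d \<in> D i} c (\<lambda>i. v i d)"
    "\<forall>c. lin_comb M {i \<in> I. d \<in> D i} c (\<lambda>i. v i d) = \<zero> \<longrightarrow> (\<forall>i\<in>{i \<in> I. d \<in> D i}. c i = 0)"
  using assms unfolding frame_at_def by blast+

definition coef :: "nat \<Rightarrow> nat \<times> nat \<Rightarrow> 's \<Rightarrow> 'k" where
  "coef j d y = (THE c. y = mact (Ss ! j) 0 c (e j d))"

lemma coef_eq:
  assumes "j \<in> I" "d \<in> D j"
  shows "coef j d (mact (Ss ! j) 0 c (e j d)) = c"
  unfolding coef_def
proof (rule the_equality)
  interpret S: graded_kst_module "Ss ! j" by (rule S_graded[OF assms(1)])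
  note iv = interval_moduleD[OF S[OF assms(1)]]
  have ec: "e j d \<in> carrier (Ss ! j)" using iv(3)[OF assms(2)] by blast
  fix c' assume eq: "mact (Ss ! j) 0 c (e j d) = mact (Ss ! j) 0 c' (e j d)"
  have "mact (Ss ! j) 0 (c' - c) (e j d) \<oplus>\<^bsub>Ss ! j\<^esub> mact (Ss ! j) 0 c (e j d) =
      mact (Ss ! j) 0 c (e j d)"
    using S.act_add_left[OF ec, of 0 "c' - c" c] eq by simp
  then have "mact (Ss ! j) 0 (c' - c) (e j d) = \<zero>\<^bsub>Ss ! j\<^esub>"
    using ec by (simp only: S.M.add.r_cancel_one S.act_closed)
  from iv(5)[OF assms(2) this] show "c' = c" by simp
qed simp

lemma coef:
  assumes "j \<in> I" "d \<in> D j" "y \<in> piece (Ss ! j) d"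
  shows "y = mact (Ss ! j) 0 (coef j d y) (e j d)"
proof -
  obtain c where c: "y = mact (Ss ! j) 0 c (e j d)"
    using interval_moduleD(4)[OF S[OF assms(1)] assms(2,3)] by blast
  show ?thesis unfolding c coef_eq[OF assms(1,2)] ..
qed

text \<open>
  The \<open>j\<close>-th inclusion sends \<open>e\<^sub>j(d)\<close> to \<open>v\<^sub>j(d)\<close>, and the \<open>j\<close>-th projection sends a vector to its
  \<open>j\<close>-th coordinate times \<open>e\<^sub>j(d)\<close>. Both are germs by the compatibility of the frame with monomials.
\<close>

lemma frame_imp_qdirect_sum:
  assumes frame: "frame M I D v"
  shows "is_qdirect_sum M Ss"
proof -
  let ?J = "\<lambda>d. {i \<in> I. d \<in> D i}" and ?w = "\<lambda>d i. v i d"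
  define crd where "crd d x = (SOME c. x = lin_comb M (?J d) c (?w d))" for d x
  define \<iota> where "\<iota> j d y = (if d \<in> D j then mact M 0 (coef j d y) (v j d) else \<zero>)" for j d y
  define \<pi> where "\<pi> j d x = (if d \<in> D j then mact (Ss ! j) 0 (crd d x j) (e j d) else \<zero>\<^bsub>Ss ! j\<^esub>)" for j d x
  have ev: "\<forall>\<^sub>F d in cofinite. \<forall>e. frame_at M I D v (e + d)"
    using frame unfolding frame_def eventually_far by (blast intro: far_add)
  have fin: "finite (?J d)" for d by simp
  have wc: "v i d \<in> carrier M" if "frame_at M I D v d" "i \<in> ?J d" for i d
    using frame_atD(1)[OF that(1)] that(2) by blast
  have crd: "x = lin_comb M (?J d) (crd d x) (?w d)" if "frame_at M I D v d" "x \<in> piece M d" for d x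
    unfolding crd_def using frame_atD(3)[OF that] by (rule someI_ex)
  have crd_eq: "crd d x i = c i"
    if f: "frame_at M I D v d" and x: "x = lin_comb M (?J d) c (?w d)" and i: "i \<in> ?J d" for d x c i
  proof -
    have "x \<in> piece M d"
      unfolding x by (rule lin_comb_piece[OF fin]) (use frame_atD(1)[OF f] in blast)
    then have eq: "lin_comb M (?J d) (crd d x) (?w d) = lin_comb M (?J d) c (?w d)"
      using crd[OF f] x by simp
    show ?thesis
      by (rule lin_comb_unique[OF fin wc[OF f] frame_atD(4)[OF f] eq i])
  qed
  have gi: "germ (Ss ! j) M (\<iota> j)" if j: "j \<in> I" for j
  proof -
    interpret S: graded_kst_module "Ss ! j" by (rule S_graded[OF j])
    note iv = interval_moduleD[OF S[OF j]]
    have coef0: "coef j d \<zero>\<^bsub>Ss ! j\<^esub> = 0" if "d \<in> D j" for d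
      using coef_eq[OF j that, of 0] iv(3)[OF that] S.piece_closed by fastforce
    show ?thesis
      unfolding germ_def using ev
    proof eventually_elim
      case (elim d)
      then have f: "frame_at M I D v (b + d)" for b by blast
      have f0: "frame_at M I D v d" using f[of 0] by simp
      show ?case
      proof (cases "d \<in> D j")
        case True
        have v: "v j d \<in> piece M d" "v j d \<in> carrier M" using frame_atD(1)[OF f0 j True] by blast+
        have ec: "e j d \<in> carrier (Ss ! j)" using iv(3)[OF True] by blast
        show ?thesis
          unfolding germ_at_def
        proof (intro conjI ballI allI)
          fix y assume y: "y \<in> piece (Ss ! j) d"
          obtain c where c: "y = mact (Ss ! j) 0 c (e j d)" using iv(4)[OF True y] by blast
          have iy: "\<iota> j d y = mact M 0 c (v j d)" using True by (simp add: \<iota>_def c coef_eq[OF j True])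
          show "\<iota> j d y \<in> piece M d" unfolding iy by (rule act0_piece[OF v(1)])
          {
            fix z assume z: "z \<in> piece (Ss ! j) d"
            obtain c' where c': "z = mact (Ss ! j) 0 c' (e j d)" using iv(4)[OF True z] by blast
            have iz: "\<iota> j d z = mact M 0 c' (v j d)" using True by (simp add: \<iota>_def c' coef_eq[OF j True])
            have "y \<oplus>\<^bsub>Ss ! j\<^esub> z = mact (Ss ! j) 0 (c + c') (e j d)"
              unfolding c c' by (rule S.act_add_left[OF ec, symmetric])
            then have "\<iota> j d (y \<oplus>\<^bsub>Ss ! j\<^esub> z) = mact M 0 (c + c') (v j d)"
              using True by (simp add: \<iota>_def coef_eq[OF j True])
            then show "\<iota> j d (y \<oplus>\<^bsub>Ss ! j\<^esub> z) = \<iota> j d y \<oplus> \<iota> j d z"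
              unfolding iy iz using act_add_left[OF v(2)] by simp
          }
          fix b a
          have "mact (Ss ! j) b a y = mact (Ss ! j) b (a * c) (e j d)"
            unfolding c using S.act_act[OF ec, of b a 0 c] by simp
          also have "\<dots> = (if b + d \<in> D j then mact (Ss ! j) 0 (a * c) (e j (b + d)) else \<zero>\<^bsub>Ss ! j\<^esub>)"
            by (rule iv(6)[OF True])
          finally have 1: "\<iota> j (b + d) (mact (Ss ! j) b a y) = (if b + d \<in> D j then mact M 0 (a * c) (v j (b + d)) else \<zero>)"
            by (simp add: \<iota>_def coef_eq[OF j])
          have "mact M b a (\<iota> j d y) = mact M b (a * c) (v j d)"
            unfolding iy using act_act[OF v(2), of b a 0 c] by simp
          also have "\<dots> = (if b + d \<in> D j then mact M 0 (a * c) (v j (b + d)) else \<zero>)"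
            by (rule frame_atD(2)[OF f0 j True])
          finally show "\<iota> j (b + d) (mact (Ss ! j) b a y) = mact M b a (\<iota> j d y)" using 1 by simp
        qed
      next
        case False
        have act0: "\<iota> j (b + d) (mact (Ss ! j) b a \<zero>\<^bsub>Ss ! j\<^esub>) = \<zero>" for a b
          using piece_closed[OF frame_atD(1)[OF f j, of b]] by (auto simp: \<iota>_def coef0)
        have \<iota>0: "\<iota> j d y = \<zero>" for y using False by (simp add: \<iota>_def)
        show ?thesis
          unfolding germ_at_def
        proof (intro conjI ballI allI)
          fix y b a assume "y \<in> piece (Ss ! j) d"
          then have y: "y = \<zero>\<^bsub>Ss ! j\<^esub>" by (rule iv(2)[OF False])
          show "\<iota> j (b + d) (mact (Ss ! j) b a y) = mact M b a (\<iota> j d y)"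
            unfolding y \<iota>0 act0 by simp
        qed (simp_all add: \<iota>0)
      qed
    qed
  qed
  have gp: "germ M (Ss ! j) (\<pi> j)" if j: "j \<in> I" for j
  proof -
    interpret S: graded_kst_module "Ss ! j" by (rule S_graded[OF j])
    note iv = interval_moduleD[OF S[OF j]]
    show ?thesis
      unfolding germ_def using ev
    proof eventually_elim
      case (elim d)
      then have f: "frame_at M I D v (b + d)" for b by blast
      have f0: "frame_at M I D v d" using f[of 0] by simp
      have crd_act: "crd (b + d) (mact M b a x) j = (if d \<in> D j then a * crd d x j else 0)"
        if x: "x \<in> piece M d" and j': "b + d \<in> D j" for x b a
      proof (rule crd_eq[OF f, where c = "\<lambda>i. if d \<in> D i then a * crd d x i else 0"])
        show "mact M b a x = lin_comb M (?J (b + d)) (\<lambda>i. if d \<in> D i then a * crd d x i else 0) (?w (b + d))"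
          using frame_at_act[OF _ f0 f, where a = a and c = "crd d x"] by (simp only: crd[OF f0 x, symmetric] finite_lessThan)
      qed (use j j' in simp)
      have crd_add: "crd d (x \<oplus> y) j = crd d x j + crd d y j"
        if x: "x \<in> piece M d" and y: "y \<in> piece M d" and d: "d \<in> D j" for x y
      proof (rule crd_eq[OF f0, where c = "\<lambda>i. crd d x i + crd d y i"])
        show "x \<oplus> y = lin_comb M (?J d) (\<lambda>i. crd d x i + crd d y i) (?w d)"
        proof -
          have "lin_comb M (?J d) (\<lambda>i. crd d x i + crd d y i) (?w d) =
              lin_comb M (?J d) (crd d x) (?w d) \<oplus> lin_comb M (?J d) (crd d y) (?w d)"
            by (rule lin_comb_add) (rule wc[OF f0])
          then show ?thesis
            by (simp only: crd[OF f0 x, symmetric] crd[OF f0 y, symmetric])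
        qed
      qed (use j d in simp)
      show ?case
        unfolding germ_at_def
      proof (intro conjI ballI allI)
        fix x assume x: "x \<in> piece M d"
        show "\<pi> j d x \<in> piece (Ss ! j) d"
          using S.act0_piece[OF iv(3)] by (auto simp: \<pi>_def)
        show "\<pi> j d (x \<oplus> y) = \<pi> j d x \<oplus>\<^bsub>Ss ! j\<^esub> \<pi> j d y" if y: "y \<in> piece M d" for y
          using S.act_add_left[OF S.piece_closed[OF iv(3)], of d 0 "crd d x j" "crd d y j"] crd_add[OF x y]
          by (simp add: \<pi>_def)
        fix b a
        show "\<pi> j (b + d) (mact M b a x) = mact (Ss ! j) b a (\<pi> j d x)"
        proof (cases "d \<in> D j")
          case True
          have ec: "e j d \<in> carrier (Ss ! j)" using iv(3)[OF True] by blast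
          have "mact (Ss ! j) b a (\<pi> j d x) = mact (Ss ! j) b (a * crd d x j) (e j d)"
            using S.act_act[OF ec, of b a 0 "crd d x j"] True by (simp add: \<pi>_def)
          also have "\<dots> = (if b + d \<in> D j then mact (Ss ! j) 0 (a * crd d x j) (e j (b + d)) else \<zero>\<^bsub>Ss ! j\<^esub>)"
            by (rule iv(6)[OF True])
          finally show ?thesis using crd_act[OF x, of b a] True by (simp add: \<pi>_def)
        next
          case False
          then show ?thesis
            using crd_act[OF x, of b a] S.piece_closed[OF iv(3), of "b + d"] by (simp add: \<pi>_def)
        qed
      qed
    qed
  qed
  have ortho: "qcomp (Ss ! l) (Ss ! j) (germ_class M (Ss ! j) (\<pi> j)) (germ_class (Ss ! l) M (\<iota> l)) =
      (if l = j then qid (Ss ! j) else qzero (Ss ! l) (Ss ! j))" if j: "j \<in> I" and l: "l \<in> I" for j l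
  proof -
    interpret T: fg_triple "Ss ! l" M "Ss ! j" by (rule triple[OF j l])
    note ivj = interval_moduleD[OF S[OF j]] and ivl = interval_moduleD[OF S[OF l]]
    have "\<forall>\<^sub>F d in cofinite. \<forall>y\<in>piece (Ss ! l) d. \<pi> j d (\<iota> l d y) = (if l = j then y else \<zero>\<^bsub>Ss ! j\<^esub>)"
      using ev
    proof eventually_elim
      case (elim d)
      then have f0: "frame_at M I D v d" using elim[rule_format, of 0] by simp
      show ?case
      proof
        fix y assume y: "y \<in> piece (Ss ! l) d"
        have zero: "mact (Ss ! j) 0 0 (e j d) = \<zero>\<^bsub>Ss ! j\<^esub>" if "d \<in> D j"
          using ivj(3)[OF that] T.NL.N.piece_closed by auto
        show "\<pi> j d (\<iota> l d y) = (if l = j then y else \<zero>\<^bsub>Ss ! j\<^esub>)"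
        proof (cases "d \<in> D l")
          case True
          have lJ: "l \<in> ?J d" using l True by simp
          have "\<iota> l d y = mact M 0 (coef l d y) (?w d l)" using True by (simp add: \<iota>_def)
          also have "\<dots> = lin_comb M (?J d) (\<lambda>i. if i = l then coef l d y else 0) (?w d)"
            by (rule lin_comb_single[OF fin lJ wc[OF f0]])
          finally have "crd d (\<iota> l d y) j = (if j = l then coef l d y else 0)" if "d \<in> D j"
            by (rule crd_eq[OF f0]) (use j that in simp)
          then show ?thesis
            using coef[OF l True y] zero True by (auto simp: \<pi>_def)
        next
          case False
          then have y0: "y = \<zero>\<^bsub>Ss ! l\<^esub>" using ivl(2) y by blast
          have "lin_comb M (?J d) (\<lambda>_. 0) (?w d) = \<zero>"
            by (rule lin_comb_zero) (use wc[OF f0] in auto)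
          then have "\<iota> l d y = lin_comb M (?J d) (\<lambda>_. 0) (?w d)"
            using False by (simp only: \<iota>_def if_False)
          then have "crd d (\<iota> l d y) j = 0" if "d \<in> D j"
            by (rule crd_eq[OF f0]) (use j that in simp)
          then show ?thesis using zero y0 by (auto simp: \<pi>_def)
        qed
      qed
    qed
    then have "germ_class (Ss ! l) (Ss ! j) (\<lambda>d y. \<pi> j d (\<iota> l d y)) = germ_class (Ss ! l) (Ss ! j) (\<lambda>d y. if l = j then y else \<zero>\<^bsub>Ss ! j\<^esub>)"
      using T.Comp.germ_class_eq_iff[OF germ_comp[OF gi[OF l] gp[OF j]]] by blast
    then show ?thesis
      unfolding T.qcomp_germ_class[OF gi[OF l] gp[OF j]]
      by (simp add: fg_kst_module.qid_germ_class[OF ivj(1)] T.Comp.qzero_germ_class)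
  qed
  have comp: "qcomp M M (germ_class (Ss ! j) M (\<iota> j)) (germ_class M (Ss ! j) (\<pi> j)) = germ_class M M (\<lambda>d x. \<iota> j d (\<pi> j d x))"
    "germ M M (\<lambda>d x. \<iota> j d (\<pi> j d x))" if j: "j \<in> I" for j
    using fg_triple.qcomp_germ_class[OF triple'[OF j] gp[OF j] gi[OF j]] germ_comp[OF gp[OF j] gi[OF j]] by blast+
  interpret MM: fg_pair M M by unfold_locales
  have "finprod (qhom_group M M) (\<lambda>j. qcomp M M (germ_class (Ss ! j) M (\<iota> j)) (germ_class M (Ss ! j) (\<pi> j))) I =
      finprod (qhom_group M M) (\<lambda>j. germ_class M M (\<lambda>d x. \<iota> j d (\<pi> j d x))) I"
    by (rule comm_monoid.finprod_cong'[OF MM.qhom_group_comm_monoid])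
      (use comp MM.germ_class_in_qhom in \<open>auto simp: qhom_group_def\<close>)
  also have "\<dots> = germ_class M M (\<lambda>d x. \<Oplus>j\<in>I. \<iota> j d (\<pi> j d x))"
    using MM.finprod_germ_class[of I "\<lambda>j d x. \<iota> j d (\<pi> j d x)"] comp(2) by blast
  also have "\<dots> = germ_class M M (\<lambda>d x. x)"
  proof -
    have "\<forall>\<^sub>F d in cofinite. \<forall>x\<in>piece M d. x = (\<Oplus>j\<in>I. \<iota> j d (\<pi> j d x))"
      using ev
    proof eventually_elim
      case (elim d)
      then have f0: "frame_at M I D v d" using elim[rule_format, of 0] by simp
      show ?case
      proof
        fix x assume x: "x \<in> piece M d"
        have "lin_comb M (?J d) (crd d x) (?w d) = (\<Oplus>j\<in>I. \<iota> j d (\<pi> j d x))"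
        proof (rule lin_comb_mono_neutral)
          show "\<iota> i d (\<pi> i d x) = mact M 0 (crd d x i) (v i d)" if "i \<in> ?J d" for i
            using that coef_eq[of i d] by (simp add: \<iota>_def \<pi>_def)
        qed (use wc[OF f0] in \<open>auto simp: \<iota>_def\<close>)
        then show "x = (\<Oplus>j\<in>I. \<iota> j d (\<pi> j d x))" using crd[OF f0 x] by simp
      qed
    qed
    then show ?thesis using MM.germ_class_eq_iff[OF germ_id, of "\<lambda>d x. \<Oplus>j\<in>I. \<iota> j d (\<pi> j d x)"] by simp
  qed
  finally have sum: "finprod (qhom_group M M) (\<lambda>j. qcomp M M (germ_class (Ss ! j) M (\<iota> j)) (germ_class M (Ss ! j) (\<pi> j))) I = qid M"
    by (simp only: qid_germ_class)
  show ?thesis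
    unfolding is_qdirect_sum_def
    using sum ortho fg_pair.germ_class_in_qhom[OF pair_in gi] fg_pair.germ_class_in_qhom[OF pair_out gp]
    by (intro exI[of _ "\<lambda>j. germ_class (Ss ! j) M (\<iota> j)"] exI[of _ "\<lambda>j. germ_class M (Ss ! j) (\<pi> j)"]) simp
qed

text \<open>
  The frame consists of the images of the vectors \<open>e\<^sub>j(d)\<close> under the inclusions. The projections show
  that they are independent, and the equation \<open>\<Sum>\<^sub>j \<iota>\<^sub>j \<circ> \<pi>\<^sub>j = id\<close> shows that they span.
\<close>

lemma qdirect_sum_imp_frame:
  assumes "is_qdirect_sum M Ss"
  shows "\<exists>v. frame M I D v"
proof -
  obtain F G where FG: "\<forall>j<length Ss. F j \<in> qhom (Ss ! j) M \<and> G j \<in> qhom M (Ss ! j)"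
    and orth: "\<forall>j<length Ss. \<forall>l<length Ss. qcomp (Ss ! l) (Ss ! j) (G j) (F l) =
             (if l = j then qid (Ss ! j) else qzero (Ss ! l) (Ss ! j))"
    and sum: "finprod (qhom_group M M) (\<lambda>j. qcomp M M (F j) (G j)) I = qid M"
    using assms unfolding is_qdirect_sum_def by blast
  have "\<forall>j\<in>I. \<exists>\<phi>. germ (Ss ! j) M \<phi> \<and> F j = germ_class (Ss ! j) M \<phi>"
    using FG fg_pair.qhom_germ[OF pair_in] by (metis lessThan_iff)
  then obtain \<iota> where \<iota>: "\<forall>j\<in>I. germ (Ss ! j) M (\<iota> j) \<and> F j = germ_class (Ss ! j) M (\<iota> j)" by metis
  have "\<forall>j\<in>I. \<exists>\<phi>. germ M (Ss ! j) \<phi> \<and> G j = germ_class M (Ss ! j) \<phi>"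
    using FG fg_pair.qhom_germ[OF pair_out] by (metis lessThan_iff)
  then obtain \<pi> where \<pi>: "\<forall>j\<in>I. germ M (Ss ! j) (\<pi> j) \<and> G j = germ_class M (Ss ! j) (\<pi> j)" by metis
  define v where "v j d = \<iota> j d (e j d)" for j d
  interpret MM: fg_pair M M by unfold_locales
  have ev1: "\<forall>\<^sub>F d in cofinite. \<forall>j\<in>I. \<forall>l\<in>I. \<forall>y\<in>piece (Ss ! l) d. \<pi> j d (\<iota> l d y) = (if l = j then y else \<zero>\<^bsub>Ss ! j\<^esub>)"
  proof (intro eventually_ball_finite ballI finite_lessThan)
    fix j l assume j: "j \<in> I" and l: "l \<in> I"
    interpret T: fg_triple "Ss ! l" M "Ss ! j" by (rule triple[OF j l])
    have g: "germ (Ss ! l) M (\<iota> l)" "germ M (Ss ! j) (\<pi> j)" using \<iota> \<pi> j l by blast+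
    have eq: "germ_class (Ss ! l) (Ss ! j) (\<lambda>d y. \<pi> j d (\<iota> l d y)) = germ_class (Ss ! l) (Ss ! j) (\<lambda>d y. if l = j then y else \<zero>\<^bsub>Ss ! j\<^esub>)"
      unfolding T.qcomp_germ_class[OF g, symmetric]
      using orth \<iota> \<pi> j l
      by (simp add: fg_kst_module.qid_germ_class[OF interval_moduleD(1)[OF S[OF j]]] T.Comp.qzero_germ_class)
    show "\<forall>\<^sub>F d in cofinite. \<forall>y\<in>piece (Ss ! l) d. \<pi> j d (\<iota> l d y) = (if l = j then y else \<zero>\<^bsub>Ss ! j\<^esub>)"
      by (rule iffD1[OF T.Comp.germ_class_eq_iff[OF germ_comp[OF g]] eq])
  qed
  have ev2: "\<forall>\<^sub>F d in cofinite. \<forall>x\<in>piece M d. x = (\<Oplus>j\<in>I. \<iota> j d (\<pi> j d x))"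
  proof -
    have g: "\<forall>j\<in>I. germ M M (\<lambda>d x. \<iota> j d (\<pi> j d x))" using germ_comp \<iota> \<pi> by blast
    have c: "qcomp M M (F j) (G j) = germ_class M M (\<lambda>d x. \<iota> j d (\<pi> j d x))" if j: "j \<in> I" for j
      using fg_triple.qcomp_germ_class[OF triple'[OF j], of "\<pi> j" "\<iota> j"] \<iota> \<pi> j by simp
    have "qid M = finprod (qhom_group M M) (\<lambda>j. germ_class M M (\<lambda>d x. \<iota> j d (\<pi> j d x))) I"
      unfolding sum[symmetric]
      by (rule comm_monoid.finprod_cong'[OF MM.qhom_group_comm_monoid])
        (use c g MM.germ_class_in_qhom in \<open>auto simp: qhom_group_def\<close>)
    also have "\<dots> = germ_class M M (\<lambda>d x. \<Oplus>j\<in>I. \<iota> j d (\<pi> j d x))"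
      using MM.finprod_germ_class[OF _ g] by blast
    finally have eq: "germ_class M M (\<lambda>d x. x) = germ_class M M (\<lambda>d x. \<Oplus>j\<in>I. \<iota> j d (\<pi> j d x))"
      unfolding qid_germ_class .
    show ?thesis by (rule iffD1[OF MM.germ_class_eq_iff[OF germ_id] eq])
  qed
  have ev3: "\<forall>\<^sub>F d in cofinite. \<forall>j\<in>I. germ_at (Ss ! j) M d (\<iota> j)"
    using \<iota> by (intro eventually_ball_finite) (auto simp: germ_def)
  then have ev3: "\<forall>\<^sub>F d in cofinite. \<forall>b. \<forall>j\<in>I. germ_at (Ss ! j) M (b + d) (\<iota> j)"
    by (rule MM.eventually_shift)
  have ev4: "\<forall>\<^sub>F d in cofinite. \<forall>j\<in>I. germ_at M (Ss ! j) d (\<pi> j)"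
    using \<pi> by (intro eventually_ball_finite) (auto simp: germ_def)
  have "\<forall>\<^sub>F d in cofinite. frame_at M I D v d"
    using ev1 ev2 ev3 ev4
  proof eventually_elim
    case (elim d)
    let ?J = "{i \<in> I. d \<in> D i}" and ?w = "\<lambda>i. v i d"
    have gi: "germ_at (Ss ! j) M (b + d) (\<iota> j)" if "j \<in> I" for j b using elim(3) that by blast
    have gi0: "germ_at (Ss ! j) M d (\<iota> j)" if "j \<in> I" for j using gi[OF that, of 0] by simp
    have gp: "germ_at M (Ss ! j) d (\<pi> j)" if "j \<in> I" for j using elim(4) that by blast
    have vp: "v i d \<in> piece M d" if "i \<in> I" "d \<in> D i" for i
      using gi0[OF that(1)] interval_moduleD(3)[OF S[OF that(1)] that(2)] unfolding germ_at_def v_def by blast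
    have scale: "\<iota> i (b + d) (mact (Ss ! i) 0 c y) = mact M 0 c (\<iota> i (b + d) y)"
      if "i \<in> I" "y \<in> piece (Ss ! i) (b + d)" for i b c y
    proof -
      have "\<iota> i (0 + (b + d)) (mact (Ss ! i) 0 c y) = mact M 0 c (\<iota> i (b + d) y)"
        using gi[OF that(1), of b] that(2) unfolding germ_at_def by blast
      then show ?thesis by simp
    qed
    have scale0: "\<iota> i d (mact (Ss ! i) 0 c y) = mact M 0 c (\<iota> i d y)"
      if "i \<in> I" "y \<in> piece (Ss ! i) d" for i c y
      using scale[OF that(1), of y 0] that(2) by simp
    have act: "mact M b c (v i d) = (if b + d \<in> D i then mact M 0 c (v i (b + d)) else \<zero>)"
      if i: "i \<in> I" and d: "d \<in> D i" for i b c
    proof -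
      note iv = interval_moduleD[OF S[OF i]]
      have "mact M b c (v i d) = \<iota> i (b + d) (mact (Ss ! i) b c (e i d))"
        using gi0[OF i] iv(3)[OF d] unfolding germ_at_def v_def by simp
      also have "\<dots> = (if b + d \<in> D i then mact M 0 c (v i (b + d)) else \<zero>)"
        unfolding iv(6)[OF d] v_def
        using scale[OF i iv(3), of b c] fg_pair.germ_zero[OF pair_in[OF i] gi[OF i]] by simp
      finally show ?thesis .
    qed
    have span: "\<exists>c. x = lin_comb M ?J c ?w" if x: "x \<in> piece M d" for x
    proof -
      have pp: "\<pi> j d x \<in> piece (Ss ! j) d" if "j \<in> I" for j
        using gp[OF that] x unfolding germ_at_def by blast
      have eq: "lin_comb M ?J (\<lambda>j. coef j d (\<pi> j d x)) ?w = (\<Oplus>j\<in>I. \<iota> j d (\<pi> j d x))"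
      proof (rule lin_comb_mono_neutral)
        show "\<iota> i d (\<pi> i d x) = mact M 0 (coef i d (\<pi> i d x)) (v i d)" if "i \<in> ?J" for i
        proof -
          have i: "i \<in> I" "d \<in> D i" using that by auto
          have "\<iota> i d (\<pi> i d x) = \<iota> i d (mact (Ss ! i) 0 (coef i d (\<pi> i d x)) (e i d))"
            using coef[OF i pp[OF i(1)]] by simp
          also have "\<dots> = mact M 0 (coef i d (\<pi> i d x)) (v i d)"
            unfolding v_def by (rule scale0[OF i(1) interval_moduleD(3)[OF S[OF i(1)] i(2)]])
          finally show ?thesis .
        qed
        show "\<iota> i d (\<pi> i d x) = \<zero>" if "i \<in> I - ?J" for i
        proof -
          have i: "i \<in> I" "d \<notin> D i" using that by auto
          then have "\<pi> i d x = \<zero>\<^bsub>Ss ! i\<^esub>" using interval_moduleD(2)[OF S[OF i(1)] i(2) pp[OF i(1)]] by simp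
          then show ?thesis using fg_pair.germ_zero[OF pair_in[OF i(1)] gi0[OF i(1)]] by simp
        qed
      qed (use vp in auto)
      have "x = (\<Oplus>j\<in>I. \<iota> j d (\<pi> j d x))" using elim(2) x by blast
      then have "x = lin_comb M ?J (\<lambda>j. coef j d (\<pi> j d x)) ?w" using eq by (rule trans[OF _ sym])
      then show ?thesis by (rule exI[of _ "\<lambda>j. coef j d (\<pi> j d x)"])
    qed
    have indep: "c l = 0" if c: "lin_comb M ?J c ?w = \<zero>" and l: "l \<in> ?J" for c l
    proof -
      have lI: "l \<in> I" "d \<in> D l" using l by auto
      interpret P: fg_pair M "Ss ! l" by (rule pair_out[OF lI(1)])
      interpret Q: fg_pair "Ss ! l" M by (rule pair_in[OF lI(1)])
      note iv = interval_moduleD[OF S[OF lI(1)]]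
      have el: "e l d \<in> carrier (Ss ! l)" using iv(3)[OF lI(2)] by blast
      have g: "\<pi> l d x \<in> piece (Ss ! l) d"
        "y \<in> piece M d \<Longrightarrow> \<pi> l d (x \<oplus> y) = \<pi> l d x \<oplus>\<^bsub>Ss ! l\<^esub> \<pi> l d y"
        "\<pi> l d (mact M 0 a x) = mact (Ss ! l) 0 a (\<pi> l d x)" if "x \<in> piece M d" for x y a
      proof -
        have "\<pi> l (0 + d) (mact M 0 a x) = mact (Ss ! l) 0 a (\<pi> l d x)"
          using gp[OF lI(1)] that unfolding germ_at_def by blast
        then show "\<pi> l d (mact M 0 a x) = mact (Ss ! l) 0 a (\<pi> l d x)" by simp
      qed (use gp[OF lI(1)] that in \<open>simp_all add: germ_at_def\<close>)
      have "\<pi> l d (lin_comb M ?J c ?w) = (\<Oplus>\<^bsub>Ss ! l\<^esub>i\<in>?J. \<pi> l d (mact M 0 (c i) (v i d)))"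
        unfolding lin_comb_def
        by (rule conjunct2[OF hom_finsum[OF M.abelian_monoid_axioms P.N.M.abelian_monoid_axioms, where P = "piece M d"]])
          (use g vp fg_pair.germ_zero[OF pair_out[OF lI(1)] gp[OF lI(1)]] act0_piece in auto)
      also have "\<dots> = (\<Oplus>\<^bsub>Ss ! l\<^esub>i\<in>?J. if i = l then mact (Ss ! l) 0 (c l) (e l d) else \<zero>\<^bsub>Ss ! l\<^esub>)"
      proof (rule P.N.M.finsum_cong')
        fix i assume "i \<in> ?J"
        then have i: "i \<in> I" "d \<in> D i" by auto
        have "\<pi> l d (v i d) = (if i = l then e i d else \<zero>\<^bsub>Ss ! l\<^esub>)"
          unfolding v_def using elim(1) lI(1) i interval_moduleD(3)[OF S[OF i(1)] i(2)] by simp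
        then show "\<pi> l d (mact M 0 (c i) (v i d)) = (if i = l then mact (Ss ! l) 0 (c l) (e l d) else \<zero>\<^bsub>Ss ! l\<^esub>)"
          using g(3)[OF vp[OF i], of "c i"] by simp
      qed (use el in auto)
      also have "\<dots> = mact (Ss ! l) 0 (c l) (e l d)"
        using P.N.M.finsum_singleton[of l ?J "\<lambda>_. mact (Ss ! l) 0 (c l) (e l d)"] l el by (simp add: eq_commute)
      finally have "mact (Ss ! l) 0 (c l) (e l d) = \<zero>\<^bsub>Ss ! l\<^esub>"
        using c fg_pair.germ_zero[OF pair_out[OF lI(1)] gp[OF lI(1)]] by simp
      then show ?thesis by (rule iv(5)[OF lI(2)])
    qed
    show ?case
      unfolding frame_at_def using vp act span indep by blast
  qed
  then show ?thesis unfolding frame_def by blast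
qed

end

section \<open>Strips and quadrants as interval modules\<close>

definition monomial_ideal :: "(nat \<times> nat) set \<Rightarrow> 'k::field kst set" where
  "monomial_ideal A = {q. Poly_Mapping.keys q \<subseteq> A}"

definition up_closed :: "(nat \<times> nat) set \<Rightarrow> bool" where
  "up_closed A \<longleftrightarrow> (\<forall>d\<in>A. \<forall>e. e + d \<in> A)"

lemma sum_terms: "(\<Sum>d\<in>Poly_Mapping.keys q. Poly_Mapping.single d (Poly_Mapping.lookup q d)) = (q :: 'k::field kst)"
proof (rule poly_mapping_eqI)
  fix e
  have "Poly_Mapping.lookup (\<Sum>d\<in>Poly_Mapping.keys q. Poly_Mapping.single d (Poly_Mapping.lookup q d)) e = (\<Sum>d\<in>Poly_Mapping.keys q. if d = e then Poly_Mapping.lookup q e else 0)"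
    unfolding lookup_sum by (rule sum.cong) (auto simp: lookup_single when_def)
  also have "\<dots> = Poly_Mapping.lookup q e" by (simp add: in_keys_iff)
  finally show "Poly_Mapping.lookup (\<Sum>d\<in>Poly_Mapping.keys q. Poly_Mapping.single d (Poly_Mapping.lookup q d)) e = Poly_Mapping.lookup q e" .
qed

lemma monomial_ideal_single: "Poly_Mapping.single d c \<in> monomial_ideal A \<longleftrightarrow> c = 0 \<or> d \<in> A"
  by (auto simp: monomial_ideal_def)

lemma monomial_ideal_mult:
  assumes "up_closed A" "q \<in> monomial_ideal A"
  shows "r * q \<in> monomial_ideal A"
  using assms keys_mult[of r q] unfolding monomial_ideal_def up_closed_def by blast

lemma up_closed_up: "up_closed {d. c \<le> d}"
proof -
  have "c \<le> e + d" if "c \<le> d" for d e :: "nat \<times> nat"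
    using that by (cases c; cases d; cases e) auto
  then show ?thesis by (auto simp: up_closed_def)
qed

lemma monomial_ideal_up_multiple:
  fixes q :: "'k::field kst"
  assumes "q \<in> monomial_ideal {d. c \<le> d}"
  shows "\<exists>x. q = x * Poly_Mapping.single c 1"
proof -
  have shift: "Poly_Mapping.single d a = Poly_Mapping.single (d - c) a * Poly_Mapping.single c 1" if "c \<le> d" for d and a :: 'k
    using that by (cases c; cases d) (simp add: mult_single)
  have "(\<Sum>d\<in>Poly_Mapping.keys q. Poly_Mapping.single d (Poly_Mapping.lookup q d)) =
      (\<Sum>d\<in>Poly_Mapping.keys q. Poly_Mapping.single (d - c) (Poly_Mapping.lookup q d) * Poly_Mapping.single c 1)"
  proof (rule sum.cong[OF refl], rule shift)
    show "c \<le> d" if "d \<in> Poly_Mapping.keys q" for d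
      using assms that unfolding monomial_ideal_def by blast
  qed
  then have "q = (\<Sum>d\<in>Poly_Mapping.keys q. Poly_Mapping.single (d - c) (Poly_Mapping.lookup q d)) * Poly_Mapping.single c 1"
    unfolding sum_terms sum_distrib_right .
  then show ?thesis by blast
qed

lemma PIdl_monomial: "PIdl\<^bsub>kst_ring\<^esub> (Poly_Mapping.single c 1) = monomial_ideal {d. c \<le> d}"
proof (intro equalityI subsetI)
  fix q :: "'a kst" assume "q \<in> PIdl\<^bsub>kst_ring\<^esub> (Poly_Mapping.single c 1)"
  then obtain x where "q = x * Poly_Mapping.single c 1" by (auto simp: cgenideal_def)
  then show "q \<in> monomial_ideal {d. c \<le> d}"
    by (simp add: monomial_ideal_mult[OF up_closed_up] monomial_ideal_single)
qed (use monomial_ideal_up_multiple in \<open>fastforce simp: cgenideal_def\<close>)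

lemma var_s_power: "var_s ^ a = (Poly_Mapping.single (a, 0) 1 :: 'k::field kst)"
  by (induction a) (simp_all add: var_s_def mult_single zero_prod_def[symmetric])

lemma var_t_power: "var_t ^ b = (Poly_Mapping.single (0, b) 1 :: 'k::field kst)"
  by (induction b) (simp_all add: var_t_def mult_single zero_prod_def[symmetric])

lemma kst_module_simps [simp]:
  "carrier kst_module = UNIV" "x \<oplus>\<^bsub>kst_module\<^esub> y = x + y" "\<zero>\<^bsub>kst_module\<^esub> = 0"
  "r \<odot>\<^bsub>kst_module\<^esub> x = r * x" "piece kst_module d = range (Poly_Mapping.single d)"
  by (simp_all add: kst_module_def)

lemma kst_module_abelian_group: "abelian_group (kst_module :: ('k::field kst, 'k kst) gmodule)"
proof (rule abelian_groupI)
  fix x :: "'k kst"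
  show "\<exists>y\<in>carrier kst_module. y \<oplus>\<^bsub>kst_module\<^esub> x = \<zero>\<^bsub>kst_module\<^esub>"
    by (rule bexI[of _ "- x"]) auto
qed (auto simp: algebra_simps)

lemma finsum_kst_module:
  assumes "finite A"
  shows "finsum (kst_module :: ('k::field kst, 'k kst) gmodule) f A = sum f A"
proof -
  interpret abelian_group "kst_module :: ('k kst, 'k kst) gmodule" by (rule kst_module_abelian_group)
  show ?thesis using assms by (induction A) (simp_all add: finsum_insert)
qed

lemma kst_module_fg: "fg_kst_module (kst_module :: ('k::field kst, 'k kst) gmodule)"
proof -
  let ?M = "kst_module :: ('k kst, 'k kst) gmodule"
  interpret A: abelian_group ?M by (rule kst_module_abelian_group)
  have neg: "\<ominus>\<^bsub>?M\<^esub> x = - x" for x by (rule A.minus_equality) auto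
  have g: "graded_module ?M"
  proof (rule graded_moduleI)
    show "module kst_ring ?M"
      by (rule moduleI[OF cring_kst_ring kst_module_abelian_group]) (auto simp: algebra_simps)
    show "subgroup (piece ?M d) (add_monoid ?M)" for d
    proof (rule subgroup.intro)
      show "inv\<^bsub>add_monoid ?M\<^esub> x \<in> piece ?M d" if x: "x \<in> piece ?M d" for x
      proof -
        obtain c where "x = Poly_Mapping.single d c" using x by auto
        then have "\<ominus>\<^bsub>?M\<^esub> x = Poly_Mapping.single d (- c)" by (simp add: neg single_uminus)
        then show ?thesis by (simp add: a_inv_def)
      qed
      show "x \<otimes>\<^bsub>add_monoid ?M\<^esub> y \<in> piece ?M d" if "x \<in> piece ?M d" "y \<in> piece ?M d" for x y
        using that by (auto simp: single_add[symmetric])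
      show "\<one>\<^bsub>add_monoid ?M\<^esub> \<in> piece ?M d"
        by simp (rule range_eqI[of _ _ 0], simp)
    qed simp
    show "mact ?M e c x \<in> piece ?M (e + d)" if "x \<in> piece ?M d" for e c x d
      using that by (auto simp: mult_single)
    show "\<exists>c D. finite D \<and> (\<forall>d. c d \<in> piece ?M d) \<and> x = (\<Oplus>\<^bsub>?M\<^esub>d\<in>D. c d)" for x
      by (intro exI[of _ "\<lambda>d. Poly_Mapping.single d (Poly_Mapping.lookup x d)"] exI[of _ "Poly_Mapping.keys x"])
        (simp add: finsum_kst_module sum_terms)
    show "c d = \<zero>\<^bsub>?M\<^esub>"
      if D: "finite D" "\<And>d. c d \<in> piece ?M d" "(\<Oplus>\<^bsub>?M\<^esub>d\<in>D. c d) = \<zero>\<^bsub>?M\<^esub>" "d \<in> D" for c D d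
    proof -
      have "\<forall>d. \<exists>a. c d = Poly_Mapping.single d a" using D(2) by auto
      then obtain a where a: "\<forall>d. c d = Poly_Mapping.single d (a d)" by metis
      have "0 = Poly_Mapping.lookup (\<Sum>d\<in>D. c d) d" using D(1,3) by (simp add: finsum_kst_module)
      also have "\<dots> = (\<Sum>i\<in>D. if i = d then a d else 0)"
        unfolding lookup_sum by (rule sum.cong) (auto simp: a lookup_single when_def)
      also have "\<dots> = a d" using D(1,4) by simp
      finally show ?thesis using a by simp
    qed
  qed
  interpret graded_kst_module ?M by unfold_locales (rule g)
  have "q \<in> monomial_span ?M {1}" for q :: "'k kst"
  proof (induction q rule: kst_induct)
    case zero
    then show ?case using monomial_span.zero[of ?M] by simp
  next
    case (add r e c)
    then show ?case using monomial_span.step[of 1 "{1}" r ?M e c] by simp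
  qed
  then have "finitely_generated ?M"
    by (intro finitely_generatedI[of "{1}"]) auto
  then show ?thesis by unfold_locales
qed

lemma component_kst_module: "component kst_module (q :: 'k::field kst) d = Poly_Mapping.single d (Poly_Mapping.lookup q d)"
proof -
  interpret fg_kst_module "kst_module :: ('k kst, 'k kst) gmodule" by (rule kst_module_fg)
  have "component kst_module q = (\<lambda>d. Poly_Mapping.single d (Poly_Mapping.lookup q d))"
    by (rule component_unique[of "Poly_Mapping.keys q"]) (auto simp: finsum_kst_module sum_terms in_keys_iff)
  then show ?thesis by simp
qed

lemma monomial_ideal_graded:
  assumes "up_closed A"
  shows "graded_submodule (monomial_ideal A) (kst_module :: ('k::field kst, 'k kst) gmodule)"
proof -
  interpret fg_kst_module "kst_module :: ('k kst, 'k kst) gmodule" by (rule kst_module_fg)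
  have neg: "\<ominus>\<^bsub>kst_module\<^esub> x = - x" for x :: "'k kst" by (rule M.minus_equality) auto
  have "submodule (monomial_ideal A) kst_ring (kst_module :: ('k kst, 'k kst) gmodule)"
  proof (rule submoduleI)
    show "a \<oplus>\<^bsub>kst_module\<^esub> b \<in> monomial_ideal A" if "a \<in> monomial_ideal A" "b \<in> monomial_ideal A" for a b :: "'k kst"
      using that keys_add[of a b] unfolding monomial_ideal_def by auto
    show "\<ominus>\<^bsub>kst_module\<^esub> a \<in> monomial_ideal A" if "a \<in> monomial_ideal A" for a :: "'k kst"
      using that by (simp add: neg monomial_ideal_def)
  qed (auto simp: monomial_ideal_def intro: subsetD[OF monomial_ideal_mult[OF assms, unfolded monomial_ideal_def mem_Collect_eq]])
  then show ?thesis
    by (rule graded_submoduleI)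
      (auto simp: component_kst_module monomial_ideal_single in_keys_iff monomial_ideal_def)
qed

text \<open>
  In each bidegree the quotient of two nested monomial ideals is spanned by the class of one
  monomial, which is nonzero exactly when the monomial lies in the larger but not in the smaller
  ideal. All strips and quadrants are of this form; for a quadrant the smaller ideal is zero.
\<close>

lemma monomial_quotient_interval:
  fixes c :: "nat \<times> nat" and B :: "(nat \<times> nat) set"
  defines "A \<equiv> {d. c \<le> d}"
  assumes B: "up_closed B" "B \<subseteq> A"
  shows "\<exists>e. interval_module (quotient_module (restrict_module (kst_module :: ('k::field kst, 'k kst) gmodule)
    (monomial_ideal A)) (monomial_ideal B)) (A - B) e"
proof -
  let ?K = "kst_module :: ('k kst, 'k kst) gmodule"
  interpret K: fg_kst_module ?K by (rule kst_module_fg)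
  have upA: "up_closed A" unfolding A_def by (rule up_closed_up)
  interpret KA: graded_sub ?K "monomial_ideal A" by unfold_locales (rule monomial_ideal_graded[OF upA])
  interpret KB: graded_sub ?K "monomial_ideal B" by unfold_locales (rule monomial_ideal_graded[OF B(1)])
  let ?R = "restrict_module ?K (monomial_ideal A)"
  interpret R: graded_kst_module ?R by (rule KA.restrict_graded)
  have BA: "monomial_ideal B \<subseteq> monomial_ideal A" using B(2) by (auto simp: monomial_ideal_def)
  have base: "Poly_Mapping.single c 1 \<in> carrier ?R"
    by (simp add: monomial_ideal_single A_def)
  have "q \<in> monomial_span ?R {Poly_Mapping.single c 1}" if q: "q \<in> carrier ?R" for q
  proof -
    have "q \<in> monomial_ideal {d. c \<le> d}" using q by (simp add: A_def)
    then obtain x where "q = x * Poly_Mapping.single c 1" using monomial_ideal_up_multiple by blast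
    then have "q = x \<odot>\<^bsub>?R\<^esub> Poly_Mapping.single c 1" by simp
    moreover have "x \<odot>\<^bsub>?R\<^esub> Poly_Mapping.single c 1 \<in> monomial_span ?R {Poly_Mapping.single c 1}"
      using base by (intro R.monomial_span_smult R.monomial_span_base) auto
    ultimately show ?thesis by simp
  qed
  then have fgR: "finitely_generated ?R"
    using base by (intro R.finitely_generatedI[of "{Poly_Mapping.single c 1}"]) blast+
  have negR: "\<ominus>\<^bsub>?R\<^esub> x = \<ominus>\<^bsub>?K\<^esub> x" if "x \<in> monomial_ideal A" for x
    using that KA.U_neg[OF that] K.M.l_neg[of x] by (intro R.M.minus_equality) simp_all
  have "submodule (monomial_ideal B) kst_ring ?R"
  proof (rule R.submoduleI)
    show "\<ominus>\<^bsub>?R\<^esub> a \<in> monomial_ideal B" if "a \<in> monomial_ideal B" for a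
      using KB.U_neg[OF that] negR[of a] BA that by auto
  qed (use BA KB.U_zero KB.U_add KB.U_act in auto)
  then have "graded_submodule (monomial_ideal B) ?R"
  proof (rule R.graded_submoduleI)
    fix x :: "'k kst" and d assume x: "x \<in> monomial_ideal B"
    then have "component ?R x = component ?K x"
      using K.graded_submoduleD(1)[OF KA.graded_submod] BA by blast
    then show "component ?R x d \<in> monomial_ideal B" using KB.U_component[OF x] by simp
  qed
  then interpret RB: graded_sub ?R "monomial_ideal B" by unfold_locales
  let ?Q = "quotient_module ?R (monomial_ideal B)"
  have fgQ: "fg_kst_module ?Q"
    using RB.quotient_graded RB.quotient_finitely_generated[OF fgR] by unfold_locales
  define e where "e d = monomial_ideal B +>\<^bsub>?R\<^esub> Poly_Mapping.single d 1" for d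
  have act: "mact ?Q b a (e d) = monomial_ideal B +>\<^bsub>?R\<^esub> Poly_Mapping.single (b + d) a" if "d \<in> A" for b a d
    unfolding e_def using RB.quotient_smult[of "Poly_Mapping.single d 1" "Poly_Mapping.single b a"] that
    by (simp add: monomial_ideal_single mult_single del: quotient_module_simps)
  have zero: "monomial_ideal B +>\<^bsub>?R\<^esub> Poly_Mapping.single d a = \<zero>\<^bsub>?Q\<^esub> \<longleftrightarrow> a = 0 \<or> d \<in> B"
    if "a = 0 \<or> d \<in> A" for d a
    using RB.coset_eq_zero_iff[of "Poly_Mapping.single d a"] that by (simp add: monomial_ideal_single)
  have piece: "y \<in> piece ?Q d \<longleftrightarrow> (\<exists>a. (a = 0 \<or> d \<in> A) \<and> y = monomial_ideal B +>\<^bsub>?R\<^esub> Poly_Mapping.single d a)" for y d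
    unfolding quotient_module_simps restrict_module_simps kst_module_simps
      monomial_ideal_single[of d _ A, symmetric] by blast
  have "interval_module ?Q (A - B) e"
    unfolding interval_module_def
  proof (intro conjI allI impI ballI)
    show "piece ?Q d = {\<zero>\<^bsub>?Q\<^esub>}" if d: "d \<notin> A - B" for d
    proof (intro equalityI subsetI)
      fix y assume "y \<in> piece ?Q d"
      then obtain a where a: "a = 0 \<or> d \<in> A" "y = monomial_ideal B +>\<^bsub>?R\<^esub> Poly_Mapping.single d a"
        unfolding piece by blast
      then show "y \<in> {\<zero>\<^bsub>?Q\<^esub>}" using zero[OF a(1)] d by blast
    next
      fix y assume "y \<in> {\<zero>\<^bsub>?Q\<^esub>}"
      then show "y \<in> piece ?Q d" unfolding piece using zero[of 0 d] by (intro exI[of _ 0]) simp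
    qed
    fix d assume d: "d \<in> A - B"
    show "e d \<in> piece ?Q d" unfolding piece e_def using d by blast
    show "\<exists>a. y = mact ?Q 0 a (e d)" if "y \<in> piece ?Q d" for y
      using that d act[of d 0] unfolding piece by auto
    show "a = 0" if "mact ?Q 0 a (e d) = \<zero>\<^bsub>?Q\<^esub>" for a
      using that d act[of d 0 a] zero[of a d] by auto
    show "mact ?Q b a (e d) = (if b + d \<in> A - B then mact ?Q 0 a (e (b + d)) else \<zero>\<^bsub>?Q\<^esub>)" for b a
    proof -
      have bd: "b + d \<in> A" using d upA unfolding up_closed_def by blast
      show ?thesis
        using act[of d b a] act[of "b + d" 0 a] zero[of a "b + d"] d bd by auto
    qed
  qed (rule fgQ)
  then show ?thesis by blast
qed

datatype shape = Vert nat nat | Horiz nat nat | Quad nat nat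

fun valid :: "shape \<Rightarrow> bool" where
  "valid (Vert a b) \<longleftrightarrow> a < b"
| "valid (Horiz a b) \<longleftrightarrow> a < b"
| "valid (Quad a b) \<longleftrightarrow> True"

fun region :: "shape \<Rightarrow> (nat \<times> nat) set" where
  "region (Vert a b) = {d. a \<le> fst d \<and> fst d < b}"
| "region (Horiz a b) = {d. a \<le> snd d \<and> snd d < b}"
| "region (Quad a b) = {d. a \<le> fst d \<and> b \<le> snd d}"

fun module_of :: "shape \<Rightarrow> ('k::field kst, 'k kst set) gmodule" where
  "module_of (Vert a b) = vertical_strip a b"
| "module_of (Horiz a b) = horizontal_strip a b"
| "module_of (Quad a b) = quadrant (a, b)"

lemma strip_or_quadrant_iff: "strip_or_quadrant S \<longleftrightarrow> (\<exists>\<sigma>. valid \<sigma> \<and> S = module_of \<sigma>)"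
proof
  assume "strip_or_quadrant S"
  then show "\<exists>\<sigma>. valid \<sigma> \<and> S = module_of \<sigma>"
  proof cases
    case (vertical a b)
    then show ?thesis by (intro exI[of _ "Vert a b"]) simp
  next
    case (horizontal a b)
    then show ?thesis by (intro exI[of _ "Horiz a b"]) simp
  next
    case (quadrant a)
    then show ?thesis by (cases a) (intro exI[of _ "Quad (fst a) (snd a)"], simp)
  qed
next
  assume "\<exists>\<sigma>. valid \<sigma> \<and> S = module_of \<sigma>"
  then obtain \<sigma> where "valid \<sigma>" "S = module_of \<sigma>" by blast
  then show "strip_or_quadrant S"
    by (cases \<sigma>) (auto intro: strip_or_quadrant.intros)
qed

lemma module_of_interval:
  assumes "valid \<sigma>"
  shows "\<exists>e. interval_module (module_of \<sigma> :: ('k::field kst, 'k kst set) gmodule) (region \<sigma>) e"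
proof (cases \<sigma>)
  case (Vert a b)
  have "{d. (a, 0) \<le> d} - {d. (b, 0) \<le> d} = region \<sigma>" "{d. (b, 0) \<le> d} \<subseteq> {d. (a, 0) \<le> d}"
    using Vert assms by (auto simp: less_eq_prod_def)
  then show ?thesis
    using monomial_quotient_interval[OF up_closed_up, of "(b, 0)" "(a, 0)"] Vert
    by (simp add: vertical_strip_def principal_def var_s_power PIdl_monomial)
next
  case (Horiz a b)
  have "{d. (0, a) \<le> d} - {d. (0, b) \<le> d} = region \<sigma>" "{d. (0, b) \<le> d} \<subseteq> {d. (0, a) \<le> d}"
    using Horiz assms by (auto simp: less_eq_prod_def)
  then show ?thesis
    using monomial_quotient_interval[OF up_closed_up, of "(0, b)" "(0, a)"] Horiz
    by (simp add: horizontal_strip_def principal_def var_t_power PIdl_monomial)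
next
  case (Quad a b)
  have "{d. (a, b) \<le> d} = region \<sigma>"
    using Quad by (auto simp: less_eq_prod_def)
  moreover have "monomial_ideal {} = {0 :: 'k kst}" by (auto simp: monomial_ideal_def)
  ultimately show ?thesis
    using monomial_quotient_interval[where 'k = 'k, of "{}" "(a, b)"] Quad
    by (simp add: quadrant_def principal_def var_s_power var_t_power mult_single PIdl_monomial up_closed_def)
qed

section \<open>Bases adapted to two flags\<close>

context vector_space
begin

lemma independent_disjoint_span:
  assumes X: "independent X" and S: "finite S" "S \<subseteq> X" "R \<subseteq> X" "S \<inter> R = {}"
    and mem: "(\<Sum>e\<in>S. c e *s e) \<in> span R" and e: "e \<in> S"
  shows "c e = 0"
proof -
  obtain T r where T: "finite T" "T \<subseteq> R" "(\<Sum>e\<in>S. c e *s e) = (\<Sum>e\<in>T. r e *s e)"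
    using mem unfolding span_explicit by blast
  let ?u = "\<lambda>e. if e \<in> S then c e else - r e"
  have ST: "S \<inter> T = {}" using S(4) T(2) by blast
  have "(\<Sum>e\<in>S \<union> T. ?u e *s e) = (\<Sum>e\<in>S. ?u e *s e) + (\<Sum>e\<in>T. ?u e *s e)"
    using S(1) T(1) ST by (rule sum.union_disjoint)
  also have "(\<Sum>e\<in>S. ?u e *s e) = (\<Sum>e\<in>S. c e *s e)" by (rule sum.cong) auto
  also have "(\<Sum>e\<in>T. ?u e *s e) = (\<Sum>e\<in>T. - (r e *s e))"
    using ST by (intro sum.cong) auto
  finally have zero: "(\<Sum>e\<in>S \<union> T. ?u e *s e) = 0" using T(3) by (simp add: sum_negf)
  have sub: "S \<union> T \<subseteq> X" "finite (S \<union> T)" using S(1-3) T(1,2) by blast+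
  have "?u e = 0"
    by (rule independentD[OF X sub(2,1) zero]) (use e in blast)
  then show ?thesis using e by simp
qed

text \<open>
  In a linear relation, the part with vectors outside \<open>Y\<close> lies in both spans, hence in the span of
  \<open>Y \<inter> X\<close>. As these vectors belong to the independent set \<open>X\<close>, that part vanishes.
\<close>

lemma independent_Un:
  assumes Y: "independent Y" and X: "independent X" and int: "span Y \<inter> span X \<subseteq> span (Y \<inter> X)"
  shows "independent (Y \<union> X)"
  unfolding independent_explicit_finite_subsets
proof (intro allI impI)
  fix S u assume S: "S \<subseteq> Y \<union> X" and fin: "finite S" and zero: "(\<Sum>v\<in>S. u v *s v) = 0"
  have split: "(\<Sum>v\<in>S. u v *s v) = (\<Sum>v\<in>S \<inter> Y. u v *s v) + (\<Sum>v\<in>S - Y. u v *s v)"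
    using fin sum.Int_Diff by blast
  then have eq: "(\<Sum>v\<in>S - Y. u v *s v) = - (\<Sum>v\<in>S \<inter> Y. u v *s v)"
    using zero by (simp add: eq_neg_iff_add_eq_0 add.commute)
  have "(\<Sum>v\<in>S - Y. u v *s v) \<in> span X"
    using S by (intro span_sum span_scale span_base) auto
  moreover have "(\<Sum>v\<in>S - Y. u v *s v) \<in> span Y"
    unfolding eq by (intro span_neg span_sum span_scale span_base) auto
  ultimately have mem: "(\<Sum>v\<in>S - Y. u v *s v) \<in> span (Y \<inter> X)" using int by blast
  have 1: "u v = 0" if "v \<in> S - Y" for v
    by (rule independent_disjoint_span[OF X _ _ _ _ mem that]) (use S fin in auto)
  then have "(\<Sum>v\<in>S - Y. u v *s v) = 0" by simp
  then have "(\<Sum>v\<in>S \<inter> Y. u v *s v) = 0" using zero split by simp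
  then have 2: "u v = 0" if "v \<in> S \<inter> Y" for v
    using independentD[OF Y, of "S \<inter> Y" u v] that fin by blast
  show "\<forall>v\<in>S. u v = 0" using 1 2 by blast
qed

text \<open>
  The basis of \<open>R\<^sub>j\<close> is obtained by extending the union of the basis of \<open>R\<^bsub>j-1\<^esub>\<close> found before with
  \<open>X \<inter> R\<^sub>j\<close>. This union is independent by the previous lemma, because \<open>R\<^bsub>j-1\<^esub>\<close> and \<open>Z \<inter> R\<^sub>j\<close> meet in
  \<open>Z \<inter> R\<^bsub>j-1\<^esub>\<close>, which is spanned by vectors common to both bases.
\<close>

lemma extend_adapted:
  assumes Z: "subspace Z" and R: "\<forall>j. subspace (R j)" "\<forall>i j. i \<le> j \<longrightarrow> R i \<subseteq> R (j :: nat)"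
    and X: "independent X" "X \<subseteq> Z" "\<forall>j\<le>m. Z \<inter> R j \<subseteq> span (X \<inter> R j)"
  shows "\<exists>Y. independent Y \<and> X \<inter> R m \<subseteq> Y \<and> Y \<subseteq> R m \<and> (\<forall>j\<le>m. R j \<subseteq> span (Y \<inter> R j))"
  using X(3)
proof (induction m)
  case 0
  have "independent (X \<inter> R 0)" using X(1) by (rule independent_mono) blast
  then obtain Y where "X \<inter> R 0 \<subseteq> Y" "Y \<subseteq> R 0" "independent Y" "R 0 \<subseteq> span Y"
    using maximal_independent_subset_extend[of "X \<inter> R 0" "R 0"] by blast
  moreover from this have "Y \<inter> R 0 = Y" by blast
  ultimately show ?case by (intro exI[of _ Y]) simp
next
  case (Suc m)
  then obtain Y where Y: "independent Y" "X \<inter> R m \<subseteq> Y" "Y \<subseteq> R m" "\<forall>j\<le>m. R j \<subseteq> span (Y \<inter> R j)"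
    by auto
  have mono: "R m \<subseteq> R (Suc m)" using R(2) by simp
  have "span Y \<inter> span (X \<inter> R (Suc m)) \<subseteq> span (Y \<inter> (X \<inter> R (Suc m)))"
  proof -
    have "span Y \<subseteq> R m" using Y(3) R(1) by (intro span_minimal) auto
    moreover have "span (X \<inter> R (Suc m)) \<subseteq> Z" using X(2) Z by (intro span_minimal) auto
    moreover have "Z \<inter> R m \<subseteq> span (X \<inter> R m)" using Suc.prems by simp
    moreover have "span (X \<inter> R m) \<subseteq> span (Y \<inter> (X \<inter> R (Suc m)))"
      using Y(2) mono by (intro span_mono) blast
    ultimately show ?thesis by blast
  qed
  moreover have "independent (X \<inter> R (Suc m))" using X(1) by (rule independent_mono) blast
  ultimately have ind: "independent (Y \<union> (X \<inter> R (Suc m)))" using Y(1) by (intro independent_Un)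
  have sub: "Y \<union> (X \<inter> R (Suc m)) \<subseteq> R (Suc m)" using Y(3) mono by blast
  obtain Y' where Y': "Y \<union> (X \<inter> R (Suc m)) \<subseteq> Y'" "Y' \<subseteq> R (Suc m)" "independent Y'" "R (Suc m) \<subseteq> span Y'"
    using maximal_independent_subset_extend[OF sub ind] by blast
  have "R j \<subseteq> span (Y' \<inter> R j)" if "j \<le> Suc m" for j
  proof (cases "j = Suc m")
    case True
    then have "Y' \<inter> R j = Y'" using Y'(2) by blast
    then show ?thesis using Y'(4) True by simp
  next
    case False
    then have "R j \<subseteq> span (Y \<inter> R j)" using Y(4) that by simp
    also have "\<dots> \<subseteq> span (Y' \<inter> R j)" using Y'(1) by (intro span_mono) blast
    finally show ?thesis .
  qed
  then show ?case using Y' by (intro exI[of _ Y']) blast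
qed

text \<open>
  The basis is built along the first flag. Passing from \<open>P\<^sub>n\<close> to \<open>P\<^bsub>n+1\<^esub>\<close> extends a basis adapted to
  the flag \<open>P\<^sub>n \<inter> Q\<^sub>j\<close> to one adapted to \<open>P\<^bsub>n+1\<^esub> \<inter> Q\<^sub>j\<close>.
\<close>

lemma two_flags:
  assumes P: "\<forall>i. subspace (P i)" "\<forall>i j. i \<le> j \<longrightarrow> P i \<subseteq> P (j :: nat)"
    and Q: "\<forall>i. subspace (Q i)" "\<forall>i j. i \<le> j \<longrightarrow> Q i \<subseteq> Q (j :: nat)"
  shows "\<exists>X. independent X \<and> X \<subseteq> P n \<inter> Q m \<and> (\<forall>i\<le>n. \<forall>j\<le>m. P i \<inter> Q j \<subseteq> span (X \<inter> P i \<inter> Q j))"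
proof (induction n)
  case 0
  have "\<exists>Y. independent Y \<and> {} \<inter> (P 0 \<inter> Q m) \<subseteq> Y \<and> Y \<subseteq> P 0 \<inter> Q m \<and> (\<forall>j\<le>m. P 0 \<inter> Q j \<subseteq> span (Y \<inter> (P 0 \<inter> Q j)))"
  proof (rule extend_adapted[of "{0}"])
    show "\<forall>i j. i \<le> j \<longrightarrow> P 0 \<inter> Q i \<subseteq> P 0 \<inter> Q j" using Q(2) by blast
  qed (use P(1) Q(1) in \<open>auto simp: subspace_inter independent_empty\<close>)
  then show ?case by (auto simp: Int_assoc)
next
  case (Suc n)
  then obtain X where X: "independent X" "X \<subseteq> P n \<inter> Q m" "\<forall>i\<le>n. \<forall>j\<le>m. P i \<inter> Q j \<subseteq> span (X \<inter> P i \<inter> Q j)"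
    by blast
  have mono: "P n \<subseteq> P (Suc n)" using P(2) by simp
  have "\<exists>Y. independent Y \<and> X \<inter> (P (Suc n) \<inter> Q m) \<subseteq> Y \<and> Y \<subseteq> P (Suc n) \<inter> Q m \<and>
      (\<forall>j\<le>m. P (Suc n) \<inter> Q j \<subseteq> span (Y \<inter> (P (Suc n) \<inter> Q j)))"
  proof (rule extend_adapted[of "P n"])
    show "\<forall>j\<le>m. P n \<inter> (P (Suc n) \<inter> Q j) \<subseteq> span (X \<inter> (P (Suc n) \<inter> Q j))"
    proof (intro allI impI)
      fix j assume "j \<le> m"
      then have "P n \<inter> Q j \<subseteq> span (X \<inter> P n \<inter> Q j)" using X(3) by blast
      moreover have "span (X \<inter> P n \<inter> Q j) \<subseteq> span (X \<inter> (P (Suc n) \<inter> Q j))"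
        using mono by (intro span_mono) blast
      ultimately show "P n \<inter> (P (Suc n) \<inter> Q j) \<subseteq> span (X \<inter> (P (Suc n) \<inter> Q j))" by blast
    qed
    show "\<forall>i j. i \<le> j \<longrightarrow> P (Suc n) \<inter> Q i \<subseteq> P (Suc n) \<inter> Q j" using Q(2) by blast
  qed (use X(1,2) P(1) Q(1) in \<open>auto simp: subspace_inter\<close>)
  then obtain Y where Y: "independent Y" "X \<inter> (P (Suc n) \<inter> Q m) \<subseteq> Y" "Y \<subseteq> P (Suc n) \<inter> Q m"
    "\<forall>j\<le>m. P (Suc n) \<inter> Q j \<subseteq> span (Y \<inter> (P (Suc n) \<inter> Q j))" by blast
  have XY: "X \<subseteq> Y" using Y(2) X(2) mono by blast
  have "P i \<inter> Q j \<subseteq> span (Y \<inter> P i \<inter> Q j)" if "i \<le> Suc n" "j \<le> m" for i j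
  proof (cases "i = Suc n")
    case True
    then show ?thesis using Y(4) that(2) by (simp add: Int_assoc)
  next
    case False
    then have "P i \<inter> Q j \<subseteq> span (X \<inter> P i \<inter> Q j)" using X(3) that by simp
    also have "\<dots> \<subseteq> span (Y \<inter> P i \<inter> Q j)" using XY by (intro span_mono) blast
    finally show ?thesis .
  qed
  then show ?case using Y by blast
qed

text \<open>
  A basis of \<open>A/B\<close> in two parts. The part of \<open>A\<close> that survives modulo \<open>K\<close> has the basis \<open>T\<close>, which
  consists of elements of \<open>A + K\<close>; each \<open>e \<in> T\<close> is replaced by an element \<open>x e\<close> of \<open>A\<close> that is
  congruent to \<open>e\<close> modulo \<open>K\<close>. The part inside \<open>K\<close> has the basis \<open>Y \<inter> A\<close>, from which the elements of
  \<open>B\<close> are dropped.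
\<close>

lemma relative_basis:
  assumes K: "subspace K" and A: "subspace A" and B: "subspace B" "B \<subseteq> A" "B \<subseteq> K"
    and X: "finite X" "independent X" "K \<subseteq> span (X \<inter> K)"
    and T: "T \<subseteq> X - K" "A \<subseteq> span (T \<union> (X \<inter> K))" "\<forall>e\<in>T. x e \<in> A \<and> e - x e \<in> K"
    and Y: "finite Y" "independent Y" "Y \<subseteq> K" "K \<inter> A \<subseteq> span (Y \<inter> A)" "B \<subseteq> span (Y \<inter> B)"
  shows "z \<in> A \<Longrightarrow> \<exists>c c'. z - ((\<Sum>e\<in>T. c e *s x e) + (\<Sum>y\<in>Y \<inter> A - B. c' y *s y)) \<in> B"
    and "(\<Sum>e\<in>T. c e *s x e) + (\<Sum>y\<in>Y \<inter> A - B. c' y *s y) \<in> B \<Longrightarrow>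
      (\<forall>e\<in>T. c e = 0) \<and> (\<forall>y\<in>Y \<inter> A - B. c' y = 0)"
proof -
  have finT: "finite T" using T(1) X(1) by (blast intro: finite_subset)
  have diff: "(\<Sum>e\<in>T. c e *s e) - (\<Sum>e\<in>T. c e *s x e) \<in> K" for c
  proof -
    have "(\<Sum>e\<in>T. c e *s e) - (\<Sum>e\<in>T. c e *s x e) = (\<Sum>e\<in>T. c e *s (e - x e))"
      by (simp add: sum_subtractf scale_right_diff_distrib)
    also have "\<dots> \<in> K" using T(3) K by (intro subspace_sum subspace_scale) auto
    finally show ?thesis .
  qed
  {
    assume z: "z \<in> A"
    have "z \<in> span (T \<union> (X \<inter> K))" using T(2) z by blast
    then obtain t k where tk: "t \<in> span T" "k \<in> span (X \<inter> K)" "z = t + k"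
      unfolding span_Un by blast
    obtain c where c: "t = (\<Sum>e\<in>T. c e *s e)"
      using tk(1) unfolding span_finite[OF finT] by blast
    have "k \<in> K" using tk(2) span_minimal[of "X \<inter> K" K] K by blast
    let ?z = "z - (\<Sum>e\<in>T. c e *s x e)"
    have eq: "?z = ((\<Sum>e\<in>T. c e *s e) - (\<Sum>e\<in>T. c e *s x e)) + k" using tk(3) c by simp
    have "?z \<in> K" unfolding eq by (rule subspace_add[OF K diff \<open>k \<in> K\<close>])
    moreover have "?z \<in> A"
      using z A T(3) by (intro subspace_diff subspace_sum subspace_scale) auto
    ultimately have "?z \<in> span (Y \<inter> A)" using Y(4) by blast
    then obtain c' where c': "?z = (\<Sum>y\<in>Y \<inter> A. c' y *s y)"
      using span_finite[of "Y \<inter> A"] Y(1) by auto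
    have "(\<Sum>y\<in>Y \<inter> A. c' y *s y) = (\<Sum>y\<in>(Y \<inter> A) \<inter> B. c' y *s y) + (\<Sum>y\<in>Y \<inter> A - B. c' y *s y)"
      using Y(1) by (intro sum.Int_Diff) simp
    moreover have "(\<Sum>y\<in>(Y \<inter> A) \<inter> B. c' y *s y) \<in> B"
      using B(1) by (intro subspace_sum subspace_scale) auto
    ultimately have "z - ((\<Sum>e\<in>T. c e *s x e) + (\<Sum>y\<in>Y \<inter> A - B. c' y *s y)) \<in> B"
      using c' by (simp add: algebra_simps)
    then show "\<exists>c c'. z - ((\<Sum>e\<in>T. c e *s x e) + (\<Sum>y\<in>Y \<inter> A - B. c' y *s y)) \<in> B" by blast
  }
  {
    assume s: "(\<Sum>e\<in>T. c e *s x e) + (\<Sum>y\<in>Y \<inter> A - B. c' y *s y) \<in> B"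
    let ?y = "\<Sum>y\<in>Y \<inter> A - B. c' y *s y"
    have yK: "?y \<in> K" using Y(3) K by (intro subspace_sum subspace_scale) auto
    have "(\<Sum>e\<in>T. c e *s x e) = ((\<Sum>e\<in>T. c e *s x e) + ?y) - ?y" by simp
    also have "\<dots> \<in> K" using s B(3) yK K by (intro subspace_diff) auto
    finally have "(\<Sum>e\<in>T. c e *s e) - (\<Sum>e\<in>T. c e *s x e) + (\<Sum>e\<in>T. c e *s x e) \<in> K"
      by (rule subspace_add[OF K diff])
    then have mem: "(\<Sum>e\<in>T. c e *s e) \<in> span (X \<inter> K)" using X(3) by auto
    have c0: "c e = 0" if "e \<in> T" for e
      by (rule independent_disjoint_span[OF X(2) finT _ _ _ mem that]) (use T(1) in auto)
    then have "?y \<in> B" using s by simp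
    then have mem': "?y \<in> span (Y \<inter> B)" using Y(5) by blast
    have "c' y = 0" if "y \<in> Y \<inter> A - B" for y
      by (rule independent_disjoint_span[OF Y(2) _ _ _ _ mem' that]) (use Y(1) in auto)
    then show "(\<forall>e\<in>T. c e = 0) \<and> (\<forall>y\<in>Y \<inter> A - B. c' y = 0)" using c0 by blast
  }
qed

lemma subspace_eq_if_dim_le:
  assumes fin: "finite \<Delta>" "T \<subseteq> span \<Delta>" and S: "subspace S" "S \<subseteq> T" and dim: "dim T \<le> dim S"
  shows "S = T"
proof -
  obtain B where B: "B \<subseteq> S" "independent B" "S \<subseteq> span B" using maximal_independent_subset[of S] by blast
  obtain C where C: "B \<subseteq> C" "C \<subseteq> T" "independent C" "T \<subseteq> span C"
    using maximal_independent_subset_extend[of B T] B S(2) by blast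
  have "finite C" using independent_span_bound[OF fin(1) C(3)] C(2) fin(2) by blast
  moreover have "card C \<le> card B"
    using dim basis_card_eq_dim[OF B(1,3,2)] basis_card_eq_dim[OF C(2,4,3)] by simp
  ultimately have "B = C" using C(1) by (intro card_seteq)
  then have "T \<subseteq> span B" using C(4) by simp
  also have "span B \<subseteq> S" using B(1) S(1) by (rule span_minimal)
  finally show ?thesis using S(2) by blast
qed

lemma dim_mono_finite:
  assumes fin: "finite \<Delta>" "T \<subseteq> span \<Delta>" and S: "S \<subseteq> T"
  shows "dim S \<le> dim T" "dim T \<le> card \<Delta>"
proof -
  obtain B where B: "B \<subseteq> S" "independent B" "S \<subseteq> span B" using maximal_independent_subset[of S] by blast
  obtain C where C: "B \<subseteq> C" "C \<subseteq> T" "independent C" "T \<subseteq> span C"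
    using maximal_independent_subset_extend[of B T] B S by blast
  have "finite C \<and> card C \<le> card \<Delta>" using independent_span_bound[OF fin(1) C(3)] C(2) fin(2) by blast
  then show "dim S \<le> dim T" "dim T \<le> card \<Delta>"
    using card_mono[OF _ C(1)] basis_card_eq_dim[OF B(1,3,2)] basis_card_eq_dim[OF C(2,4,3)] by auto
qed

end

lemma bounded_mono_stable:
  fixes h :: "nat \<Rightarrow> nat"
  assumes "\<forall>i j. i \<le> j \<longrightarrow> h i \<le> h j" "\<forall>i. h i \<le> b"
  shows "\<exists>J. \<forall>j\<ge>J. h j = h J"
proof -
  obtain J where "\<forall>j. h j \<le> h J"
    using ex_has_greatest_nat[of "\<lambda>_. True" 0 h "Suc b"] assms(2) by (auto simp: less_Suc_eq_le)
  then show ?thesis using assms(1) by (meson le_antisym)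
qed

text \<open>
  Beyond a point \<open>(i0, j0)\<close> where the maximum is attained the function is constant. Finitely many rows
  and columns remain, and each of them is eventually constant.
\<close>

lemma bounded_mono_stable2:
  fixes g :: "nat \<Rightarrow> nat \<Rightarrow> nat"
  assumes mono: "\<forall>i i' j j'. i \<le> i' \<longrightarrow> j \<le> j' \<longrightarrow> g i j \<le> g i' j'" and bound: "\<forall>i j. g i j \<le> b"
  shows "\<exists>N. \<forall>i j. g i j = g (min i N) (min j N)"
proof -
  have "\<exists>d. True \<and> (\<forall>d'. True \<longrightarrow> g (fst d') (snd d') \<le> g (fst d) (snd d))"
    by (rule ex_has_greatest_nat[of _ "(0, 0)" _ "Suc b"]) (use bound in \<open>simp_all add: less_Suc_eq_le\<close>)
  then obtain d where d: "\<And>d'. g (fst d') (snd d') \<le> g (fst d) (snd d)" by blast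
  obtain i0 j0 where "d = (i0, j0)" by (cases d)
  then have max: "\<forall>i j. g i j \<le> g i0 j0" using d[of "(i, j)" for i j] by simp
  have top: "g i j = g i0 j0" if "i0 \<le> i" "j0 \<le> j" for i j
    using max mono that by (meson le_antisym)
  have "\<forall>i. \<exists>J. \<forall>j\<ge>J. g i j = g i J"
    using bounded_mono_stable mono bound by (meson order_refl)
  then obtain J where J: "\<forall>i. \<forall>j\<ge>J i. g i j = g i (J i)" by metis
  have "\<forall>j. \<exists>I. \<forall>i\<ge>I. g i j = g I j"
  proof
    fix j show "\<exists>I. \<forall>i\<ge>I. g i j = g I j"
      by (rule bounded_mono_stable[of "\<lambda>i. g i j" b]) (use mono bound in auto)
  qed
  then obtain I where I: "\<forall>j. \<forall>i\<ge>I j. g i j = g (I j) j" by metis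
  obtain N where N: "i0 \<le> N" "j0 \<le> N" "\<forall>i<i0. J i \<le> N" "\<forall>j<j0. I j \<le> N"
  proof
    let ?N = "i0 + j0 + (\<Sum>i<i0. J i) + (\<Sum>j<j0. I j)"
    show "i0 \<le> ?N" "j0 \<le> ?N" by auto
    have "J i \<le> (\<Sum>i<i0. J i)" if "i < i0" for i using that by (intro member_le_sum) auto
    then show "\<forall>i<i0. J i \<le> ?N" by (meson le_add2 le_add1 order_trans)
    have "I j \<le> (\<Sum>j<j0. I j)" if "j < j0" for j using that by (intro member_le_sum) auto
    then show "\<forall>j<j0. I j \<le> ?N" by (meson le_add2 order_trans)
  qed
  have "g i j = g (min i N) (min j N)" for i j
  proof -
    consider "i0 \<le> i" "j0 \<le> j" | "i < i0" | "j < j0" by linarith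
    then show ?thesis
    proof cases
      case 1
      then show ?thesis using top[of i j] top[of "min i N" "min j N"] N by simp
    next
      case 2
      then have mi: "min i N = i" using N(1) by simp
      show ?thesis
      proof (cases "j \<le> N")
        case False
        have "J i \<le> N" using N(3) 2 by blast
        then have "J i \<le> N" "J i \<le> j" using False by linarith+
        then have "g i j = g i N" using J by metis
        then show ?thesis using False mi by (simp add: min_def)
      qed (simp add: mi)
    next
      case 3
      then have mj: "min j N = j" using N(2) by simp
      show ?thesis
      proof (cases "i \<le> N")
        case False
        have "I j \<le> N" using N(4) 3 by blast
        then have "I j \<le> N" "I j \<le> i" using False by linarith+
        then have "g i j = g N j" using I by metis
        then show ?thesis using False mj by (simp add: min_def)
      qed (simp add: mj)
    qed
  qed
  then show ?thesis by blast
qed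

text \<open>
  The dimensions increase and are bounded, hence become stationary, and then so do the subspaces.
\<close>

lemma (in vector_space) subspaces_stable:
  fixes F :: "nat \<times> nat \<Rightarrow> 'b set"
  assumes F: "\<forall>d. subspace (F d)" "\<forall>d d'. d \<le> d' \<longrightarrow> F d \<subseteq> F d'" and fin: "finite \<Delta>" "\<forall>d. F d \<subseteq> span \<Delta>"
  shows "\<exists>N. \<forall>n\<ge>N. \<forall>i j. F (i, j) = F (min i n, min j n)"
proof -
  have "\<exists>N. \<forall>i j. dim (F (i, j)) = dim (F (min i N, min j N))"
  proof (rule bounded_mono_stable2)
    show "\<forall>i i' j j'. i \<le> i' \<longrightarrow> j \<le> j' \<longrightarrow> dim (F (i, j)) \<le> dim (F (i', j'))"
    proof (intro allI impI)
      fix i i' j j' :: nat assume "i \<le> i'" "j \<le> j'"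
      then have "F (i, j) \<subseteq> F (i', j')" using F(2) by simp
      then show "dim (F (i, j)) \<le> dim (F (i', j'))"
        using fin by (intro dim_mono_finite(1)) auto
    qed
    show "\<forall>i j. dim (F (i, j)) \<le> card \<Delta>"
      using fin dim_mono_finite(2)[OF fin(1)] by blast
  qed
  then obtain N where N: "\<forall>i j. dim (F (i, j)) = dim (F (min i N, min j N))" by blast
  have eq: "F (min i N, min j N) = F (i, j)" for i j
    by (rule subspace_eq_if_dim_le[OF fin(1)]) (use F fin(2) N in \<open>simp_all add: less_eq_prod_def\<close>)
  have "F (i, j) = F (min i n, min j n)" if "N \<le> n" for n i j
    using that eq[of i j] eq[of "min i n" "min j n"] by (simp add: min.assoc min.absorb2)
  then show ?thesis by blast
qed

section \<open>Adapted bases of stable subquotients\<close>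

text \<open>
  The stage at which \<open>e\<close> enters an increasing family \<open>S\<close>.
\<close>

definition birth :: "(nat \<Rightarrow> 'b set) \<Rightarrow> 'b \<Rightarrow> nat" where
  "birth S e = (LEAST i. e \<in> S i)"

lemma birth_le_iff:
  assumes "\<forall>i j. i \<le> j \<longrightarrow> S i \<subseteq> S j" "e \<in> S m"
  shows "birth S e \<le> i \<longleftrightarrow> e \<in> S i"
proof
  have "e \<in> S (birth S e)" unfolding birth_def using assms(2) by (rule LeastI)
  then show "birth S e \<le> i \<Longrightarrow> e \<in> S i" using assms(1) by blast
qed (simp add: birth_def Least_le)

context vector_space
begin

text \<open>
  A common basis of \<open>K\<close> for the flags \<open>A\<^sub>i \<inter> K\<close> and \<open>B\<^sub>i\<close>. Its element \<open>y\<close> is a nonzero class of \<open>A\<^sub>i/B\<^sub>i\<close>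
  exactly for \<open>i\<close> between its entries into the two flags: this is a strip.
\<close>

lemma filtered_subspace_basis:
  assumes K: "subspace K" and A: "\<forall>i. subspace (A i)" "\<forall>i j. i \<le> j \<longrightarrow> A i \<subseteq> A (j :: nat)" "\<forall>i. A i = A (min i N)"
    and B: "\<forall>i. subspace (B i)" "\<forall>i j. i \<le> j \<longrightarrow> B i \<subseteq> B (j :: nat)" "\<forall>i. B i = B (min i N)"
    and BK: "B N = K" "K \<subseteq> A N"
  shows "\<exists>Y. independent Y \<and> Y \<subseteq> K \<and> (\<forall>i. K \<inter> A i \<subseteq> span (Y \<inter> A i) \<and> B i \<subseteq> span (Y \<inter> B i))"
proof -
  have "\<exists>Y. independent Y \<and> Y \<subseteq> (A N \<inter> K) \<inter> B N \<and>
      (\<forall>i\<le>N. \<forall>j\<le>N. (A i \<inter> K) \<inter> B j \<subseteq> span (Y \<inter> (A i \<inter> K) \<inter> B j))"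
    by (rule two_flags) (use K A B in \<open>blast intro: subspace_inter\<close>)+
  then obtain Y where Y: "independent Y" "Y \<subseteq> K"
    "\<forall>i\<le>N. \<forall>j\<le>N. (A i \<inter> K) \<inter> B j \<subseteq> span (Y \<inter> (A i \<inter> K) \<inter> B j)" by blast
  have "K \<inter> A i \<subseteq> span (Y \<inter> A i)" if "i \<le> N" for i
  proof -
    have "(A i \<inter> K) \<inter> B N \<subseteq> span (Y \<inter> (A i \<inter> K) \<inter> B N)" using Y(3) that by blast
    also have "\<dots> \<subseteq> span (Y \<inter> A i)" by (intro span_mono) blast
    finally show ?thesis using BK(1) by blast
  qed
  moreover have "B i \<subseteq> span (Y \<inter> B i)" if "i \<le> N" for i
  proof -
    have "(A N \<inter> K) \<inter> B i \<subseteq> span (Y \<inter> (A N \<inter> K) \<inter> B i)" using Y(3) that by blast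
    also have "\<dots> \<subseteq> span (Y \<inter> B i)" by (intro span_mono) blast
    finally show ?thesis using BK B(2) that by blast
  qed
  ultimately have "K \<inter> A i \<subseteq> span (Y \<inter> A i) \<and> B i \<subseteq> span (Y \<inter> B i)" for i
    using A(3)[rule_format, of i] B(3)[rule_format, of i] min.cobounded2[of i N] by metis
  then show ?thesis using Y(1,2) by blast
qed

text \<open>
  The counterpart of a frame for the subquotients \<open>F\<^sub>d/K\<^sub>d\<close>, with representatives \<open>x\<^sub>i(d)\<close> in \<open>F\<^sub>d\<close>
  and equalities replaced by congruences modulo \<open>K\<close>.
\<close>

definition adapted_at :: "(nat \<times> nat \<Rightarrow> 'b set) \<Rightarrow> (nat \<times> nat \<Rightarrow> 'b set) \<Rightarrow> 'i set \<Rightarrow> ('i \<Rightarrow> shape) \<Rightarrow>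
    ('i \<Rightarrow> nat \<times> nat \<Rightarrow> 'b) \<Rightarrow> nat \<times> nat \<Rightarrow> bool" where
  "adapted_at F K I \<sigma> x d \<longleftrightarrow>
     (\<forall>i\<in>I. d \<in> region (\<sigma> i) \<longrightarrow> x i d \<in> F d \<and>
        (\<forall>e. x i d - (if e + d \<in> region (\<sigma> i) then x i (e + d) else 0) \<in> K (e + d))) \<and>
     (\<forall>z\<in>F d. \<exists>c. z - (\<Sum>i\<in>{i \<in> I. d \<in> region (\<sigma> i)}. c i *s x i d) \<in> K d) \<and>
     (\<forall>c. (\<Sum>i\<in>{i \<in> I. d \<in> region (\<sigma> i)}. c i *s x i d) \<in> K d \<longrightarrow>
        (\<forall>i\<in>{i \<in> I. d \<in> region (\<sigma> i)}. c i = 0))"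

lemma sum_two_images:
  assumes "finite S" "finite R" "inj f" "inj g" "\<forall>a b. f a \<noteq> g b"
  shows "(\<Sum>i\<in>f ` S \<union> g ` R. h i) = (\<Sum>a\<in>S. h (f a)) + (\<Sum>b\<in>R. h (g b) :: 'b)"
proof -
  have "f ` S \<inter> g ` R = {}" using assms(5) by blast
  then have "(\<Sum>i\<in>f ` S \<union> g ` R. h i) = sum h (f ` S) + sum h (g ` R)"
    using assms(1,2) by (intro sum.union_disjoint) auto
  then show ?thesis
    using assms(3,4) by (simp add: sum.reindex[OF inj_on_subset[OF _ subset_UNIV]])
qed

lemma half_basis:
  fixes f :: "'b \<Rightarrow> 'i" and g :: "'b \<Rightarrow> 'i"
  assumes K: "subspace K" and A: "subspace A" and B: "subspace B" "B \<subseteq> A" "B \<subseteq> K"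
    and X: "finite X" "independent X" "K \<subseteq> span (X \<inter> K)"
    and T: "T \<subseteq> X - K" "A \<subseteq> span (T \<union> (X \<inter> K))" "\<forall>e\<in>T. x e \<in> A \<and> e - x e \<in> K"
    and Y: "finite Y" "independent Y" "Y \<subseteq> K" "K \<inter> A \<subseteq> span (Y \<inter> A)" "B \<subseteq> span (Y \<inter> B)"
    and fg: "inj f" "inj g" "\<forall>a b. f a \<noteq> g b"
    and w: "\<forall>e\<in>T. w (f e) = x e" "\<forall>y\<in>Y \<inter> A - B. w (g y) = y"
    and J: "J = f ` T \<union> g ` (Y \<inter> A - B)"
  shows "\<forall>z\<in>A. \<exists>c. z - (\<Sum>i\<in>J. c i *s w i) \<in> B"
    and "\<forall>c. (\<Sum>i\<in>J. c i *s w i) \<in> B \<longrightarrow> (\<forall>i\<in>J. c i = 0)"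
proof -
  have finT: "finite T" using T(1) X(1) by (blast intro: finite_subset)
  have finY: "finite (Y \<inter> A - B)" using Y(1) by simp
  have sum: "(\<Sum>i\<in>J. c i *s w i) = (\<Sum>e\<in>T. c (f e) *s x e) + (\<Sum>y\<in>Y \<inter> A - B. c (g y) *s y)" for c
  proof -
    have "(\<Sum>i\<in>J. c i *s w i) = (\<Sum>e\<in>T. c (f e) *s w (f e)) + (\<Sum>y\<in>Y \<inter> A - B. c (g y) *s w (g y))"
      unfolding J by (rule sum_two_images[OF finT finY fg])
    also have "(\<Sum>e\<in>T. c (f e) *s w (f e)) = (\<Sum>e\<in>T. c (f e) *s x e)"
      using w(1) by (intro sum.cong) auto
    also have "(\<Sum>y\<in>Y \<inter> A - B. c (g y) *s w (g y)) = (\<Sum>y\<in>Y \<inter> A - B. c (g y) *s y)"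
      using w(2) by (intro sum.cong) auto
    finally show ?thesis .
  qed
  note rb = relative_basis[OF K A B X T Y]
  show "\<forall>z\<in>A. \<exists>c. z - (\<Sum>i\<in>J. c i *s w i) \<in> B"
  proof
    fix z assume "z \<in> A"
    then obtain c c' where c: "z - ((\<Sum>e\<in>T. c e *s x e) + (\<Sum>y\<in>Y \<inter> A - B. c' y *s y)) \<in> B"
      using rb(1) by blast
    let ?c = "\<lambda>i. if i \<in> range f then c (the_inv f i) else c' (the_inv g i)"
    have "?c (f e) = c e" "?c (g y) = c' y" for e y
      proof -
      show "?c (f e) = c e" using fg(1) by (simp add: the_inv_f_f)
      have "g y \<notin> range f" using fg(3) by (metis rangeE)
      then show "?c (g y) = c' y" using fg(2) by (simp add: the_inv_f_f)
    qed
    then have "z - (\<Sum>i\<in>J. ?c i *s w i) \<in> B" using c unfolding sum by simp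
    then show "\<exists>c. z - (\<Sum>i\<in>J. c i *s w i) \<in> B" by (rule exI[of _ ?c])
  qed
  show "\<forall>c. (\<Sum>i\<in>J. c i *s w i) \<in> B \<longrightarrow> (\<forall>i\<in>J. c i = 0)"
  proof (intro allI impI)
    fix c assume "(\<Sum>i\<in>J. c i *s w i) \<in> B"
    then have "(\<forall>e\<in>T. c (f e) = 0) \<and> (\<forall>y\<in>Y \<inter> A - B. c (g y) = 0)"
      unfolding sum by (rule rb(2))
    then show "\<forall>i\<in>J. c i = 0" unfolding J by blast
  qed
qed

text \<open>
  Outside the box, \<open>F\<^sub>d/K\<^sub>d\<close> is \<open>A\<^sub>i/B\<^sub>i\<close> with \<open>A\<^sub>i = F\<^bsub>(i,N)\<^esub>\<close> and \<open>B\<^sub>i = K\<^bsub>(i,N)\<^esub>\<close> for \<open>d = (i, j)\<close>,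
  \<open>j \<ge> N\<close>, and \<open>C\<^sub>j/D\<^sub>j\<close> with \<open>C\<^sub>j = F\<^bsub>(N,j)\<^esub>\<close> and \<open>D\<^sub>j = K\<^bsub>(N,j)\<^esub>\<close> for \<open>i \<ge> N\<close>. All \<open>B\<^sub>i\<close> and \<open>D\<^sub>j\<close>
  lie in \<open>K = K\<^bsub>(N,N)\<^esub>\<close>. Modulo \<open>K\<close> only the two flags \<open>A\<^sub>i + K\<close> and \<open>C\<^sub>j + K\<close> remain. A common
  basis of them gives the quadrants: the corner of a quadrant records the entries into the two
  flags. Inside \<open>K\<close> the two sides are independent of each other, and each of them gives its strips.
\<close>

lemma adapted_decomposition:
  fixes F K :: "nat \<times> nat \<Rightarrow> 'b set"
  assumes F: "\<forall>d. subspace (F d)" "\<forall>d d'. d \<le> d' \<longrightarrow> F d \<subseteq> F d'" "\<forall>i j. F (i, j) = F (min i N, min j N)"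
    and K: "\<forall>d. subspace (K d)" "\<forall>d d'. d \<le> d' \<longrightarrow> K d \<subseteq> K d'" "\<forall>i j. K (i, j) = K (min i N, min j N)"
    and KF: "\<forall>d. K d \<subseteq> F d" and fin: "finite \<Delta>" "\<forall>d. F d \<subseteq> span \<Delta>"
  shows "\<exists>(I :: ('b + 'b + 'b) set) \<sigma> x. finite I \<and> (\<forall>i\<in>I. valid (\<sigma> i)) \<and>
    (\<forall>d. far N d \<longrightarrow> adapted_at F K I \<sigma> x d)"
proof -
  define A B C D where "A i = F (i, N)" and "B i = K (i, N)" and "C j = F (N, j)" and "D j = K (N, j)" for i j
  define KK where "KK = K (N, N)"
  have F1: "F (i, j) = A i" "K (i, j) = B i" if "N \<le> j" for i j
    using F(3)[rule_format, of i j] F(3)[rule_format, of i N] K(3)[rule_format, of i j] K(3)[rule_format, of i N] that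
    by (simp_all add: A_def B_def min_absorb2)
  have F2: "F (i, j) = C j" "K (i, j) = D j" if "N \<le> i" for i j
    using F(3)[rule_format, of i j] F(3)[rule_format, of N j] K(3)[rule_format, of i j] K(3)[rule_format, of N j] that
    by (simp_all add: C_def D_def min_absorb2)
  have clamp: "\<forall>i. F (i, N) = F (min i N, N)" "\<forall>i. F (N, i) = F (N, min i N)"
    "\<forall>i. K (i, N) = K (min i N, N)" "\<forall>i. K (N, i) = K (N, min i N)"
    using F(3)[rule_format, of _ N] F(3)[rule_format, of N] K(3)[rule_format, of _ N] K(3)[rule_format, of N]
    by (simp_all only: min.idem simp_thms)
  have A: "\<forall>i. subspace (A i)" "\<forall>i j. i \<le> j \<longrightarrow> A i \<subseteq> A j" "\<forall>i. A i = A (min i N)"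
    and B: "\<forall>i. subspace (B i)" "\<forall>i j. i \<le> j \<longrightarrow> B i \<subseteq> B j" "\<forall>i. B i = B (min i N)"
    and C: "\<forall>i. subspace (C i)" "\<forall>i j. i \<le> j \<longrightarrow> C i \<subseteq> C j" "\<forall>i. C i = C (min i N)"
    and D: "\<forall>i. subspace (D i)" "\<forall>i j. i \<le> j \<longrightarrow> D i \<subseteq> D j" "\<forall>i. D i = D (min i N)"
    using F(1,2) K(1,2) clamp by (simp_all add: A_def B_def C_def D_def)
  have sK: "subspace KK" and BA: "B i \<subseteq> A i" "D i \<subseteq> C i" and BK: "B N = KK" "D N = KK" "KK \<subseteq> A N" "KK \<subseteq> C N"
    and AC: "A N = C N" for i
    using K(1) KF by (auto simp: A_def B_def C_def D_def KK_def)
  have BKi: "B i \<subseteq> KK" "D i \<subseteq> KK" for i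
    using B(2)[rule_format, of "min i N" N] B(3)[rule_format, of i]
      D(2)[rule_format, of "min i N" N] D(3)[rule_format, of i] BK by simp_all
  have AN: "A i \<subseteq> A N" "C i \<subseteq> C N" for i
    using A(2)[rule_format, of "min i N" N] A(3)[rule_format, of i]
      C(2)[rule_format, of "min i N" N] C(3)[rule_format, of i] by simp_all
  have ind_fin: "finite S" if "independent S" "S \<subseteq> A N" for S
    using independent_span_bound[OF fin(1) that(1)] that(2) fin(2) unfolding A_def by blast

  define P Q where "P i = {a + k |a k. a \<in> A i \<and> k \<in> KK}" and "Q i = {a + k |a k. a \<in> C i \<and> k \<in> KK}" for i
  have PQ: "subspace (P i)" "subspace (Q i)" for i
    unfolding P_def Q_def using A(1) C(1) sK by (simp_all add: subspace_sums)
  have PQm: "\<forall>i j. i \<le> j \<longrightarrow> P i \<subseteq> P j" "\<forall>i j. i \<le> j \<longrightarrow> Q i \<subseteq> Q j"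
    unfolding P_def Q_def using A(2) C(2) by blast+
  have PA: "A i \<subseteq> P i" "C i \<subseteq> Q i" "KK \<subseteq> P i" "KK \<subseteq> Q i" for i
  proof -
    have z: "0 \<in> KK" "0 \<in> A i" "0 \<in> C i" using sK A(1) C(1) subspace_0 by blast+
    have "a = a + 0" "a = 0 + a" for a :: 'b by simp_all
    then show "A i \<subseteq> P i" "C i \<subseteq> Q i" "KK \<subseteq> P i" "KK \<subseteq> Q i"
      unfolding P_def Q_def using z by blast+
  qed
  have PN: "P i \<subseteq> A N" "Q i \<subseteq> A N" for i
    unfolding P_def Q_def using AN AC BK(3) A(1) subspace_add[of "A N"] by blast+
  (* KK is put in front of both flags, so that the common basis contains a basis of KK
     and the remaining elements T are a basis modulo KK. *)
  have "\<exists>X. independent X \<and> X \<subseteq> case_nat KK P (Suc N) \<inter> case_nat KK Q (Suc N) \<and>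
     (\<forall>i\<le>Suc N. \<forall>j\<le>Suc N. case_nat KK P i \<inter> case_nat KK Q j \<subseteq> span (X \<inter> case_nat KK P i \<inter> case_nat KK Q j))"
  proof (rule two_flags)
    show "\<forall>i. subspace (case_nat KK P i)" "\<forall>i. subspace (case_nat KK Q i)"
      using PQ sK by (auto split: nat.split)
    show "\<forall>i j. i \<le> j \<longrightarrow> case_nat KK P i \<subseteq> case_nat KK P j" "\<forall>i j. i \<le> j \<longrightarrow> case_nat KK Q i \<subseteq> case_nat KK Q j"
      using PQm PA(3,4) by (auto split: nat.split)
  qed
  then obtain X where X: "independent X" "X \<subseteq> P N \<inter> Q N"
    and Xs: "\<And>i j. i \<le> Suc N \<Longrightarrow> j \<le> Suc N \<Longrightarrow>
       case_nat KK P i \<inter> case_nat KK Q j \<subseteq> span (X \<inter> case_nat KK P i \<inter> case_nat KK Q j)"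
    by auto
  have XK: "KK \<subseteq> span (X \<inter> KK)"
    using Xs[of 0 0] by (simp add: Int_assoc)
  have Pspan: "P i \<subseteq> span (X \<inter> P i)" if "i \<le> N" for i
  proof -
    have "P i \<inter> Q N \<subseteq> span (X \<inter> P i \<inter> Q N)" using Xs[of "Suc i" "Suc N"] that by simp
    moreover have "P i \<subseteq> Q N" using PN(1)[of i] PA(2)[of N] AC by blast
    moreover have "span (X \<inter> P i \<inter> Q N) \<subseteq> span (X \<inter> P i)" by (intro span_mono) blast
    ultimately show ?thesis by blast
  qed
  have Qspan: "Q i \<subseteq> span (X \<inter> Q i)" if "i \<le> N" for i
  proof -
    have "P N \<inter> Q i \<subseteq> span (X \<inter> P N \<inter> Q i)" using Xs[of "Suc N" "Suc i"] that by simp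
    moreover have "Q i \<subseteq> P N" using PN(2)[of i] PA(1)[of N] by blast
    moreover have "span (X \<inter> P N \<inter> Q i) \<subseteq> span (X \<inter> Q i)" by (intro span_mono) blast
    ultimately show ?thesis by blast
  qed
  have PQmin: "P i = P (min i N)" "Q i = Q (min i N)" for i
    unfolding P_def Q_def using A(3)[rule_format, of i] C(3)[rule_format, of i] by simp_all
  have finX: "finite X" using ind_fin[OF X(1)] X(2) PN by blast

  (* The entries of e into the two flags are the corner of its quadrant. On each arm e is
     represented by an element of A or C that is congruent to it modulo KK. *)
  define T where "T = X - KK"
  define a1 a2 where "a1 = birth P" and "a2 = birth Q"
  have a1: "a1 e \<le> i \<longleftrightarrow> e \<in> P i" and a2: "a2 e \<le> i \<longleftrightarrow> e \<in> Q i" if "e \<in> T" for e i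
    using birth_le_iff[OF PQm(1), of e N i] birth_le_iff[OF PQm(2), of e N i] X(2) that
    by (auto simp: a1_def a2_def T_def)
  have "\<forall>e\<in>T. \<exists>x. x \<in> A (a1 e) \<and> e - x \<in> KK"
  proof
    fix e assume "e \<in> T"
    then have "e \<in> P (a1 e)" using a1 by blast
    then obtain a k where "e = a + k" "a \<in> A (a1 e)" "k \<in> KK" unfolding P_def by blast
    then show "\<exists>x. x \<in> A (a1 e) \<and> e - x \<in> KK" by (intro exI[of _ a]) simp
  qed
  then obtain x1 where x1: "\<forall>e\<in>T. x1 e \<in> A (a1 e) \<and> e - x1 e \<in> KK" by metis
  have "\<forall>e\<in>T. \<exists>x. x \<in> C (a2 e) \<and> e - x \<in> KK"
  proof
    fix e assume "e \<in> T"
    then have "e \<in> Q (a2 e)" using a2 by blast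
    then obtain a k where "e = a + k" "a \<in> C (a2 e)" "k \<in> KK" unfolding Q_def by blast
    then show "\<exists>x. x \<in> C (a2 e) \<and> e - x \<in> KK" by (intro exI[of _ a]) simp
  qed
  then obtain x2 where x2: "\<forall>e\<in>T. x2 e \<in> C (a2 e) \<and> e - x2 e \<in> KK" by metis

  obtain Y where Y: "independent Y" "Y \<subseteq> KK" "\<forall>i. KK \<inter> A i \<subseteq> span (Y \<inter> A i) \<and> B i \<subseteq> span (Y \<inter> B i)"
    using filtered_subspace_basis[OF sK A B BK(1,3)] by blast
  obtain Z where Z: "independent Z" "Z \<subseteq> KK" "\<forall>i. KK \<inter> C i \<subseteq> span (Z \<inter> C i) \<and> D i \<subseteq> span (Z \<inter> D i)"
    using filtered_subspace_basis[OF sK C D BK(2,4)] by blast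
  have finY: "finite Y" "finite Z" using ind_fin Y(1,2) Z(1,2) BK(3) by blast+
  have Yb: "birth A y \<le> i \<longleftrightarrow> y \<in> A i" "birth B y \<le> i \<longleftrightarrow> y \<in> B i" if "y \<in> Y" for y i
    using birth_le_iff[OF A(2), of y N i] birth_le_iff[OF B(2), of y N i] that Y(2) BK by blast+
  have Zb: "birth C y \<le> i \<longleftrightarrow> y \<in> C i" "birth D y \<le> i \<longleftrightarrow> y \<in> D i" if "y \<in> Z" for y i
    using birth_le_iff[OF C(2), of y N i] birth_le_iff[OF D(2), of y N i] that Z(2) BK by blast+
  have bN: "birth B y \<le> N" if "y \<in> Y" for y using Yb(2)[OF that, of N] that Y(2) BK by blast
  have dN: "birth D y \<le> N" if "y \<in> Z" for y using Zb(2)[OF that, of N] that Z(2) BK by blast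
  have aN: "a1 e \<le> N" "a2 e \<le> N" if "e \<in> T" for e
    using a1[OF that] a2[OF that] that X(2) unfolding T_def by blast+

  let ?q = "Inl :: 'b \<Rightarrow> 'b + 'b + 'b"
  let ?v = "\<lambda>y. Inr (Inl y) :: 'b + 'b + 'b" and ?h = "\<lambda>y. Inr (Inr y) :: 'b + 'b + 'b"
  define \<sigma> where "\<sigma> = case_sum (\<lambda>e. Quad (a1 e) (a2 e))
    (case_sum (\<lambda>y. Vert (birth A y) (birth B y)) (\<lambda>y. Horiz (birth C y) (birth D y)))"
  define x where "x i d = (case i of Inl e \<Rightarrow> if N \<le> snd d then x1 e else x2 e | Inr r \<Rightarrow> case_sum (\<lambda>y. y) (\<lambda>y. y) r)"
    for i :: "'b + 'b + 'b" and d :: "nat \<times> nat"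
  (* Basis elements of KK that enter A and B, or C and D, at the same time give an empty strip
     and are left out. *)
  define I where "I = ?q ` T \<union> ?v ` {y \<in> Y. birth A y < birth B y} \<union> ?h ` {y \<in> Z. birth C y < birth D y}"
  have s [simp]: "\<sigma> (Inl e) = Quad (a1 e) (a2 e)" "\<sigma> (Inr (Inl y)) = Vert (birth A y) (birth B y)"
    "\<sigma> (Inr (Inr y)) = Horiz (birth C y) (birth D y)" for e y
    by (simp_all add: \<sigma>_def)
  have xs [simp]: "x (Inl e) d = (if N \<le> snd d then x1 e else x2 e)" "x (Inr (Inl y)) d = y" "x (Inr (Inr y)) d = y" for e y d
    by (simp_all add: x_def)
  have "adapted_at F K I \<sigma> x d" if far: "far N d" for d
  proof -
    obtain i j where d: "d = (i, j)" by (cases d)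
    let ?J = "{t \<in> I. d \<in> region (\<sigma> t)}"
    have zero: "0 \<in> K d'" for d' using K(1) subspace_0 by blast
    have comp: "x t d \<in> F d \<and> (\<forall>e. x t d - (if e + d \<in> region (\<sigma> t) then x t (e + d) else 0) \<in> K (e + d))"
      if t: "t \<in> I" and r: "d \<in> region (\<sigma> t)" for t
    proof -
      consider (q) e where "t = Inl e" "e \<in> T" | (v) y where "t = Inr (Inl y)" "y \<in> Y" | (h) y where "t = Inr (Inr y)" "y \<in> Z"
        using t unfolding I_def by blast
      then show ?thesis
      proof cases
        case q
        have r': "a1 e \<le> i" "a2 e \<le> j" using r by (simp_all add: q d)
        have "x t d \<in> F d"
        proof (cases "N \<le> j")
          case True
          have "x1 e \<in> A i" using x1 q(2) A(2) r'(1) by blast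
          then show ?thesis using True by (simp add: q d F1)
        next
          case False
          then have Ni: "N \<le> i" using far by (simp add: far_def d)
          have "x2 e \<in> C j" using x2 q(2) C(2) r'(2) by blast
          then show ?thesis using False Ni by (simp add: q d F2)
        qed
        moreover have "x t d - (if b + d \<in> region (\<sigma> t) then x t (b + d) else 0) \<in> K (b + d)" for b
        proof -
          obtain b1 b2 where b: "b = (b1, b2)" by (cases b)
          have reg: "b + d \<in> region (\<sigma> t)" using r' by (simp add: q d b)
          show ?thesis
          proof (cases "N \<le> j \<or> \<not> N \<le> b2 + j")
            case True
            then have "x t (b + d) = x t d" by (auto simp: q d b)
            then show ?thesis using reg zero by simp
          next
            case False
            then have Ni: "N \<le> i" "N \<le> b2 + j" "\<not> N \<le> j" using far by (auto simp: far_def d)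
            (* The monomial leads from the horizontal arm into the middle, where the representative
               changes from x2 e to x1 e. *)
            have "K (b + d) = D (b2 + j)" using Ni(1) by (simp add: d b F2)
            also have "\<dots> = D N" using D(3)[rule_format, of "b2 + j"] Ni(2) by (simp add: min_absorb2)
            finally have Kd: "K (b + d) = KK" using BK by simp
            have "e - x1 e \<in> KK" "e - x2 e \<in> KK" using x1 x2 q(2) by blast+
            then have "(e - x1 e) - (e - x2 e) \<in> KK" by (rule subspace_diff[OF sK])
            then have "x2 e - x1 e \<in> KK" by simp
            then show ?thesis using reg Kd Ni by (simp add: q d b)
          qed
        qed
        ultimately show ?thesis by blast
      next
        case v
        have r': "birth A y \<le> i" "i < birth B y" using r by (simp_all add: v d)
        then have Nj: "N \<le> j" using far bN[OF v(2)] by (simp add: far_def d)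
        have "x t d \<in> F d" using r'(1) Yb(1)[OF v(2)] Nj by (simp add: v d F1)
        moreover have "x t d - (if b + d \<in> region (\<sigma> t) then x t (b + d) else 0) \<in> K (b + d)" for b
        proof -
          obtain b1 b2 where b: "b = (b1, b2)" by (cases b)
          have Kd: "K (b + d) = B (b1 + i)" using Nj by (simp add: d b F1)
          show ?thesis
          proof (cases "b + d \<in> region (\<sigma> t)")
            case True
            then show ?thesis using zero by (simp add: v)
          next
            case False
            then have "birth B y \<le> b1 + i" using r'(1) by (simp add: v d b)
            then have "y \<in> B (b1 + i)" using Yb(2)[OF v(2)] by blast
            then show ?thesis unfolding if_not_P[OF False] using Kd by (simp add: v)
          qed
        qed
        ultimately show ?thesis by blast
      next
        case h
        have r': "birth C y \<le> j" "j < birth D y" using r by (simp_all add: h d)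
        then have Ni: "N \<le> i" using far dN[OF h(2)] by (simp add: far_def d)
        have "x t d \<in> F d" using r'(1) Zb(1)[OF h(2)] Ni by (simp add: h d F2)
        moreover have "x t d - (if b + d \<in> region (\<sigma> t) then x t (b + d) else 0) \<in> K (b + d)" for b
        proof -
          obtain b1 b2 where b: "b = (b1, b2)" by (cases b)
          have Kd: "K (b + d) = D (b2 + j)" using Ni by (simp add: d b F2)
          show ?thesis
          proof (cases "b + d \<in> region (\<sigma> t)")
            case True
            then show ?thesis using zero by (simp add: h)
          next
            case False
            then have "birth D y \<le> b2 + j" using r'(1) by (simp add: h d b)
            then have "y \<in> D (b2 + j)" using Zb(2)[OF h(2)] by blast
            then show ?thesis unfolding if_not_P[OF False] using Kd by (simp add: h)
          qed
        qed
        ultimately show ?thesis by blast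
      qed
    qed
    have basis: "(\<forall>z\<in>F d. \<exists>c. z - (\<Sum>t\<in>?J. c t *s x t d) \<in> K d) \<and>
      (\<forall>c. (\<Sum>t\<in>?J. c t *s x t d) \<in> K d \<longrightarrow> (\<forall>t\<in>?J. c t = 0))"
    proof (cases "N \<le> j")
      case True
      let ?T = "{e \<in> T. a1 e \<le> i}"
      have T': "e \<in> P i" "a2 e \<le> j" if "e \<in> ?T" for e using that a1 aN(2)[of e] True by auto
      have J: "?J = ?q ` ?T \<union> ?v ` (Y \<inter> A i - B i)"
      proof (intro equalityI subsetI)
        fix t assume "t \<in> ?J"
        then show "t \<in> ?q ` ?T \<union> ?v ` (Y \<inter> A i - B i)"
          using Yb dN True unfolding I_def by (fastforce simp: d not_le[symmetric])
      next
        fix t assume "t \<in> ?q ` ?T \<union> ?v ` (Y \<inter> A i - B i)"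
        then consider (q) e where "t = Inl e" "e \<in> ?T" | (v) y where "t = Inr (Inl y)" "y \<in> Y \<inter> A i - B i" by blast
        then show "t \<in> ?J"
        proof cases
          case q
          then show ?thesis using T'[OF q(2)] by (simp add: I_def d)
        next
          case v
          then have "birth A y \<le> i" "i < birth B y" using Yb[of y i] by (auto simp: not_le[symmetric])
          then show ?thesis using v by (simp add: I_def d image_iff)
        qed
      qed
      have span: "A i \<subseteq> span (?T \<union> (X \<inter> KK))"
      proof -
        have "A i \<subseteq> P i" by (rule PA)
        also have "\<dots> \<subseteq> span (X \<inter> P i)" using Pspan[of "min i N"] PQmin[of i] by simp
        also have "\<dots> \<subseteq> span (?T \<union> (X \<inter> KK))" using a1 by (intro span_mono) (auto simp: T_def)
        finally show ?thesis .
      qed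
      have fg: "inj ?q" "inj ?v" "\<forall>a b. ?q a \<noteq> ?v b" by (auto intro: injI)
      have wT: "\<forall>e\<in>?T. x1 e \<in> A i \<and> e - x1 e \<in> KK" using x1 A(2) by blast
      have w: "\<forall>e\<in>?T. x (?q e) d = x1 e" "\<forall>y\<in>Y \<inter> A i - B i. x (?v y) d = y" using True by (simp_all add: d)
      have TX: "?T \<subseteq> X - KK" by (auto simp: T_def)
      note hb = half_basis[OF sK A(1)[rule_format, of i] B(1)[rule_format, of i] BA(1) BKi(1) finX X(1) XK
          TX span wT finY(1) Y(1,2) Y(3)[rule_format, THEN conjunct1] Y(3)[rule_format, THEN conjunct2] fg, where w = "\<lambda>t. x t d", OF w J]
      show ?thesis using hb F1[OF True, of i] unfolding d by simp
    next
      case False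
      then have Ni: "N \<le> i" using far by (simp add: far_def d)
      let ?T = "{e \<in> T. a2 e \<le> j}"
      have T': "e \<in> Q j" "a1 e \<le> i" if "e \<in> ?T" for e using that a2 aN(1)[of e] Ni by auto
      have J: "?J = ?q ` ?T \<union> ?h ` (Z \<inter> C j - D j)"
      proof (intro equalityI subsetI)
        fix t assume "t \<in> ?J"
        then show "t \<in> ?q ` ?T \<union> ?h ` (Z \<inter> C j - D j)"
          using Zb bN Ni unfolding I_def by (fastforce simp: d not_le[symmetric])
      next
        fix t assume "t \<in> ?q ` ?T \<union> ?h ` (Z \<inter> C j - D j)"
        then consider (q) e where "t = Inl e" "e \<in> ?T" | (h) y where "t = Inr (Inr y)" "y \<in> Z \<inter> C j - D j" by blast
        then show "t \<in> ?J"
        proof cases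
          case q
          then show ?thesis using T'[OF q(2)] by (simp add: I_def d)
        next
          case h
          then have "birth C y \<le> j" "j < birth D y" using Zb[of y j] by (auto simp: not_le[symmetric])
          then show ?thesis using h by (simp add: I_def d image_iff)
        qed
      qed
      have span: "C j \<subseteq> span (?T \<union> (X \<inter> KK))"
      proof -
        have "C j \<subseteq> Q j" by (rule PA)
        also have "\<dots> \<subseteq> span (X \<inter> Q j)" using Qspan[of "min j N"] PQmin[of j] by simp
        also have "\<dots> \<subseteq> span (?T \<union> (X \<inter> KK))" using a2 by (intro span_mono) (auto simp: T_def)
        finally show ?thesis .
      qed
      have fg: "inj ?q" "inj ?h" "\<forall>a b. ?q a \<noteq> ?h b" by (auto intro: injI)
      have wT: "\<forall>e\<in>?T. x2 e \<in> C j \<and> e - x2 e \<in> KK" using x2 C(2) by blast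
      have w: "\<forall>e\<in>?T. x (?q e) d = x2 e" "\<forall>y\<in>Z \<inter> C j - D j. x (?h y) d = y" using False by (simp_all add: d)
      have TX: "?T \<subseteq> X - KK" by (auto simp: T_def)
      note hb = half_basis[OF sK C(1)[rule_format, of j] D(1)[rule_format, of j] BA(2) BKi(2) finX X(1) XK
          TX span wT finY(2) Z(1,2) Z(3)[rule_format, THEN conjunct1] Z(3)[rule_format, THEN conjunct2] fg, where w = "\<lambda>t. x t d", OF w J]
      show ?thesis using hb F2[OF Ni, of j] unfolding d by simp
    qed
    show ?thesis unfolding adapted_at_def using comp basis by blast
  qed
  moreover have "finite I" using finX finY by (simp add: I_def T_def)
  moreover have "\<forall>i\<in>I. valid (\<sigma> i)" unfolding I_def by auto
  ultimately show ?thesis by blast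
qed

end

section \<open>Existence of a frame\<close>

definition fscale :: "'k::field \<Rightarrow> ('a \<Rightarrow> 'k) \<Rightarrow> 'a \<Rightarrow> 'k" where
  "fscale a c = (\<lambda>x. a * c x)"

lemma vector_space_fscale: "vector_space (fscale :: 'k::field \<Rightarrow> ('a \<Rightarrow> 'k) \<Rightarrow> 'a \<Rightarrow> 'k)"
  by unfold_locales (auto simp: fscale_def fun_eq_iff algebra_simps)

lemma sum_fun_apply: "(\<Sum>i\<in>A. f i) x = (\<Sum>i\<in>A. f i x :: 'k::field)"
  by (induction A rule: infinite_finite_induct) auto

definition unit_fun :: "'a \<Rightarrow> 'a \<Rightarrow> 'k::field" where
  "unit_fun g = (\<lambda>x. if x = g then 1 else 0)"

lemma finite_support_in_span:
  fixes c :: "'a \<Rightarrow> 'k::field"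
  assumes "finite G" "\<forall>g. c g \<noteq> 0 \<longrightarrow> g \<in> G"
  shows "c \<in> module.span fscale (unit_fun ` G)"
proof -
  interpret V: vector_space "fscale :: 'k \<Rightarrow> ('a \<Rightarrow> 'k) \<Rightarrow> 'a \<Rightarrow> 'k" by (rule vector_space_fscale)
  have "c = (\<Sum>g\<in>G. fscale (c g) (unit_fun g))"
  proof
    fix x
    have "(\<Sum>g\<in>G. fscale (c g) (unit_fun g) x) = (\<Sum>g\<in>G. if g = x then c x else 0)"
      by (rule sum.cong) (auto simp: fscale_def unit_fun_def)
    also have "\<dots> = c x" using assms by auto
    finally show "c x = (\<Sum>g\<in>G. fscale (c g) (unit_fun g)) x" by (simp add: sum_fun_apply)
  qed
  moreover have "(\<Sum>g\<in>G. fscale (c g) (unit_fun g)) \<in> V.span (unit_fun ` G)"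
    by (intro V.span_sum V.span_scale V.span_base) auto
  ultimately show ?thesis by simp
qed

text \<open>
  For homogeneous generators \<open>G\<close> with bidegrees \<open>\<delta>\<close>, the space \<open>F\<^sub>d\<close> consists of the coefficient
  functions on the generators of bidegree at most \<open>d\<close>. Evaluation \<open>ev\<^sub>d\<close> multiplies each generator by
  the monomial that brings it to bidegree \<open>d\<close>. It maps \<open>F\<^sub>d\<close> onto \<open>M\<^sub>d\<close> with kernel \<open>K\<^sub>d\<close>, and
  monomials act as the inclusions of these spaces in one another.
\<close>

lemma (in fg_kst_module) frame_exists:
  "\<exists>(I :: (('m \<Rightarrow> 'k) + ('m \<Rightarrow> 'k) + ('m \<Rightarrow> 'k)) set) \<sigma> v.
     (\<forall>i\<in>I. valid (\<sigma> i)) \<and> frame M I (\<lambda>i. region (\<sigma> i)) v"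
proof -
  interpret V: vector_space "fscale :: 'k \<Rightarrow> ('m \<Rightarrow> 'k) \<Rightarrow> 'm \<Rightarrow> 'k" by (rule vector_space_fscale)
  obtain G \<delta> where G: "finite G" "\<And>g. g \<in> G \<Longrightarrow> g \<in> piece M (\<delta> g)" "carrier M \<subseteq> monomial_span M G"
    using finitely_generated_homogeneous[OF fin_gen] by blast
  have Gc: "g \<in> carrier M" if "g \<in> G" for g using G(2)[OF that] by blast
  define F where "F d = {c :: 'm \<Rightarrow> 'k. \<forall>g. c g \<noteq> 0 \<longrightarrow> g \<in> G \<and> \<delta> g \<le> d}" for d
  define ev where "ev d c = (\<Oplus>g\<in>{g \<in> G. \<delta> g \<le> d}. mact M (d - \<delta> g) (c g) g)" for d and c :: "'m \<Rightarrow> 'k"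
  define K where "K d = {c \<in> F d. ev d c = \<zero>}" for d
  have shift: "(d - \<delta>') + \<delta>' = d" "(e + d) - \<delta>' = e + (d - \<delta>')" if "\<delta>' \<le> d" for d e \<delta>' :: "nat \<times> nat"
    using that by (cases d; cases e; cases \<delta>'; simp)+
  have ev_piece: "ev d c \<in> piece M d" for d c
    unfolding ev_def
  proof (rule finsum_in[OF M.abelian_monoid_axioms _ zero_piece add_piece])
    fix g assume "g \<in> {g \<in> G. \<delta> g \<le> d}"
    then show "mact M (d - \<delta> g) (c g) g \<in> piece M d"
      using act_piece[OF G(2), of g "d - \<delta> g" "c g"] shift(1)[of "\<delta> g" d] by simp
  qed (use G(1) piece_closed in auto)
  have ev_add: "ev d (c + c') = ev d c \<oplus> ev d c'" for d c c'
  proof -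
    have "ev d (c + c') = (\<Oplus>g\<in>{g \<in> G. \<delta> g \<le> d}. mact M (d - \<delta> g) (c g) g \<oplus> mact M (d - \<delta> g) (c' g) g)"
      unfolding ev_def by (rule M.finsum_cong') (use Gc act_add_left in auto)
    also have "\<dots> = ev d c \<oplus> ev d c'"
      unfolding ev_def by (rule M.finsum_addf) (use Gc in auto)
    finally show ?thesis .
  qed
  have ev_scale: "ev d (fscale a c) = mact M 0 a (ev d c)" for d a c
  proof -
    have "mact M 0 a (ev d c) = (\<Oplus>g\<in>{g \<in> G. \<delta> g \<le> d}. mact M 0 a (mact M (d - \<delta> g) (c g) g))"
      unfolding ev_def by (rule finsum_smult_ldistr) (use G(1) Gc in auto)
    also have "\<dots> = ev d (fscale a c)"
      unfolding ev_def by (rule M.finsum_cong') (use Gc act_act in \<open>auto simp: fscale_def\<close>)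
    finally show ?thesis ..
  qed
  have ev_act: "ev (e + d) c = mact M e 1 (ev d c)" if c: "c \<in> F d" for e d c
  proof -
    have le: "\<delta>' \<le> e + d" if "\<delta>' \<le> d" for \<delta>' using that by (cases d; cases e; cases \<delta>'; simp)
    have "mact M e 1 (ev d c) = (\<Oplus>g\<in>{g \<in> G. \<delta> g \<le> d}. mact M e 1 (mact M (d - \<delta> g) (c g) g))"
      unfolding ev_def by (rule finsum_smult_ldistr) (use G(1) Gc in auto)
    also have "\<dots> = ev (e + d) c"
      unfolding ev_def
    proof (rule M.add.finprod_mono_neutral_cong_left)
      fix g assume "g \<in> {g \<in> G. \<delta> g \<le> e + d} - {g \<in> G. \<delta> g \<le> d}"
      then have "g \<in> G" "c g = 0" using c by (auto simp: F_def)
      then show "mact M (e + d - \<delta> g) (c g) g = \<zero>" using Gc by simp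
    next
      fix g assume "g \<in> {g \<in> G. \<delta> g \<le> d}"
      then show "mact M e 1 (mact M (d - \<delta> g) (c g) g) = mact M (e + d - \<delta> g) (c g) g"
        using act_act[of g e 1 "d - \<delta> g" "c g"] Gc shift(2)[of "\<delta> g" d e] by (simp add: add.assoc)
    qed (use G(1) Gc in \<open>auto intro: le\<close>)
    finally show ?thesis ..
  qed
  have ev_zero: "ev d 0 = \<zero>" for d
    unfolding ev_def by (rule M.add.finprod_one_eqI) (use Gc in auto)
  have F0: "0 \<in> F d" for d by (simp add: F_def)
  have Fadd: "c + c' \<in> F d" if "c \<in> F d" "c' \<in> F d" for c c' d
  proof -
    have "g \<in> G \<and> \<delta> g \<le> d" if "c g + c' g \<noteq> 0" for g
      using that \<open>c \<in> F d\<close> \<open>c' \<in> F d\<close> unfolding F_def by (cases "c g = 0") auto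
    then show ?thesis by (simp add: F_def)
  qed
  have Fscale: "fscale a c \<in> F d" if "c \<in> F d" for a c d
    using that by (auto simp: F_def fscale_def)
  have subF: "V.subspace (F d)" for d
    by (rule V.subspaceI[OF F0 Fadd Fscale])
  have subK: "V.subspace (K d)" for d
  proof (rule V.subspaceI)
    show "0 \<in> K d" using F0 ev_zero by (simp add: K_def)
    show "c + c' \<in> K d" if "c \<in> K d" "c' \<in> K d" for c c'
      using that Fadd[of c d c'] by (simp add: K_def ev_add)
    show "fscale a c \<in> K d" if "c \<in> K d" for a c
      using that Fscale[of c d a] by (simp add: K_def ev_scale)
  qed
  have surj: "\<exists>c\<in>F d. x = ev d c" if x: "x \<in> piece M d" for x d
  proof -
    have Gs: "G \<subseteq> carrier M" using Gc by blast
    have "\<exists>c\<in>F d. component M y d = ev d c" if "y \<in> monomial_span M G" for y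
      using that
    proof induction
      case zero
      then show ?case by (intro bexI[OF _ F0]) (simp only: component_zero ev_zero)
    next
      case (step b y e a)
      then obtain c where c: "c \<in> F d" "component M y d = ev d c" by blast
      have bc: "b \<in> carrier M" "y \<in> carrier M" using step Gc monomial_span_closed[OF Gs] by blast+
      have comp: "component M (mact M e a b \<oplus> y) d = (if d = e + \<delta> b then mact M e a b else \<zero>) \<oplus> ev d c"
        using component_add[of "mact M e a b" y d] bc component_homogeneous[OF act_piece[OF G(2)[OF step(1)], of e a], of d] c(2)
        by simp
      show ?case
      proof (cases "d = e + \<delta> b")
        case True
        let ?u = "\<lambda>g. if g = b then a else 0"
        have le: "\<delta> b \<le> d" unfolding True by (cases e; cases "\<delta> b"; simp)
        have "ev d ?u = (\<Oplus>g\<in>{g \<in> G. \<delta> g \<le> d}. if b = g then mact M e a b else \<zero>)"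
          unfolding ev_def using Gc True by (intro M.finsum_cong') auto
        also have "\<dots> = mact M e a b"
          by (rule M.finsum_singleton) (use G(1) le step(1) bc in auto)
        finally have "component M (mact M e a b \<oplus> y) d = ev d (?u + c)"
          using comp True ev_add by simp
        moreover have "?u \<in> F d" using le step(1) by (simp add: F_def)
        ultimately show ?thesis using Fadd c(1) by blast
      next
        case False
        then have "component M (mact M e a b \<oplus> y) d = ev d c"
          using comp piece_closed[OF ev_piece] by simp
        then show ?thesis using c(1) by blast
      qed
    qed
    then obtain c where "c \<in> F d" "component M x d = ev d c"
      using G(3) piece_closed[OF x] by blast
    then show ?thesis using component_homogeneous[OF x, of d] by auto
  qed
  have monoF: "F d \<subseteq> F d'" if "d \<le> d'" for d d'
    using that unfolding F_def by (blast intro: order_trans)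
  have monoK: "K d \<subseteq> K d'" if "d \<le> d'" for d d'
  proof
    fix c assume c: "c \<in> K d"
    have d': "d' = (d' - d) + d" using shift(1)[OF that] by simp
    have "ev ((d' - d) + d) c = \<zero>" using ev_act[of c d "d' - d"] c by (simp add: K_def)
    then show "c \<in> K d'" using c monoF[OF that] d' by (auto simp: K_def)
  qed
  let ?\<Delta> = "unit_fun ` G :: ('m \<Rightarrow> 'k) set"
  have fin: "finite ?\<Delta>" "\<forall>d. F d \<subseteq> V.span ?\<Delta>"
    using G(1) finite_support_in_span[OF G(1)] by (auto simp: F_def)
  have KF: "\<forall>d. K d \<subseteq> F d" by (auto simp: K_def)
  obtain N1 where N1: "\<forall>n\<ge>N1. \<forall>i j. F (i, j) = F (min i n, min j n)"
    using V.subspaces_stable[of F, OF _ _ fin] subF monoF by blast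
  obtain N2 where N2: "\<forall>n\<ge>N2. \<forall>i j. K (i, j) = K (min i n, min j n)"
    using V.subspaces_stable[of K, OF _ _ fin(1)] subK monoK KF fin(2) by blast
  let ?N = "max N1 N2"
  have "\<forall>i j. F (i, j) = F (min i ?N, min j ?N)" "\<forall>i j. K (i, j) = K (min i ?N, min j ?N)"
    using N1 N2 max.cobounded1 max.cobounded2 by blast+
  then obtain I :: "(('m \<Rightarrow> 'k) + ('m \<Rightarrow> 'k) + ('m \<Rightarrow> 'k)) set" and \<sigma> x
    where I: "finite I" "\<forall>i\<in>I. valid (\<sigma> i)" "\<forall>d. far ?N d \<longrightarrow> V.adapted_at F K I \<sigma> x d"
    using V.adapted_decomposition[of F ?N K, OF _ _ _ _ _ _ KF fin] subF subK monoF monoK by metis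
  define v where "v i d = ev d (x i d)" for i d
  have "frame_at M I (\<lambda>i. region (\<sigma> i)) v d" if far: "far ?N d" for d
  proof -
    let ?J = "{i \<in> I. d \<in> region (\<sigma> i)}"
    note ad = I(3)[rule_format, OF far, unfolded V.adapted_at_def]
    have xF: "x i d \<in> F d" and xK: "x i d - (if e + d \<in> region (\<sigma> i) then x i (e + d) else 0) \<in> K (e + d)"
      if "i \<in> I" "d \<in> region (\<sigma> i)" for i e
      using ad that by blast+
    have ev_eq: "ev d' c = ev d' c'" if "c - c' \<in> K d'" for c c' d'
    proof -
      have "ev d' ((c - c') + c') = ev d' c'"
        unfolding ev_add using that piece_closed[OF ev_piece] by (simp add: K_def)
      then show ?thesis by simp
    qed
    have act: "mact M e a (v i d) = (if e + d \<in> region (\<sigma> i) then mact M 0 a (v i (e + d)) else \<zero>)"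
      if i: "i \<in> I" "d \<in> region (\<sigma> i)" for i e a
    proof -
      have "mact M e a (v i d) = mact M 0 a (mact M e 1 (v i d))"
        using act_act[of "v i d" 0 a e 1] piece_closed[OF ev_piece] by (simp add: v_def)
      also have "mact M e 1 (v i d) = ev (e + d) (x i d)"
        using ev_act[OF xF[OF i]] by (simp add: v_def)
      also have "\<dots> = ev (e + d) (if e + d \<in> region (\<sigma> i) then x i (e + d) else 0)"
        by (rule ev_eq[OF xK[OF i]])
      finally show ?thesis by (simp add: v_def ev_zero)
    qed
    have lc: "lin_comb M S c (\<lambda>i. v i d) = ev d (\<Sum>i\<in>S. fscale (c i) (x i d))" if "finite S" for S c
      using that
    proof (induction S)
      case empty
      then show ?case by (simp only: lin_comb_def M.finsum_empty sum.empty ev_zero)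
    next
      case (insert s S)
      have "lin_comb M (insert s S) c (\<lambda>i. v i d) = mact M 0 (c s) (v s d) \<oplus> lin_comb M S c (\<lambda>i. v i d)"
        unfolding lin_comb_def using insert(1,2) piece_closed[OF ev_piece] by (intro M.finsum_insert) (auto simp: v_def)
      also have "\<dots> = ev d (fscale (c s) (x s d)) \<oplus> ev d (\<Sum>i\<in>S. fscale (c i) (x i d))"
        unfolding insert.IH by (simp only: ev_scale v_def)
      also have "\<dots> = ev d (fscale (c s) (x s d) + (\<Sum>i\<in>S. fscale (c i) (x i d)))"
        by (rule ev_add[symmetric])
      finally show ?case unfolding sum.insert[OF insert(1,2)] .
    qed
    have finJ: "finite ?J" using I(1) by simp
    have sF: "(\<Sum>i\<in>?J. fscale (c i) (x i d)) \<in> F d" for c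
      using xF by (intro V.subspace_sum[OF subF] V.subspace_scale[OF subF]) blast
    have span: "\<exists>c. y = lin_comb M ?J c (\<lambda>i. v i d)" if y: "y \<in> piece M d" for y
    proof -
      obtain z where z: "z \<in> F d" "y = ev d z" using surj[OF y] by blast
      obtain c where "z - (\<Sum>i\<in>?J. fscale (c i) (x i d)) \<in> K d" using ad z(1) by blast
      then have "y = lin_comb M ?J c (\<lambda>i. v i d)" using ev_eq lc[OF finJ] z(2) by simp
      then show ?thesis by blast
    qed
    have indep: "\<forall>i\<in>?J. c i = 0" if "lin_comb M ?J c (\<lambda>i. v i d) = \<zero>" for c
    proof -
      have "(\<Sum>i\<in>?J. fscale (c i) (x i d)) \<in> K d" using that lc[OF finJ] sF by (simp add: K_def)
      then show ?thesis using ad by blast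
    qed
    show ?thesis
      unfolding frame_at_def using act span indep ev_piece by (simp add: v_def)
  qed
  then have "frame M I (\<lambda>i. region (\<sigma> i)) v"
    unfolding frame_def eventually_far using I(1) by blast
  then show ?thesis using I(2) by blast
qed

context graded_kst_module
begin

lemma lin_comb_reindex:
  assumes "inj_on h J" "\<And>j. j \<in> J \<Longrightarrow> w (h j) \<in> carrier M"
  shows "lin_comb M (h ` J) c w = lin_comb M J (\<lambda>j. c (h j)) (\<lambda>j. w (h j))"
  unfolding lin_comb_def by (rule M.add.finprod_reindex) (use assms in auto)

lemma frame_reindex:
  assumes frame: "frame M I D v" and h: "bij_betw h J I"
  shows "frame M J (\<lambda>j. D (h j)) (\<lambda>j. v (h j))"
proof -
  have fin: "finite J" using assms bij_betw_finite unfolding frame_def by blast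
  have inj: "inj_on h J" and img: "h ` J = I" using h by (auto simp: bij_betw_def)
  have "frame_at M J (\<lambda>j. D (h j)) (\<lambda>j. v (h j)) d" if f: "frame_at M I D v d" for d
  proof -
    let ?I = "{i \<in> I. d \<in> D i}" and ?J = "{j \<in> J. d \<in> D (h j)}"
    have hJ: "h ` ?J = ?I" and injJ: "inj_on h ?J" using img inj by (auto simp: inj_on_def)
    have f1: "i \<in> I \<Longrightarrow> d \<in> D i \<Longrightarrow> v i d \<in> piece M d"
      and f2: "i \<in> I \<Longrightarrow> d \<in> D i \<Longrightarrow> mact M e a (v i d) = (if e + d \<in> D i then mact M 0 a (v i (e + d)) else \<zero>)"
      and f3: "x \<in> piece M d \<Longrightarrow> \<exists>c. x = lin_comb M ?I c (\<lambda>i. v i d)"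
      and f4: "lin_comb M ?I c (\<lambda>i. v i d) = \<zero> \<Longrightarrow> \<forall>i\<in>?I. c i = 0" for i e a c x
      using f unfolding frame_at_def by blast+
    have hI: "h j \<in> I" if "j \<in> J" for j using img that by blast
    have w: "v (h j) d \<in> carrier M" if "j \<in> ?J" for j using f1 hI that piece_closed by blast
    have lc: "lin_comb M ?I c (\<lambda>i. v i d) = lin_comb M ?J (\<lambda>j. c (h j)) (\<lambda>j. v (h j) d)" for c
      using lin_comb_reindex[OF injJ, of "\<lambda>i. v i d" c] w unfolding hJ by blast
    show ?thesis
      unfolding frame_at_def
    proof (intro conjI ballI allI impI)
      fix x assume "x \<in> piece M d"
      then obtain c where "x = lin_comb M ?I c (\<lambda>i. v i d)" using f3 by blast
      then show "\<exists>c. x = lin_comb M ?J c (\<lambda>j. v (h j) d)" unfolding lc by blast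
    next
      fix c j assume c: "lin_comb M ?J c (\<lambda>j. v (h j) d) = \<zero>" and j: "j \<in> ?J"
      let ?c = "\<lambda>i. c (the_inv_into J h i)"
      have ch: "?c (h j) = c j" if "j \<in> ?J" for j using that inj by (simp add: the_inv_into_f_f)
      have "lin_comb M ?I ?c (\<lambda>i. v i d) = lin_comb M ?J c (\<lambda>j. v (h j) d)"
        unfolding lc by (rule lin_comb_cong) (use w ch in blast)+
      then have "\<forall>i\<in>?I. ?c i = 0" using f4 c by simp
      moreover have "h j \<in> ?I" using j hI by blast
      ultimately show "c j = 0" using ch[OF j] by simp
    qed (use f1 f2 hI in blast)+
  qed
  then show ?thesis
    using frame fin unfolding frame_def by (blast intro: eventually_mono)
qed

end

section \<open>Uniqueness of the shapes\<close>

lemma (in vector_space) independent_family: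
  fixes r :: "'c \<Rightarrow> 'b"
  assumes "finite L" and indep: "\<forall>u. (\<Sum>l\<in>L. u l *s r l) = 0 \<longrightarrow> (\<forall>l\<in>L. u l = 0)"
  shows "inj_on r L \<and> independent (r ` L)"
proof
  show inj: "inj_on r L"
  proof (rule inj_onI, rule ccontr)
    fix l l' assume l: "l \<in> L" "l' \<in> L" "r l = r l'" "l \<noteq> l'"
    define u :: "'c \<Rightarrow> 'a" where "u i = (if i = l then 1 else if i = l' then - 1 else 0)" for i
    have "(\<Sum>i\<in>L. u i *s r i) = (\<Sum>i\<in>{l, l'}. u i *s r i)"
      using assms(1) l by (intro sum.mono_neutral_right) (auto simp: u_def)
    also have "\<dots> = 0" using l by (simp add: u_def)
    finally have "\<forall>i\<in>L. u i = 0" by (rule mp[OF spec[OF indep, of u]])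
    then show False using l(1) by (auto simp: u_def)
  qed
  show "independent (r ` L)"
  proof (rule independent_if_scalars_zero)
    fix f x assume zero: "(\<Sum>x\<in>r ` L. f x *s x) = 0" and x: "x \<in> r ` L"
    have "(\<Sum>l\<in>L. f (r l) *s r l) = 0" using zero by (simp add: sum.reindex[OF inj])
    then have "\<forall>l\<in>L. f (r l) = 0" by (rule mp[OF spec[OF indep, of "\<lambda>l. f (r l)"]])
    then show "f x = 0" using x by blast
  qed (use assms(1) in simp)
qed

text \<open>
  The coordinates of an independent family with respect to a spanning family \<open>w\<close> are independent
  functions on the index set of \<open>w\<close>.
\<close>

lemma (in graded_kst_module) independent_card_le:
  fixes w :: "'i \<Rightarrow> 'm" and w' :: "'j \<Rightarrow> 'm"
  assumes fin: "finite J" "finite L" and w: "\<And>j. j \<in> J \<Longrightarrow> w j \<in> carrier M" "\<And>l. l \<in> L \<Longrightarrow> w' l \<in> carrier M"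
    and indep: "\<forall>c. lin_comb M L c w' = \<zero> \<longrightarrow> (\<forall>l\<in>L. c l = 0)"
    and span: "\<forall>l\<in>L. \<exists>c. w' l = lin_comb M J c w"
  shows "card L \<le> card J"
proof -
  interpret V: vector_space "fscale :: 'k \<Rightarrow> ('i \<Rightarrow> 'k) \<Rightarrow> 'i \<Rightarrow> 'k" by (rule vector_space_fscale)
  obtain C where C: "\<forall>l\<in>L. w' l = lin_comb M J (C l) w" using span by metis
  define r where "r l = (\<lambda>j. if j \<in> J then C l j else 0)" for l
  have lc: "lin_comb M S u w' = lin_comb M J (\<lambda>j. \<Sum>l\<in>S. u l * C l j) w" if "finite S" "S \<subseteq> L" for S u
    using that
  proof (induction S)
    case empty
    have "lin_comb M J (\<lambda>j. \<Sum>l\<in>{}. u l * C l j) w = \<zero>" by (rule lin_comb_zero) (use w in auto)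
    moreover have "lin_comb M {} u w' = \<zero>" by (simp add: lin_comb_def)
    ultimately show ?case by simp
  next
    case (insert s S)
    have s: "s \<in> L" "S \<subseteq> L" using insert by auto
    have "lin_comb M (insert s S) u w' = mact M 0 (u s) (w' s) \<oplus> lin_comb M S u w'"
      unfolding lin_comb_def using insert(1,2) w(2) s by (intro M.finsum_insert) auto
    also have "mact M 0 (u s) (w' s) = lin_comb M J (\<lambda>j. u s * C s j) w"
      using C s(1) lin_comb_scale[OF fin(1) w(1), where a = "u s" and c = "C s"] by simp
    also have "lin_comb M S u w' = lin_comb M J (\<lambda>j. \<Sum>l\<in>S. u l * C l j) w" using insert s by simp
    also have "lin_comb M J (\<lambda>j. u s * C s j) w \<oplus> \<dots> = lin_comb M J (\<lambda>j. u s * C s j + (\<Sum>l\<in>S. u l * C l j)) w"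
      by (rule lin_comb_add[symmetric]) (rule w(1))
    finally show ?case using insert(1,2) by simp
  qed
  have "\<forall>u. (\<Sum>l\<in>L. fscale (u l) (r l)) = 0 \<longrightarrow> (\<forall>l\<in>L. u l = 0)"
  proof (intro allI impI)
    fix u assume zero: "(\<Sum>l\<in>L. fscale (u l) (r l)) = 0"
    have "(\<Sum>l\<in>L. u l * C l j) = 0" if "j \<in> J" for j
      using fun_cong[OF zero, of j] that by (simp add: sum_fun_apply fscale_def r_def)
    then have "lin_comb M L u w' = \<zero>"
      unfolding lc[OF fin(2) order_refl] by (intro lin_comb_zero) (use w in auto)
    then show "\<forall>l\<in>L. u l = 0" using indep by blast
  qed
  then have ind: "inj_on r L" "V.independent (r ` L)"
    using V.independent_family[OF fin(2), of r] by blast+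
  have "r l \<in> V.span (unit_fun ` J)" for l
    by (rule finite_support_in_span[OF fin(1)]) (simp add: r_def)
  then have "r ` L \<subseteq> V.span (unit_fun ` J)" by blast
  then have "card (r ` L) \<le> card (unit_fun ` J :: ('i \<Rightarrow> 'k) set)"
    using V.independent_span_bound[OF _ ind(2)] fin(1) by blast
  also have "\<dots> \<le> card J" using fin(1) by (rule card_image_le)
  finally show ?thesis using card_image[OF ind(1)] by simp
qed

text \<open>
  The vectors \<open>v\<^sub>i(r)\<close> with \<open>p, q, r \<in> D\<^sub>i\<close> form a basis of \<open>im(M\<^sub>p \<rightarrow> M\<^sub>r) \<inter> im(M\<^sub>q \<rightarrow> M\<^sub>r)\<close>: a vector in
  the first image has no coordinates outside the \<open>D\<^sub>i\<close> that contain \<open>p\<close>, and one in the second image has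
  none outside those that contain \<open>q\<close>. The independent vectors \<open>v'\<^sub>i(r)\<close> of a second frame lie in the
  same space.
\<close>

lemma (in graded_kst_module) frame_count_le:
  fixes D :: "'i \<Rightarrow> (nat \<times> nat) set" and D' :: "'j \<Rightarrow> (nat \<times> nat) set"
  assumes fin: "finite I" "finite I'"
    and p: "frame_at M I D v p" "frame_at M I' D' v' p"
    and q: "frame_at M I D v q" "frame_at M I' D' v' q"
    and r: "frame_at M I D v r" "frame_at M I' D' v' r"
    and le: "r = e + p" "r = e' + q"
  shows "card {i \<in> I'. p \<in> D' i \<and> q \<in> D' i \<and> r \<in> D' i} \<le> card {i \<in> I. p \<in> D i \<and> q \<in> D i \<and> r \<in> D i}"
    (is "card ?L \<le> card ?J")
proof (rule independent_card_le)
  let ?w = "\<lambda>i. v i r" and ?w' = "\<lambda>i. v' i r"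
  let ?Ir = "{i \<in> I. r \<in> D i}" and ?Ir' = "{i \<in> I'. r \<in> D' i}"
  show "finite ?J" "finite ?L" using fin by auto
  have wr: "v i r \<in> carrier M" if "i \<in> ?Ir" for i
    using r(1) that piece_closed unfolding frame_at_def by blast
  have wr': "v' i r \<in> carrier M" if "i \<in> ?Ir'" for i
    using r(2) that piece_closed unfolding frame_at_def by blast
  show "v i r \<in> carrier M" if "i \<in> ?J" for i using wr that by blast
  show "v' i r \<in> carrier M" if "i \<in> ?L" for i using wr' that by blast
  show "\<forall>c. lin_comb M ?L c ?w' = \<zero> \<longrightarrow> (\<forall>l\<in>?L. c l = 0)"
  proof (intro allI impI)
    fix c assume c: "lin_comb M ?L c ?w' = \<zero>"
    let ?c = "\<lambda>i. if i \<in> ?L then c i else 0"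
    have "lin_comb M ?L c ?w' = (\<Oplus>i\<in>?Ir'. mact M 0 (?c i) (v' i r))"
      by (rule lin_comb_mono_neutral) (use fin wr' in auto)
    then have "lin_comb M ?Ir' ?c ?w' = \<zero>" using c by (simp only: lin_comb_def)
    then have "\<forall>i\<in>?Ir'. ?c i = 0" using r(2) unfolding frame_at_def by blast
    then show "\<forall>l\<in>?L. c l = 0" by auto
  qed
  show "\<forall>l\<in>?L. \<exists>c. v' l r = lin_comb M ?J c ?w"
  proof
    fix l assume l: "l \<in> ?L"
    have image: "\<exists>c. v' l r = lin_comb M ?Ir (\<lambda>i. if s \<in> D i then c i else 0) ?w"
      if s: "frame_at M I D v s" "frame_at M I' D' v' s" "s \<in> D' l" and b: "r = b + s" for s b
    proof -
      have vs: "v' l s \<in> piece M s" "mact M b a (v' l s) = (if b + s \<in> D' l then mact M 0 a (v' l (b + s)) else \<zero>)" for a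
        using s(2,3) l unfolding frame_at_def by blast+
      obtain c where c: "v' l s = lin_comb M {i \<in> I. s \<in> D i} c (\<lambda>i. v i s)"
        using s(1) vs(1) unfolding frame_at_def by blast
      have "v' l r = mact M b 1 (v' l s)" using vs(2)[of 1] wr'[of l] l b by simp
      also have "\<dots> = lin_comb M ?Ir (\<lambda>i. if s \<in> D i then c i else 0) ?w"
        unfolding c using frame_at_act[OF fin(1) s(1), of b 1 c] r(1) b by (simp cong: if_cong)
      finally show ?thesis by blast
    qed
    obtain c where c: "v' l r = lin_comb M ?Ir (\<lambda>i. if p \<in> D i then c i else 0) ?w"
      using image[OF p _ le(1)] l by blast
    obtain c' where c': "v' l r = lin_comb M ?Ir (\<lambda>i. if q \<in> D i then c' i else 0) ?w"
      using image[OF q _ le(2)] l by blast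
    have eq: "(if p \<in> D i then c i else 0) = (if q \<in> D i then c' i else 0)" if "i \<in> ?Ir" for i
    proof (rule lin_comb_unique[OF _ wr _ _ that])
      show "\<forall>c. lin_comb M ?Ir c ?w = \<zero> \<longrightarrow> (\<forall>i\<in>?Ir. c i = 0)" using r(1) unfolding frame_at_def by blast
      show "lin_comb M ?Ir (\<lambda>i. if p \<in> D i then c i else 0) ?w = lin_comb M ?Ir (\<lambda>i. if q \<in> D i then c' i else 0) ?w"
        using c c' by simp
    qed (use fin in auto)
    have "lin_comb M ?J c ?w = (\<Oplus>i\<in>?Ir. mact M 0 (if p \<in> D i then c i else 0) (v i r))"
    proof (rule lin_comb_mono_neutral)
      show "mact M 0 (if p \<in> D i then c i else 0) (v i r) = \<zero>" if "i \<in> ?Ir - ?J" for i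
      proof -
        have "(if p \<in> D i then c i else 0) = 0" using eq[of i] that by auto
        then show ?thesis using wr[of i] that by simp
      qed
    qed (use fin wr in auto)
    then have "v' l r = lin_comb M ?J c ?w" using c by (simp only: lin_comb_def)
    then show "\<exists>c. v' l r = lin_comb M ?J c ?w" by blast
  qed
qed

text \<open>
  For valid shapes \<open>below \<tau> \<sigma>\<close> means that \<open>\<sigma>\<close> contains \<open>\<tau>\<close> up to finitely many bidegrees. For example,
  a quadrant contains a vertical strip up to finitely many bidegrees if it does not begin to the right
  of the left edge of the strip.
\<close>

fun below :: "shape \<Rightarrow> shape \<Rightarrow> bool" where
  "below (Vert a b) (Vert a' b') \<longleftrightarrow> a' \<le> a \<and> b \<le> b'"
| "below (Vert a b) (Quad a1 a2) \<longleftrightarrow> a1 \<le> a"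
| "below (Horiz a b) (Horiz a' b') \<longleftrightarrow> a' \<le> a \<and> b \<le> b'"
| "below (Horiz a b) (Quad a1 a2) \<longleftrightarrow> a2 \<le> a"
| "below (Quad a1 a2) (Quad b1 b2) \<longleftrightarrow> b1 \<le> a1 \<and> b2 \<le> a2"
| "below _ _ \<longleftrightarrow> False"

text \<open>
  A bound for the coordinates of the corners of the shape.
\<close>

fun extent :: "shape \<Rightarrow> nat" where
  "extent (Vert a b) = a + b"
| "extent (Horiz a b) = a + b"
| "extent (Quad a b) = a + b"

text \<open>
  Three bidegrees \<open>p, q \<le> r\<close> of \<open>\<tau>\<close> that lie outside the box \<open>[0, n)\<^sup>2\<close> and detect the shapes above
  \<open>\<tau>\<close>, for large \<open>n\<close>. A quadrant is probed on both of its arms and in the middle, a strip at its first and at its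
  last position, which is \<open>b - 1\<close> since strips are half-open.
\<close>

fun probe :: "nat \<Rightarrow> shape \<Rightarrow> (nat \<times> nat) \<times> (nat \<times> nat) \<times> (nat \<times> nat)" where
  "probe n (Vert a b) = ((a, n), (a, n), (b - 1, n))"
| "probe n (Horiz a b) = ((n, a), (n, a), (n, b - 1))"
| "probe n (Quad a b) = ((a, n), (n, b), (n, n))"

lemma probe_in_region_iff:
  assumes "valid \<tau>" "valid \<sigma>" "extent \<tau> \<le> n" "extent \<sigma> \<le> n" "probe n \<tau> = (p, q, r)"
  shows "p \<in> region \<sigma> \<and> q \<in> region \<sigma> \<and> r \<in> region \<sigma> \<longleftrightarrow> below \<tau> \<sigma>"
  using assms by (cases \<tau>; cases \<sigma>) auto

lemma probe_le:
  assumes "valid \<tau>" "extent \<tau> \<le> n" "probe n \<tau> = (p, q, r)"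
  shows "far n p" "far n q" "far n r" "\<exists>e. r = e + p" "\<exists>e. r = e + q"
proof -
  have ex: "\<exists>e. r = e + p" if "p \<le> r" for p r :: "nat \<times> nat"
    using that by (intro exI[of _ "r - p"]) (cases p; cases r; simp)
  have "far n p \<and> far n q \<and> far n r \<and> p \<le> r \<and> q \<le> r"
  proof (cases \<tau>)
    case (Vert a b)
    then have "p = (a, n)" "q = (a, n)" "r = (b - 1, n)" "a < b" using assms by auto
    then show ?thesis by (simp add: far_def)
  next
    case (Horiz a b)
    then have "p = (n, a)" "q = (n, a)" "r = (n, b - 1)" "a < b" using assms by auto
    then show ?thesis by (simp add: far_def)
  next
    case (Quad a b)
    then have "p = (a, n)" "q = (n, b)" "r = (n, n)" "a + b \<le> n" using assms by auto
    then show ?thesis by (simp add: far_def)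
  qed
  then show "far n p" "far n q" "far n r" "\<exists>e. r = e + p" "\<exists>e. r = e + q"
    using ex by blast+
qed

lemma below_refl: "below \<sigma> \<sigma>"
  by (cases \<sigma>) auto

lemma below_antisym: "below \<sigma> \<tau> \<Longrightarrow> below \<tau> \<sigma> \<Longrightarrow> \<sigma> = \<tau>"
  by (cases \<sigma>; cases \<tau>) auto

lemma below_trans: "below \<rho> \<sigma> \<Longrightarrow> below \<sigma> \<tau> \<Longrightarrow> below \<rho> \<tau>"
  by (cases \<rho>; cases \<sigma>; cases \<tau>) auto

text \<open>
  Remove the common part of the two multisets. A maximal element \<open>\<mu>\<close> among those that remain is the only
  remaining shape above \<open>\<mu>\<close>, so the counts above \<open>\<mu>\<close> differ between the two sides.
\<close>

lemma multiset_eq_if_counts_below: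
  assumes valid: "\<forall>\<sigma>\<in>set_mset (A + B). valid \<sigma>"
    and counts: "\<forall>\<tau>. valid \<tau> \<longrightarrow> size (filter_mset (below \<tau>) A) = size (filter_mset (below \<tau>) B)"
  shows "A = B"
proof (rule ccontr)
  assume "A \<noteq> B"
  let ?A = "A - B" and ?B = "B - A" and ?R = "\<lambda>\<sigma> \<tau>. below \<sigma> \<tau> \<and> \<sigma> \<noteq> \<tau>"
  have AB: "A = (A \<inter># B) + ?A" "B = (A \<inter># B) + ?B"
    by (auto simp: multiset_eq_iff min_def)
  have disj: "\<sigma> \<notin># ?B" if "\<sigma> \<in># ?A" for \<sigma>
    using that by (simp add: in_diff_count)
  have diff: "size (filter_mset (below \<tau>) ?A) = size (filter_mset (below \<tau>) ?B)" if "valid \<tau>" for \<tau>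
  proof -
    have "size (filter_mset (below \<tau>) A) = size (filter_mset (below \<tau>) (A \<inter># B)) + size (filter_mset (below \<tau>) ?A)"
      "size (filter_mset (below \<tau>) B) = size (filter_mset (below \<tau>) (A \<inter># B)) + size (filter_mset (below \<tau>) ?B)"
      using AB by (metis filter_union_mset size_union)+
    then show ?thesis using counts that by simp
  qed
  have "set_mset (?A + ?B) \<noteq> {}"
    using AB \<open>A \<noteq> B\<close> by (metis add.right_neutral set_mset_eq_empty_iff union_eq_empty)
  moreover have "asymp_on (set_mset (?A + ?B)) ?R"
    by (rule asymp_onI) (use below_antisym in blast)
  moreover have "transp_on (set_mset (?A + ?B)) ?R"
  proof (rule transp_onI)
    fix \<rho> \<sigma> \<tau> assume "?R \<rho> \<sigma>" "?R \<sigma> \<tau>"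
    then show "?R \<rho> \<tau>" using below_trans below_antisym by blast
  qed
  ultimately obtain \<mu> where \<mu>: "\<mu> \<in> set_mset (?A + ?B)" "\<forall>\<tau>\<in>set_mset (?A + ?B). \<tau> \<noteq> \<mu> \<longrightarrow> \<not> ?R \<mu> \<tau>"
    using Finite_Set.bex_max_element[of "set_mset (?A + ?B)" ?R] finite_set_mset by blast
  have v: "valid \<mu>"
    using \<mu>(1) valid by (auto dest: in_diffD)
  have sub: False if "\<mu> \<in># X" "set_mset Y \<subseteq> set_mset (?A + ?B)" "\<mu> \<notin># Y"
    "size (filter_mset (below \<mu>) X) = size (filter_mset (below \<mu>) Y)" for X Y
  proof -
    have "\<mu> \<in># filter_mset (below \<mu>) X" using that(1) below_refl by simp
    then have "filter_mset (below \<mu>) Y \<noteq> {#}" using that(4) by (metis size_eq_0_iff_empty empty_iff set_mset_empty)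
    then obtain \<tau> where "\<tau> \<in># filter_mset (below \<mu>) Y" by (metis multiset_nonemptyE)
    then have "\<tau> \<in># Y" "below \<mu> \<tau>" by simp_all
    moreover from this have "\<tau> \<noteq> \<mu>" using that(3) by metis
    moreover have "\<tau> \<in> set_mset (?A + ?B)" using that(2) \<open>\<tau> \<in># Y\<close> by (rule subsetD)
    ultimately show False using \<mu>(2) by metis
  qed
  consider "\<mu> \<in># ?A" | "\<mu> \<in># ?B" using \<mu>(1) by auto
  then show False
  proof cases
    case 1
    then show ?thesis using sub[of ?A ?B] disj diff[OF v] by auto
  next
    case 2
    then show ?thesis using sub[of ?B ?A] disj diff[OF v] by auto
  qed
qed

section \<open>The decomposition theorem\<close>

lemma qiso_refl:
  assumes "fg_kst_module S"
  shows "qiso S S"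
proof -
  interpret fg_kst_module S by fact
  interpret P: fg_triple S S S by unfold_locales
  have "qid S \<in> qhom S S" unfolding qid_germ_class by (rule P.MN.germ_class_in_qhom[OF germ_id])
  moreover have "qcomp S S (qid S) (qid S) = qid S"
    unfolding qid_germ_class by (rule P.qcomp_germ_class[OF germ_id germ_id])
  ultimately show ?thesis unfolding qiso_def by blast
qed

context fg_kst_module
begin

lemma decomposition_exists:
  "\<exists>Ss :: ('k kst, 'k kst set) gmodule list. (\<forall>S\<in>set Ss. strip_or_quadrant S) \<and> is_qdirect_sum M Ss"
proof -
  obtain I :: "(('m \<Rightarrow> 'k) + ('m \<Rightarrow> 'k) + ('m \<Rightarrow> 'k)) set" and \<sigma> v
    where I: "\<forall>i\<in>I. valid (\<sigma> i)" "frame M I (\<lambda>i. region (\<sigma> i)) v"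
    using frame_exists by blast
  have "finite I" using I(2) by (simp add: frame_def)
  then obtain h where h: "bij_betw h {..<card I} I"
    using ex_bij_betw_nat_finite by (metis atLeast0LessThan)
  let ?S = "\<lambda>j. module_of (\<sigma> (h j)) :: ('k kst, 'k kst set) gmodule"
  let ?Ss = "map ?S [0..<card I]"
  have valid: "valid (\<sigma> (h j))" if "j < card I" for j
    using I(1) bij_betwE[OF h] that by blast
  have "\<forall>j. \<exists>e. j < card I \<longrightarrow> interval_module (?S j) (region (\<sigma> (h j))) e"
    using module_of_interval valid by blast
  then obtain e where e: "\<forall>j. j < card I \<longrightarrow> interval_module (?S j) (region (\<sigma> (h j))) (e j)" by metis
  interpret interval_family M ?Ss "\<lambda>j. region (\<sigma> (h j))" e
    by unfold_locales (use e in simp)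
  have "is_qdirect_sum M ?Ss"
    by (rule frame_imp_qdirect_sum) (use frame_reindex[OF I(2) h] in simp)
  moreover have "strip_or_quadrant (?S j)" if "j < card I" for j
    using valid[OF that] strip_or_quadrant_iff by blast
  then have "\<forall>S\<in>set ?Ss. strip_or_quadrant S" by auto
  ultimately show ?thesis by blast
qed

lemma decomposition_frame:
  fixes Ss :: "('k kst, 'k kst set) gmodule list"
  assumes "\<forall>S\<in>set Ss. strip_or_quadrant S" "is_qdirect_sum M Ss"
  obtains \<sigma>s v where "Ss = map module_of \<sigma>s" "\<forall>\<sigma>\<in>set \<sigma>s. valid \<sigma>"
    "frame M {..<length \<sigma>s} (\<lambda>j. region (\<sigma>s ! j)) v"
proof -
  have "\<forall>S\<in>set Ss. \<exists>\<sigma>. valid \<sigma> \<and> S = module_of \<sigma>"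
    using assms(1) by (simp add: strip_or_quadrant_iff)
  then obtain f where f: "\<forall>S\<in>set Ss. valid (f S) \<and> S = module_of (f S)" by metis
  let ?\<sigma>s = "map f Ss"
  have Ss: "Ss = map module_of ?\<sigma>s" using f by (simp add: map_idI)
  have nth: "Ss ! j = module_of (?\<sigma>s ! j) \<and> valid (?\<sigma>s ! j)" if "j < length Ss" for j
    using f that by simp
  have "\<forall>j. \<exists>e. j < length Ss \<longrightarrow> interval_module (Ss ! j) (region (?\<sigma>s ! j)) e"
    using nth module_of_interval by metis
  then obtain e where e: "\<forall>j. j < length Ss \<longrightarrow> interval_module (Ss ! j) (region (?\<sigma>s ! j)) (e j)" by metis
  interpret interval_family M Ss "\<lambda>j. region (?\<sigma>s ! j)" e
    by unfold_locales (use e in simp)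
  obtain v where "frame M {..<length Ss} (\<lambda>j. region (?\<sigma>s ! j)) v"
    using qdirect_sum_imp_frame[OF assms(2)] by blast
  then show thesis using that[of ?\<sigma>s v] Ss f by simp
qed

lemma frame_shapes_unique:
  assumes "\<forall>\<sigma>\<in>set \<sigma>s. valid \<sigma>" "\<forall>\<sigma>\<in>set \<tau>s. valid \<sigma>"
    and f: "frame M {..<length \<sigma>s} (\<lambda>j. region (\<sigma>s ! j)) v"
    and f': "frame M {..<length \<tau>s} (\<lambda>j. region (\<tau>s ! j)) v'"
  shows "mset \<sigma>s = mset \<tau>s"
proof (rule multiset_eq_if_counts_below)
  show "\<forall>\<sigma>\<in>set_mset (mset \<sigma>s + mset \<tau>s). valid \<sigma>" using assms(1,2) by auto
  show "\<forall>\<rho>. valid \<rho> \<longrightarrow> size (filter_mset (below \<rho>) (mset \<sigma>s)) = size (filter_mset (below \<rho>) (mset \<tau>s))"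
  proof (intro allI impI)
    fix \<rho> assume \<rho>: "valid \<rho>"
    have "\<forall>\<^sub>F d in cofinite. frame_at M {..<length \<sigma>s} (\<lambda>j. region (\<sigma>s ! j)) v d \<and>
        frame_at M {..<length \<tau>s} (\<lambda>j. region (\<tau>s ! j)) v' d"
      using f f' unfolding frame_def by (intro eventually_conj) blast+
    then obtain m where m: "\<forall>d. far m d \<longrightarrow> frame_at M {..<length \<sigma>s} (\<lambda>j. region (\<sigma>s ! j)) v d \<and>
        frame_at M {..<length \<tau>s} (\<lambda>j. region (\<tau>s ! j)) v' d"
      unfolding eventually_far by blast
    obtain n where n: "m \<le> n" "extent \<rho> \<le> n" "\<forall>\<sigma>\<in>set \<sigma>s \<union> set \<tau>s. extent \<sigma> \<le> n"
    proof
      (* Outside this box both frames are valid and all shapes are told apart by the probes. *)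
      let ?n = "m + extent \<rho> + (\<Sum>\<sigma>\<in>set \<sigma>s \<union> set \<tau>s. extent \<sigma>)"
      have "extent \<sigma> \<le> (\<Sum>\<sigma>\<in>set \<sigma>s \<union> set \<tau>s. extent \<sigma>)" if "\<sigma> \<in> set \<sigma>s \<union> set \<tau>s" for \<sigma>
        using that by (intro member_le_sum) auto
      then show "\<forall>\<sigma>\<in>set \<sigma>s \<union> set \<tau>s. extent \<sigma> \<le> ?n" by (meson le_add2 order_trans)
    qed auto
    obtain p q r where pqr: "probe n \<rho> = (p, q, r)" by (cases "probe n \<rho>")
    note pr = probe_le[OF \<rho> n(2) pqr]
    obtain e e' where e: "r = e + p" "r = e' + q" using pr(4,5) by blast
    have fr: "frame_at M {..<length \<sigma>s} (\<lambda>j. region (\<sigma>s ! j)) v d"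
      "frame_at M {..<length \<tau>s} (\<lambda>j. region (\<tau>s ! j)) v' d" if "far n d" for d
      using m far_mono[OF that n(1)] by blast+
    have count: "size (filter_mset (below \<rho>) (mset xs)) =
        card {j \<in> {..<length xs}. p \<in> region (xs ! j) \<and> q \<in> region (xs ! j) \<and> r \<in> region (xs ! j)}"
      if xs: "\<forall>\<sigma>\<in>set xs. valid \<sigma> \<and> extent \<sigma> \<le> n" for xs
    proof -
      have "size (filter_mset (below \<rho>) (mset xs)) = length (filter (below \<rho>) xs)"
        by (simp flip: mset_filter)
      also have "\<dots> = card {j. j < length xs \<and> below \<rho> (xs ! j)}" by (rule length_filter_conv_card)
      also have "{j. j < length xs \<and> below \<rho> (xs ! j)} =
          {j \<in> {..<length xs}. p \<in> region (xs ! j) \<and> q \<in> region (xs ! j) \<and> r \<in> region (xs ! j)}"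
        using probe_in_region_iff[OF \<rho> _ n(2) _ pqr] xs nth_mem by blast
      finally show ?thesis .
    qed
    show "size (filter_mset (below \<rho>) (mset \<sigma>s)) = size (filter_mset (below \<rho>) (mset \<tau>s))"
      using count[of \<sigma>s] count[of \<tau>s] assms(1,2) n(3)
        frame_count_le[OF _ _ fr[OF pr(1)] fr[OF pr(2)] fr[OF pr(3)] e]
        frame_count_le[OF _ _ fr(2,1)[OF pr(1)] fr(2,1)[OF pr(2)] fr(2,1)[OF pr(3)] e]
      by (simp add: le_antisym)
  qed
qed

lemma decomposition_unique:
  fixes Ss Ts :: "('k kst, 'k kst set) gmodule list"
  assumes "\<forall>S\<in>set Ss. strip_or_quadrant S" "is_qdirect_sum M Ss"
    and "\<forall>T\<in>set Ts. strip_or_quadrant T" "is_qdirect_sum M Ts"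
  shows "length Ss = length Ts \<and> (\<exists>p. p permutes {..<length Ss} \<and> (\<forall>j<length Ss. qiso (Ss ! j) (Ts ! p j)))"
proof -
  obtain \<sigma>s v where s: "Ss = map module_of \<sigma>s" "\<forall>\<sigma>\<in>set \<sigma>s. valid \<sigma>"
    "frame M {..<length \<sigma>s} (\<lambda>j. region (\<sigma>s ! j)) v"
    using decomposition_frame[OF assms(1,2)] by blast
  obtain \<tau>s v' where t: "Ts = map module_of \<tau>s" "\<forall>\<sigma>\<in>set \<tau>s. valid \<sigma>"
    "frame M {..<length \<tau>s} (\<lambda>j. region (\<tau>s ! j)) v'"
    using decomposition_frame[OF assms(3,4)] by blast
  have eq: "mset \<sigma>s = mset \<tau>s" by (rule frame_shapes_unique[OF s(2) t(2) s(3) t(3)])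
  then have len: "length \<sigma>s = length \<tau>s" by (rule mset_eq_length)
  obtain p where p: "p permutes {..<length \<tau>s}" "permute_list p \<tau>s = \<sigma>s"
    using mset_eq_permutation[OF eq] by blast
  have "qiso (Ss ! j) (Ts ! p j)" if j: "j < length Ss" for j
  proof -
    have pj: "p j < length \<tau>s" using permutes_in_image[OF p(1), of j] j s(1) len by simp
    have "\<sigma>s ! j = \<tau>s ! p j"
      using permute_list_nth[OF p(1), of j] p(2) j s(1) len by simp
    then have "Ss ! j = Ts ! p j" using j pj s(1) t(1) by simp
    moreover have "fg_kst_module (Ss ! j)"
      using module_of_interval[of "\<sigma>s ! j"] s j interval_moduleD(1) by fastforce
    ultimately show ?thesis using qiso_refl by metis
  qed
  then show ?thesis using p(1) len s(1) t(1) by auto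
qed

end

theorem theoremA:
  fixes M :: "('k::field kst, 'm) gmodule"
  assumes "fg_graded_module M"
  shows "(\<exists>Ss :: ('k kst, 'k kst set) gmodule list.
            (\<forall>S\<in>set Ss. strip_or_quadrant S) \<and> is_qdirect_sum M Ss) \<and>
         (\<forall>Ss Ts :: ('k kst, 'k kst set) gmodule list.
            (\<forall>S\<in>set Ss. strip_or_quadrant S) \<and> is_qdirect_sum M Ss \<and>
            (\<forall>T\<in>set Ts. strip_or_quadrant T) \<and> is_qdirect_sum M Ts \<longrightarrow>
            length Ss = length Ts \<and>
            (\<exists>p. p permutes {..<length Ss} \<and> (\<forall>j<length Ss. qiso (Ss ! j) (Ts ! p j))))"
proof -
  interpret fg_kst_module M using assms by (rule fg_kst_moduleI)
  show ?thesis using decomposition_exists decomposition_unique by blast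
qed

end
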